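(* Let $\lambda>0$ and let $L$ be a two-sided real-valued Lévy process possessing a finite second moment. Denote by $V$ the variance and by $\mu$ the first moment of $L_1$, and assume $V>0$ for the correlation formula. Let $$X_t=\int_{-\infty}^\infty e^{-\lambda|t-u|}\,dL_u,\qquad t\ge0 .$$ Then for all $t\ge0$ and $h\ge0$ $$E X_t=\frac{2\mu}{\lambda},\qquad \operatorname{Var}(X_t)=\frac{V}{\lambda},$$ $$\operatorname{Cov}(X_{t+h},X_t)=V h e^{-\lambda h}+\frac{V}{\lambda}e^{-\lambda h},\qquad \operatorname{Corr}(X_{t+h},X_t)=\lambda h e^{-\lambda h}+e^{-\lambda h}.$$
   Context: The two-sided Lévy process is obtained from two independent copies $L^{(1)},L^{(2)}$ of a Lévy process on $[0,\infty)$ by $L_t=L^{(1)}_t$ for $t\ge0$ and $L_t=-L^{(2)}_{(-t)-}$ for $t<0$. Integrals of deterministic functions over $\mathbb{R}$ with respect to $L$ are meant in the sense of Rajput and Rosinski: with $\Lambda$ the independently scattered random measure on bounded Borel sets associated with $L$ (so $\Lambda((a,b])=L_b-L_a$), a measurable $f$ is integrable if there are step functions $g_n\to f$ Lebesgue-a.e. such that $\lim_n\int_Ag_n\,d\Lambda$ exists in probability for every Borel set $A$, and then $\int_{\mathbb{R}} f\,dL_s=\lim_n\int_{\mathbb{R}} g_n\,d\Lambda$. Under the stated assumptions the integrals defining $X_t$ exist. *)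

theory Defs
  imports "HOL-Probability.Probability"
begin

definition cadlag_on_nonneg :: "(real \<Rightarrow> real) \<Rightarrow> bool" where
  "cadlag_on_nonneg x \<longleftrightarrow>
     (\<forall>t\<ge>0. (x \<longlongrightarrow> x t) (at_right t)) \<and>
     (\<forall>t>0. \<exists>l. (x \<longlongrightarrow> l) (at_left t))"

definition bounded_borel :: "real set set" where
  "bounded_borel = {A \<in> sets borel. bounded A}"

text \<open>Step functions are the finite linear combinations of indicators of bounded Borel sets.
  Their integral uses the canonical representation (the level sets of the non-zero values),
  so that only values of \<open>\<Lambda>\<close> on bounded Borel sets occur.\<close>

definition step_function :: "(real \<Rightarrow> real) \<Rightarrow> bool" where
  "step_function g \<longleftrightarrow> simple_function borel g \<and> bounded {x. g x \<noteq> 0}"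

definition step_integral :: "(real set \<Rightarrow> 'a \<Rightarrow> real) \<Rightarrow> real set \<Rightarrow> (real \<Rightarrow> real) \<Rightarrow> 'a \<Rightarrow> real" where
  "step_integral \<Lambda> A g \<omega> = (\<Sum>y\<in>range g - {0}. y * \<Lambda> (A \<inter> g -` {y}) \<omega>)"

context prob_space
begin

definition covariance :: "('a \<Rightarrow> real) \<Rightarrow> ('a \<Rightarrow> real) \<Rightarrow> real" where
  "covariance X Y = expectation (\<lambda>\<omega>. (X \<omega> - expectation X) * (Y \<omega> - expectation Y))"

definition correlation :: "('a \<Rightarrow> real) \<Rightarrow> ('a \<Rightarrow> real) \<Rightarrow> real" where
  "correlation X Y = covariance X Y / (sqrt (variance X) * sqrt (variance Y))"

definition tendsto_in_prob :: "('i \<Rightarrow> 'a \<Rightarrow> real) \<Rightarrow> ('a \<Rightarrow> real) \<Rightarrow> 'i filter \<Rightarrow> bool" where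
  "tendsto_in_prob Y Z F \<longleftrightarrow>
     (\<forall>e>0. ((\<lambda>i. prob {\<omega> \<in> space M. \<bar>Y i \<omega> - Z \<omega>\<bar> > e}) \<longlongrightarrow> 0) F)"

text \<open>A Levy process on \<open>[0,\<infinity>)\<close>; its values at negative times are irrelevant.\<close>

definition levy_process :: "(real \<Rightarrow> 'a \<Rightarrow> real) \<Rightarrow> bool" where
  "levy_process L \<longleftrightarrow>
     (\<forall>t\<ge>0. random_variable borel (L t)) \<and>
     (AE \<omega> in M. L 0 \<omega> = 0) \<and>
     (\<forall>(n::nat) t. 0 \<le> t 0 \<and> mono t \<longrightarrow>
        indep_vars (\<lambda>_. borel) (\<lambda>i \<omega>. L (t (Suc i)) \<omega> - L (t i) \<omega>) {..<n}) \<and>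
     (\<forall>s\<ge>0. \<forall>h\<ge>0. distr M borel (\<lambda>\<omega>. L (s + h) \<omega> - L s \<omega>) = distr M borel (L h)) \<and>
     (\<forall>s\<ge>0. tendsto_in_prob L (L s) (at s within {0..})) \<and>
     (AE \<omega> in M. cadlag_on_nonneg (\<lambda>t. L t \<omega>))"

definition independent_copies :: "(real \<Rightarrow> 'a \<Rightarrow> real) \<Rightarrow> (real \<Rightarrow> 'a \<Rightarrow> real) \<Rightarrow> bool" where
  "independent_copies L1 L2 \<longleftrightarrow>
     indep_var (PiM {0..} (\<lambda>_. borel)) (\<lambda>\<omega>. \<lambda>t\<in>{0..}. L1 t \<omega>)
               (PiM {0..} (\<lambda>_. borel)) (\<lambda>\<omega>. \<lambda>t\<in>{0..}. L2 t \<omega>) \<and>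
     distr M (PiM {0..} (\<lambda>_. borel)) (\<lambda>\<omega>. \<lambda>t\<in>{0..}. L1 t \<omega>) =
     distr M (PiM {0..} (\<lambda>_. borel)) (\<lambda>\<omega>. \<lambda>t\<in>{0..}. L2 t \<omega>)"

text \<open>Paths are only almost surely cadlag, so the left limit need not exist on a null set;
  the pathwise identity is therefore required almost surely, simultaneously for all times.\<close>

definition two_sided_levy_process :: "(real \<Rightarrow> 'a \<Rightarrow> real) \<Rightarrow> bool" where
  "two_sided_levy_process L \<longleftrightarrow>
     (\<forall>t. random_variable borel (L t)) \<and>
     (\<exists>L1 L2. levy_process L1 \<and> levy_process L2 \<and> independent_copies L1 L2 \<and>
        (AE \<omega> in M. \<forall>t. L t \<omega> =
           (if t \<ge> 0 then L1 t \<omega> else - Lim (at_left (- t)) (\<lambda>s. L2 s \<omega>))))"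

definition independently_scattered :: "(real set \<Rightarrow> 'a \<Rightarrow> real) \<Rightarrow> bool" where
  "independently_scattered \<Lambda> \<longleftrightarrow>
     (\<forall>A\<in>bounded_borel. random_variable borel (\<Lambda> A)) \<and>
     (\<forall>A :: nat \<Rightarrow> real set. range A \<subseteq> bounded_borel \<and> disjoint_family A \<longrightarrow>
        indep_vars (\<lambda>_. borel) (\<lambda>n. \<Lambda> (A n)) UNIV \<and>
        ((\<Union>n. A n) \<in> bounded_borel \<longrightarrow>
           (AE \<omega> in M. (\<lambda>n. \<Lambda> (A n) \<omega>) sums \<Lambda> (\<Union>n. A n) \<omega>)))"

definition is_random_measure_of :: "(real set \<Rightarrow> 'a \<Rightarrow> real) \<Rightarrow> (real \<Rightarrow> 'a \<Rightarrow> real) \<Rightarrow> bool" where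
  "is_random_measure_of \<Lambda> L \<longleftrightarrow> independently_scattered \<Lambda> \<and>
     (\<forall>a b. a \<le> b \<longrightarrow> (AE \<omega> in M. \<Lambda> {a<..b} \<omega> = L b \<omega> - L a \<omega>))"

text \<open>The random measure of a process and the integrals below are determined only up to
  almost sure equality; Hilbert choice fixes a version.\<close>

definition random_measure_of :: "(real \<Rightarrow> 'a \<Rightarrow> real) \<Rightarrow> real set \<Rightarrow> 'a \<Rightarrow> real" where
  "random_measure_of L = (SOME \<Lambda>. is_random_measure_of \<Lambda> L)"

definition has_random_integral ::
    "(real set \<Rightarrow> 'a \<Rightarrow> real) \<Rightarrow> (real \<Rightarrow> real) \<Rightarrow> ('a \<Rightarrow> real) \<Rightarrow> bool" where
  "has_random_integral \<Lambda> f Y \<longleftrightarrow>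
     f \<in> borel_measurable borel \<and> random_variable borel Y \<and>
     (\<exists>g :: nat \<Rightarrow> real \<Rightarrow> real.
        (\<forall>n. step_function (g n)) \<and>
        (AE x in lborel. (\<lambda>n. g n x) \<longlonglongrightarrow> f x) \<and>
        (\<forall>A\<in>sets borel. \<exists>Z. random_variable borel Z \<and>
           tendsto_in_prob (\<lambda>n. step_integral \<Lambda> A (g n)) Z sequentially) \<and>
        tendsto_in_prob (\<lambda>n. step_integral \<Lambda> UNIV (g n)) Y sequentially)"

definition levy_integral :: "(real \<Rightarrow> 'a \<Rightarrow> real) \<Rightarrow> (real \<Rightarrow> real) \<Rightarrow> 'a \<Rightarrow> real" where
  "levy_integral L f = (SOME Y. has_random_integral (random_measure_of L) f Y)"

end

end

theory Submission
  imports Defs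
begin

text \<open>
  Polarisation of \<open>E (L t - L s)\<^sup>2 = V |t - s| + \<mu>\<^sup>2 (t - s)\<^sup>2\<close> gives
  \<open>E (I f * I g) = V * \<integral>f g + \<mu>\<^sup>2 * \<integral>f * \<integral>g\<close> for the integral \<open>I\<close> of step functions over half-open
  intervals, so \<open>I\<close> extends to all \<open>f \<in> L\<^sup>1 \<inter> L\<^sup>2\<close>, and the claimed moments are the values of this formula
  at the kernels \<open>exp (- lam * |t - u|)\<close>. What remains is to identify \<open>I f\<close> with the Rajput-Rosinski integral.
  The random variables \<open>I (indicator A)\<close> form an independently scattered random measure: independence
  passes to limits from the increments of a grid, and almost sure \<open>\<sigma>\<close>-additivity comes from Kolmogorov's
  inequality. By a Dynkin argument every random measure of \<open>L\<close> is a version of it. Finally, if step functions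
  \<open>g n\<close> tend to \<open>f\<close> almost everywhere and their integrals over every Borel set converge in
  probability, a sliding hump argument shows that the limit over the line is \<open>I f\<close>.
\<close>

section \<open>Square integrable functions\<close>

text \<open>\<open>levy_integral\<close> is a Hilbert choice, so of the chosen limit nothing is
  known except that some step functions, converging almost everywhere without any domination,
  produce it. Convergence in probability over every Borel set has to replace domination; hence the
  sliding hump, a Vitali-Hahn-Saks argument run with the subadditive functional E min(1, |Y|) in
  place of a norm. The random measure is an arbitrary choice too, so existence and uniqueness are
  both proved for it. The space is the intersection of L1 and L2 because the drift contributes the
  squared integral of f, which the L2 norm does not control. The two-sided process is glued at time
  0 from two independent copies, so independence of increments is set up along grids through 0, and
  every grid is refined to contain that point. Mean and variance are linear in time by Cauchy's
  functional equation. Stochastic continuity supplies the local bound for the mean, and it also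
  removes the left limits that define the process at negative times.\<close>

definition sq_integrable :: "'b measure \<Rightarrow> ('b \<Rightarrow> real) \<Rightarrow> bool" where
  "sq_integrable N f \<longleftrightarrow> f \<in> borel_measurable N \<and> integrable N (\<lambda>x. (f x)\<^sup>2)"

lemma sq_integrable_measurable [measurable_dest]:
  "sq_integrable N f \<Longrightarrow> f \<in> borel_measurable N"
  by (simp add: sq_integrable_def)

lemma sq_integrable_square: "sq_integrable N f \<Longrightarrow> integrable N (\<lambda>x. (f x)\<^sup>2)"
  by (simp add: sq_integrable_def)

lemma sq_integrable_mult:
  assumes "sq_integrable N f" "sq_integrable N g"
  shows "integrable N (\<lambda>x. f x * g x)"
proof (rule Bochner_Integration.integrable_bound)
  show "integrable N (\<lambda>x. (f x)\<^sup>2 + (g x)\<^sup>2)"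
    using assms by (auto simp: sq_integrable_def)
  show "(\<lambda>x. f x * g x) \<in> borel_measurable N"
    using assms by (auto simp: sq_integrable_def)
  have "\<bar>a * b\<bar> \<le> \<bar>a\<^sup>2 + b\<^sup>2\<bar>" for a b :: real
  proof -
    have "0 \<le> (\<bar>a\<bar> - \<bar>b\<bar>)\<^sup>2" "0 \<le> a\<^sup>2 + b\<^sup>2" by auto
    then have "2 * (\<bar>a\<bar> * \<bar>b\<bar>) \<le> a\<^sup>2 + b\<^sup>2" by (simp add: power2_diff)
    moreover have "0 \<le> \<bar>a\<bar> * \<bar>b\<bar>" by simp
    ultimately have "\<bar>a\<bar> * \<bar>b\<bar> \<le> a\<^sup>2 + b\<^sup>2" by linarith
    then show ?thesis by (simp add: abs_mult)
  qed
  then show "AE x in N. norm (f x * g x) \<le> norm ((f x)\<^sup>2 + (g x)\<^sup>2)"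
    by simp
qed

lemma sq_integrable_cmult: "sq_integrable N f \<Longrightarrow> sq_integrable N (\<lambda>x. c * f x)"
  by (auto simp: sq_integrable_def power_mult_distrib)

lemma sq_integrable_add:
  assumes "sq_integrable N f" "sq_integrable N g"
  shows "sq_integrable N (\<lambda>x. f x + g x)"
  using assms sq_integrable_mult[OF assms]
  by (auto simp: sq_integrable_def power2_sum mult.assoc)

lemma sq_integrable_diff:
  assumes "sq_integrable N f" "sq_integrable N g"
  shows "sq_integrable N (\<lambda>x. f x - g x)"
  using sq_integrable_add[OF assms(1) sq_integrable_cmult[OF assms(2), of "-1"]] by simp

lemma sq_integrable_zero: "sq_integrable N (\<lambda>x. 0)"
  by (simp add: sq_integrable_def)

lemma sq_integrable_sum:
  "(\<And>i. i \<in> I \<Longrightarrow> sq_integrable N (f i)) \<Longrightarrow> sq_integrable N (\<lambda>x. \<Sum>i\<in>I. f i x)"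
  by (induction I rule: infinite_finite_induct)
    (auto intro: sq_integrable_add sq_integrable_zero)

lemma integral_square_add:
  assumes "sq_integrable N f" "sq_integrable N g"
  shows "(\<integral>x. (f x + g x)\<^sup>2 \<partial>N) = (\<integral>x. (f x)\<^sup>2 \<partial>N) + 2 * (\<integral>x. f x * g x \<partial>N) + (\<integral>x. (g x)\<^sup>2 \<partial>N)"
  using assms sq_integrable_mult[OF assms]
  by (simp add: power2_sum sq_integrable_def mult.assoc)

lemma integral_square_diff:
  assumes "sq_integrable N f" "sq_integrable N g"
  shows "(\<integral>x. (f x - g x)\<^sup>2 \<partial>N) = (\<integral>x. (f x)\<^sup>2 \<partial>N) - 2 * (\<integral>x. f x * g x \<partial>N) + (\<integral>x. (g x)\<^sup>2 \<partial>N)"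
  using assms sq_integrable_mult[OF assms]
  by (simp add: power2_diff sq_integrable_def mult.assoc)

text \<open>The parallelogram identity with the square of \<open>f - g\<close> dropped.\<close>

lemma integral_square_add_le:
  assumes "sq_integrable N f" "sq_integrable N g"
  shows "(\<integral>x. (f x + g x)\<^sup>2 \<partial>N) \<le> 2 * (\<integral>x. (f x)\<^sup>2 \<partial>N) + 2 * (\<integral>x. (g x)\<^sup>2 \<partial>N)"
proof -
  have "0 \<le> (\<integral>x. (f x - g x)\<^sup>2 \<partial>N)" by simp
  then show ?thesis
    unfolding integral_square_add[OF assms] integral_square_diff[OF assms] by simp
qed

lemma integral_mult_le_sqrt:
  assumes "sq_integrable N f" "sq_integrable N g"
  shows "\<bar>\<integral>x. f x * g x \<partial>N\<bar> \<le> sqrt (\<integral>x. (f x)\<^sup>2 \<partial>N) * sqrt (\<integral>x. (g x)\<^sup>2 \<partial>N)"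
proof -
  define a b c where "a = (\<integral>x. (f x)\<^sup>2 \<partial>N)" and "b = (\<integral>x. (g x)\<^sup>2 \<partial>N)" and "c = (\<integral>x. f x * g x \<partial>N)"
  have q: "0 \<le> a + 2 * t * c + t\<^sup>2 * b" for t
  proof -
    have "0 \<le> (\<integral>x. (f x + t * g x)\<^sup>2 \<partial>N)" by simp
    also have "\<dots> = a + 2 * t * c + t\<^sup>2 * b"
      using integral_square_add[OF assms(1) sq_integrable_cmult[OF assms(2), of t]]
      by (simp add: a_def b_def c_def power_mult_distrib mult.left_commute)
    finally show ?thesis .
  qed
  have nn: "0 \<le> a" "0 \<le> b" by (simp_all add: a_def b_def)
  have "c\<^sup>2 \<le> a * b"
  proof (cases "b = 0")
    case True
    have "c = 0"
    proof (rule ccontr)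
      assume "c \<noteq> 0"
      \<comment> \<open>With \<open>b = 0\<close> the quadratic is affine in \<open>t\<close>; this
        \<open>t\<close> gives it the value -1.\<close>
      then show False using q[of "- (a + 1) / (2 * c)"] True by (simp add: field_simps)
    qed
    then show ?thesis using nn by simp
  next
    case False
    then have "b > 0" using nn by simp
    \<comment> \<open>The minimiser of the quadratic in \<open>t\<close>.\<close>
    with q[of "- c / b"] show ?thesis by (simp add: field_simps power2_eq_square)
  qed
  then have "sqrt (c\<^sup>2) \<le> sqrt (a * b)" by (rule real_sqrt_le_mono)
  then show ?thesis by (simp add: real_sqrt_mult a_def b_def c_def)
qed

lemma tendsto_integral_mult_L2:
  assumes "\<And>n. sq_integrable N (f n)" "sq_integrable N F" "sq_integrable N g"
    and "(\<lambda>n. \<integral>x. (f n x - F x)\<^sup>2 \<partial>N) \<longlonglongrightarrow> 0"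
  shows "(\<lambda>n. \<integral>x. f n x * g x \<partial>N) \<longlonglongrightarrow> (\<integral>x. F x * g x \<partial>N)"
proof (rule LIM_zero_cancel, rule Lim_null_comparison)
  show "(\<lambda>n. sqrt (\<integral>x. (f n x - F x)\<^sup>2 \<partial>N) * sqrt (\<integral>x. (g x)\<^sup>2 \<partial>N)) \<longlonglongrightarrow> 0"
    using tendsto_mult_left_zero[OF tendsto_real_sqrt[OF assms(4), simplified]] by simp
  have "norm ((\<integral>x. f n x * g x \<partial>N) - (\<integral>x. F x * g x \<partial>N))
      \<le> sqrt (\<integral>x. (f n x - F x)\<^sup>2 \<partial>N) * sqrt (\<integral>x. (g x)\<^sup>2 \<partial>N)" for n
    using integral_mult_le_sqrt[OF sq_integrable_diff[OF assms(1,2)] assms(3), of n]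
      sq_integrable_mult[OF assms(1,3), of n] sq_integrable_mult[OF assms(2,3)]
    by (simp add: left_diff_distrib)
  then show "\<forall>\<^sub>F n in sequentially. norm ((\<integral>x. f n x * g x \<partial>N) - (\<integral>x. F x * g x \<partial>N))
      \<le> sqrt (\<integral>x. (f n x - F x)\<^sup>2 \<partial>N) * sqrt (\<integral>x. (g x)\<^sup>2 \<partial>N)" by simp
qed

text \<open>Fatou's lemma for the squares. The bound is asked only eventually because it comes from
  Cauchy or convergence estimates, which hold from some index on.\<close>

lemma sq_integrable_Fatou:
  assumes "\<And>n. sq_integrable N (f n)" and [measurable]: "F \<in> borel_measurable N"
    and lim: "AE x in N. (\<lambda>n. f n x) \<longlonglongrightarrow> F x"
    and le: "\<forall>\<^sub>F n in sequentially. (\<integral>x. (f n x)\<^sup>2 \<partial>N) \<le> c"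
  shows "sq_integrable N F" "(\<integral>x. (F x)\<^sup>2 \<partial>N) \<le> c"
proof -
  have [measurable]: "f n \<in> borel_measurable N" for n using assms(1) by (simp add: sq_integrable_def)
  \<comment> \<open>\<open>ennreal\<close> sends negative numbers to 0, so \<open>c\<close> is first
    seen to be nonnegative.\<close>
  obtain n where "(\<integral>x. (f n x)\<^sup>2 \<partial>N) \<le> c" using le by (auto simp: eventually_sequentially)
  then have c: "0 \<le> c" by (smt (verit) integral_nonneg_AE AE_I2 zero_le_power2)
  have "(\<integral>\<^sup>+x. ennreal ((F x)\<^sup>2) \<partial>N) = (\<integral>\<^sup>+x. liminf (\<lambda>n. ennreal ((f n x)\<^sup>2)) \<partial>N)"
  proof (rule nn_integral_cong_AE)
    show "AE x in N. ennreal ((F x)\<^sup>2) = liminf (\<lambda>n. ennreal ((f n x)\<^sup>2))"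
      using lim
    proof eventually_elim
      case (elim x)
      then have "(\<lambda>n. ennreal ((f n x)\<^sup>2)) \<longlonglongrightarrow> ennreal ((F x)\<^sup>2)"
        by (intro tendsto_ennrealI tendsto_intros)
      then show ?case by (rule lim_imp_Liminf[symmetric, rotated]) simp
    qed
  qed
  also have "\<dots> \<le> liminf (\<lambda>n. \<integral>\<^sup>+x. ennreal ((f n x)\<^sup>2) \<partial>N)"
    by (rule nn_integral_liminf) measurable
  also have "\<dots> \<le> ennreal c"
  proof (rule Liminf_le)
    show "\<forall>\<^sub>F n in sequentially. (\<integral>\<^sup>+x. ennreal ((f n x)\<^sup>2) \<partial>N) \<le> ennreal c"
      using le
    proof eventually_elim
      case (elim n)
      then show ?case
        using nn_integral_eq_integral[OF sq_integrable_square[OF assms(1)[of n]]]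
        by (simp add: ennreal_leI)
    qed
  qed simp
  finally have le': "(\<integral>\<^sup>+x. ennreal ((F x)\<^sup>2) \<partial>N) \<le> ennreal c" .
  also have "ennreal c < \<infinity>" by simp
  finally have "integrable N (\<lambda>x. (F x)\<^sup>2)"
    by (intro integrableI_nonneg) auto
  then show "sq_integrable N F" by (simp add: sq_integrable_def)
  show "(\<integral>x. (F x)\<^sup>2 \<partial>N) \<le> c"
    using le' c nn_integral_eq_integral[OF \<open>integrable N (\<lambda>x. (F x)\<^sup>2)\<close>]
    by (simp add: ennreal_le_iff)
qed

text \<open>Fatou's lemma for \<open>f n - G\<close> bounds the second moment of
  \<open>F - G\<close> by every positive number. This identifies almost sure sums with integrals
  known as mean square limits.\<close>

lemma AE_eq_of_L2_limit:
  assumes "\<And>n. sq_integrable N (f n)" "sq_integrable N G" and [measurable]: "F \<in> borel_measurable N"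
    and "AE x in N. (\<lambda>n. f n x) \<longlonglongrightarrow> F x"
    and lim: "(\<lambda>n. \<integral>x. (f n x - G x)\<^sup>2 \<partial>N) \<longlonglongrightarrow> 0"
  shows "AE x in N. F x = G x"
proof -
  have [measurable]: "G \<in> borel_measurable N" using assms(2) by (simp add: sq_integrable_def)
  have *: "sq_integrable N (\<lambda>x. F x - G x) \<and> (\<integral>x. (F x - G x)\<^sup>2 \<partial>N) \<le> c" if "c > 0" for c
  proof -
    have "AE x in N. (\<lambda>n. f n x - G x) \<longlonglongrightarrow> F x - G x"
      using assms(4) by eventually_elim (intro tendsto_intros)
    moreover have "\<forall>\<^sub>F n in sequentially. (\<integral>x. (f n x - G x)\<^sup>2 \<partial>N) \<le> c"
      using order_tendstoD(2)[OF lim that] by eventually_elim simp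
    ultimately show ?thesis
      using sq_integrable_Fatou[of N "\<lambda>n x. f n x - G x" "\<lambda>x. F x - G x" c] sq_integrable_diff[OF assms(1,2)]
      by auto
  qed
  have "(\<integral>x. (F x - G x)\<^sup>2 \<partial>N) \<le> 0"
  proof (rule field_le_epsilon)
    fix e :: real assume "0 < e"
    then show "(\<integral>x. (F x - G x)\<^sup>2 \<partial>N) \<le> 0 + e" using *[of e] by simp
  qed
  then have "(\<integral>x. (F x - G x)\<^sup>2 \<partial>N) = 0" by (simp add: antisym)
  then have "AE x in N. (F x - G x)\<^sup>2 = 0"
    using *[of 1] by (subst (asm) integral_nonneg_eq_0_iff_AE) (auto simp: sq_integrable_def)
  then show ?thesis by eventually_elim simp
qed

context prob_space
begin

lemma sq_integrable_integrable: "sq_integrable M Y \<Longrightarrow> integrable M Y"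
  by (auto simp: sq_integrable_def intro: square_integrable_imp_integrable)

lemma sq_integrable_const: "sq_integrable M (\<lambda>_. c)"
  by (simp add: sq_integrable_def)

lemma expectation_abs_le_sqrt:
  assumes "sq_integrable M Y"
  shows "expectation (\<lambda>w. \<bar>Y w\<bar>) \<le> sqrt (expectation (\<lambda>w. (Y w)\<^sup>2))"
proof -
  have "sq_integrable M (\<lambda>w. \<bar>Y w\<bar>)" using assms by (auto simp: sq_integrable_def)
  from integral_mult_le_sqrt[OF this sq_integrable_const[of 1]] show ?thesis
    by (simp add: prob_space)
qed

text \<open>The Riesz-Fischer argument: a rapidly Cauchy subsequence has absolutely summable
  increments almost surely, which yields \<open>Z\<close>; Fatou's lemma then transfers the Cauchy
  estimates to \<open>Z\<close>.\<close>

lemma L2_complete: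
  fixes Y :: "nat \<Rightarrow> 'a \<Rightarrow> real"
  assumes sq: "\<And>n. sq_integrable M (Y n)"
    and Cauchy: "\<And>e. e > 0 \<Longrightarrow> \<exists>N. \<forall>m\<ge>N. \<forall>n\<ge>N. expectation (\<lambda>w. (Y m w - Y n w)\<^sup>2) < e"
  obtains Z where "sq_integrable M Z" "(\<lambda>n. expectation (\<lambda>w. (Y n w - Z w)\<^sup>2)) \<longlonglongrightarrow> 0"
proof -
  have [measurable]: "Y n \<in> borel_measurable M" for n using sq by (simp add: sq_integrable_def)
  \<comment> \<open>The rate \<open>(1/4)^k\<close> for second moments becomes the summable rate
    \<open>(1/2)^k\<close> for first absolute moments after taking roots.\<close>
  have "\<exists>r::nat \<Rightarrow> nat. \<forall>k. (\<forall>m\<ge>r k. \<forall>n\<ge>r k. expectation (\<lambda>w. (Y m w - Y n w)\<^sup>2) < (1/4)^k) \<and> r k < r (Suc k)"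
  proof (rule dependent_nat_choice)
    show "\<exists>N. \<forall>m\<ge>N. \<forall>n\<ge>N. expectation (\<lambda>w. (Y m w - Y n w)\<^sup>2) < (1/4)^0"
      using Cauchy[of 1] by simp
    fix x k :: nat
    obtain N where "\<forall>m\<ge>N. \<forall>n\<ge>N. expectation (\<lambda>w. (Y m w - Y n w)\<^sup>2) < (1/4)^Suc k"
      using Cauchy[of "(1/4)^Suc k"] by auto
    then show "\<exists>y. (\<forall>m\<ge>y. \<forall>n\<ge>y. expectation (\<lambda>w. (Y m w - Y n w)\<^sup>2) < (1/4)^Suc k) \<and> x < y"
      by (intro exI[of _ "max N (Suc x)"]) auto
  qed
  then obtain r :: "nat \<Rightarrow> nat" where
    r: "\<And>k m n. m \<ge> r k \<Longrightarrow> n \<ge> r k \<Longrightarrow> expectation (\<lambda>w. (Y m w - Y n w)\<^sup>2) < (1/4)^k"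
    and rm: "\<And>k. r k < r (Suc k)" by blast
  have sm: "strict_mono r" using rm by (simp add: strict_mono_Suc_iff)
  define D where "D k w = \<bar>Y (r (Suc k)) w - Y (r k) w\<bar>" for k w
  have [measurable]: "D k \<in> borel_measurable M" for k unfolding D_def by measurable
  have ED: "(\<integral>\<^sup>+w. ennreal (D k w) \<partial>M) \<le> ennreal ((1/2)^k)" for k
  proof -
    have s: "sq_integrable M (\<lambda>w. Y (r (Suc k)) w - Y (r k) w)" by (intro sq_integrable_diff sq)
    have "expectation (D k) \<le> sqrt (expectation (\<lambda>w. (Y (r (Suc k)) w - Y (r k) w)\<^sup>2))"
      unfolding D_def by (rule expectation_abs_le_sqrt[OF s])
    also have "\<dots> \<le> sqrt ((1/4)^k)"
      using r[of k "r (Suc k)" "r k"] rm[of k] by (intro real_sqrt_le_mono) simp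
    also have "sqrt ((1/4)^k) = (1/2)^k"
      using real_sqrt_power[of "1/4" k] by (simp add: real_sqrt_divide)
    finally have "expectation (D k) \<le> (1/2)^k" .
    moreover have "integrable M (D k)"
      unfolding D_def by (intro integrable_abs sq_integrable_integrable s)
    ultimately show ?thesis
      by (subst nn_integral_eq_integral) (auto simp: D_def intro: ennreal_leI)
  qed
  have "(\<integral>\<^sup>+w. (\<Sum>k. ennreal (D k w)) \<partial>M) = (\<Sum>k. \<integral>\<^sup>+w. ennreal (D k w) \<partial>M)"
    by (rule nn_integral_suminf) measurable
  also have "\<dots> \<le> (\<Sum>k. ennreal ((1/2)^k))"
    by (intro suminf_le ED summableI)
  also have "\<dots> = ennreal 2"
    using geometric_sums[of "1/2::real"] by (intro suminf_ennreal_eq) auto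
  finally have "(\<integral>\<^sup>+w. (\<Sum>k. ennreal (D k w)) \<partial>M) \<noteq> \<infinity>"
    by (auto simp: top_unique)
  then have "AE w in M. (\<Sum>k. ennreal (D k w)) \<noteq> \<infinity>"
    by (intro nn_integral_PInf_AE) auto
  then have conv: "AE w in M. convergent (\<lambda>k. Y (r k) w)"
  proof eventually_elim
    case (elim w)
    then have "summable (\<lambda>k. D k w)"
      by (intro summable_suminf_not_top) (auto simp: D_def)
    then have "summable (\<lambda>k. Y (r (Suc k)) w - Y (r k) w)"
      unfolding D_def by (rule summable_rabs_cancel)
    then have "convergent (\<lambda>n. \<Sum>k<n. Y (r (Suc k)) w - Y (r k) w)"
      by (simp add: summable_iff_convergent)
    then have "convergent (\<lambda>n. Y (r n) w - Y (r 0) w)"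
      using sum_lessThan_telescope[of "\<lambda>k. Y (r k) w"] by simp
    then obtain l where "(\<lambda>n. Y (r n) w - Y (r 0) w) \<longlonglongrightarrow> l" by (auto simp: convergent_def)
    from tendsto_add[OF this tendsto_const[of "Y (r 0) w"]] show ?case
      by (auto simp: convergent_def)
  qed
  define Z where "Z w = lim (\<lambda>k. Y (r k) w)" for w
  have [measurable]: "Z \<in> borel_measurable M" unfolding Z_def by measurable
  have Zlim: "AE w in M. (\<lambda>k. Y (r k) w) \<longlonglongrightarrow> Z w"
    using conv by eventually_elim (simp add: Z_def convergent_LIMSEQ_iff)
  \<comment> \<open>Fatou along the subsequence in the second index, the first one staying
    fixed.\<close>
  have *: "sq_integrable M (\<lambda>w. Y n w - Z w) \<and> expectation (\<lambda>w. (Y n w - Z w)\<^sup>2) \<le> e"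
    if e: "\<And>k. k \<ge> n \<Longrightarrow> expectation (\<lambda>w. (Y n w - Y k w)\<^sup>2) < e" for n e
  proof -
    have "AE w in M. (\<lambda>k. Y n w - Y (r k) w) \<longlonglongrightarrow> Y n w - Z w"
      using Zlim by eventually_elim (intro tendsto_intros)
    moreover have "\<forall>\<^sub>F k in sequentially. expectation (\<lambda>w. (Y n w - Y (r k) w)\<^sup>2) \<le> e"
      using eventually_ge_at_top[of n]
    proof eventually_elim
      case (elim k)
      have "k \<le> r k" by (rule strict_mono_imp_increasing[OF sm])
      then show ?case using e[of "r k"] elim by simp
    qed
    ultimately show ?thesis
      using sq_integrable_Fatou[of M "\<lambda>k w. Y n w - Y (r k) w" "\<lambda>w. Y n w - Z w" e]
        sq_integrable_diff[OF sq sq] by auto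
  qed
  have "sq_integrable M Z"
  proof -
    obtain N where "\<forall>m\<ge>N. \<forall>n\<ge>N. expectation (\<lambda>w. (Y m w - Y n w)\<^sup>2) < 1" using Cauchy[of 1] by auto
    then have "sq_integrable M (\<lambda>w. Y N w - Z w)" using *[of N 1] by auto
    from sq_integrable_diff[OF sq[of N] this] show ?thesis by simp
  qed
  moreover have "(\<lambda>n. expectation (\<lambda>w. (Y n w - Z w)\<^sup>2)) \<longlonglongrightarrow> 0"
  proof (rule LIMSEQ_I)
    fix e :: real assume "e > 0"
    then obtain N where N: "\<forall>m\<ge>N. \<forall>n\<ge>N. expectation (\<lambda>w. (Y m w - Y n w)\<^sup>2) < e/2"
      using Cauchy[of "e/2"] by auto
    have "norm (expectation (\<lambda>w. (Y n w - Z w)\<^sup>2) - 0) < e" if "n \<ge> N" for n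
      using *[of n "e/2"] N that \<open>e > 0\<close> by auto
    then show "\<exists>N. \<forall>n\<ge>N. norm (expectation (\<lambda>w. (Y n w - Z w)\<^sup>2) - 0) < e" by blast
  qed
  ultimately show thesis by (rule that)
qed

end

section \<open>Convergence in probability and independence\<close>

lemma abs_integral_le:
  fixes f g :: "'b \<Rightarrow> real"
  assumes "integrable N f" "integrable N g" "\<And>x. x \<in> space N \<Longrightarrow> \<bar>f x\<bar> \<le> g x"
  shows "\<bar>\<integral>x. f x \<partial>N\<bar> \<le> (\<integral>x. g x \<partial>N)"
  using integral_norm_bound[of N f] integral_mono[OF integrable_abs[OF assms(1)] assms(2,3)]
  unfolding real_norm_def by linarith

context prob_space
begin

text \<open>A subadditive functional that metrises convergence in probability for arbitrary random
  variables. It turns limits in probability into null sequences of reals and later serves as the set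
  function of the sliding hump.\<close>

definition trunc_mean :: "('a \<Rightarrow> real) \<Rightarrow> real" where
  "trunc_mean Y = expectation (\<lambda>w. min 1 \<bar>Y w\<bar>)"

lemma trunc_integrable [simp]:
  fixes Y :: "'a \<Rightarrow> real"
  assumes [measurable]: "Y \<in> borel_measurable M"
  shows "integrable M (\<lambda>w. min 1 \<bar>Y w\<bar>)"
  by (rule integrable_const_bound[where B=1]) auto

lemma trunc_mean_nonneg: "0 \<le> trunc_mean Y"
  unfolding trunc_mean_def by (rule integral_nonneg_AE) auto

lemma trunc_mean_cong_AE:
  assumes "AE w in M. Y w = Z w" and [measurable]: "Y \<in> borel_measurable M" "Z \<in> borel_measurable M"
  shows "trunc_mean Y = trunc_mean Z"
  unfolding trunc_mean_def using assms(1) by (intro integral_cong_AE) auto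

lemma trunc_mean_add_le:
  assumes [measurable]: "Y \<in> borel_measurable M" "Z \<in> borel_measurable M"
  shows "trunc_mean (\<lambda>w. Y w + Z w) \<le> trunc_mean Y + trunc_mean Z"
proof -
  have "trunc_mean (\<lambda>w. Y w + Z w) \<le> expectation (\<lambda>w. min 1 \<bar>Y w\<bar> + min 1 \<bar>Z w\<bar>)"
    unfolding trunc_mean_def by (intro integral_mono Bochner_Integration.integrable_add trunc_integrable) auto
  then show ?thesis by (simp add: trunc_mean_def)
qed

lemma trunc_mean_uminus: "trunc_mean (\<lambda>w. - Y w) = trunc_mean Y"
  by (simp add: trunc_mean_def)

lemma trunc_mean_diff_le:
  assumes "Y \<in> borel_measurable M" "Z \<in> borel_measurable M"
  shows "\<bar>trunc_mean Y - trunc_mean Z\<bar> \<le> trunc_mean (\<lambda>w. Y w - Z w)"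
proof -
  have "trunc_mean Y \<le> trunc_mean (\<lambda>w. Y w - Z w) + trunc_mean Z"
    using trunc_mean_add_le[of "\<lambda>w. Y w - Z w" Z] assms by simp
  moreover have "trunc_mean Z \<le> trunc_mean (\<lambda>w. - (Y w - Z w)) + trunc_mean Y"
    using trunc_mean_add_le[of "\<lambda>w. - (Y w - Z w)" Y] assms by simp
  ultimately show ?thesis
    using trunc_mean_uminus[of "\<lambda>w. Y w - Z w"] by simp
qed

lemma trunc_mean_eq_0_iff:
  assumes [measurable]: "Y \<in> borel_measurable M"
  shows "trunc_mean Y = 0 \<longleftrightarrow> (AE w in M. Y w = 0)"
proof -
  have "trunc_mean Y = 0 \<longleftrightarrow> (AE w in M. min 1 \<bar>Y w\<bar> = 0)"
    unfolding trunc_mean_def by (subst integral_nonneg_eq_0_iff_AE) auto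
  also have "\<dots> \<longleftrightarrow> (AE w in M. Y w = 0)"
    by (intro AE_cong) (auto simp: min_def)
  finally show ?thesis .
qed

lemma trunc_mean_le_sqrt:
  assumes "sq_integrable M Y"
  shows "trunc_mean Y \<le> sqrt (expectation (\<lambda>w. (Y w)\<^sup>2))"
proof -
  have "trunc_mean Y \<le> expectation (\<lambda>w. \<bar>Y w\<bar>)"
    unfolding trunc_mean_def using assms
    by (intro integral_mono integrable_abs sq_integrable_integrable trunc_integrable) (auto simp: sq_integrable_def)
  then show ?thesis using expectation_abs_le_sqrt[OF assms] by simp
qed

lemma trunc_mean_tendsto_0_of_L2:
  assumes "\<And>n. sq_integrable M (Y n)" "(\<lambda>n. expectation (\<lambda>w. (Y n w)\<^sup>2)) \<longlonglongrightarrow> 0"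
  shows "(\<lambda>n. trunc_mean (Y n)) \<longlonglongrightarrow> 0"
proof (rule tendsto_sandwich[OF _ _ tendsto_const])
  show "(\<lambda>n. sqrt (expectation (\<lambda>w. (Y n w)\<^sup>2))) \<longlonglongrightarrow> 0"
    using tendsto_real_sqrt[OF assms(2)] by simp
qed (use trunc_mean_nonneg trunc_mean_le_sqrt[OF assms(1)] in auto)

lemma tendsto_in_prob_iff_trunc_mean:
  assumes [measurable]: "\<And>i. Y i \<in> borel_measurable M" "Z \<in> borel_measurable M"
  shows "tendsto_in_prob Y Z F \<longleftrightarrow> ((\<lambda>i. trunc_mean (\<lambda>w. Y i w - Z w)) \<longlongrightarrow> 0) F"
proof
  assume *: "tendsto_in_prob Y Z F"
  show "((\<lambda>i. trunc_mean (\<lambda>w. Y i w - Z w)) \<longlongrightarrow> 0) F"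
  proof (rule tendstoI)
    fix e :: real assume "e > 0"
    then have "((\<lambda>i. prob {w \<in> space M. \<bar>Y i w - Z w\<bar> > e/2}) \<longlongrightarrow> 0) F"
      by (intro *[unfolded tendsto_in_prob_def, rule_format]) simp
    then have "\<forall>\<^sub>F i in F. prob {w \<in> space M. \<bar>Y i w - Z w\<bar> > e/2} < e/2"
      using \<open>e > 0\<close> by (intro order_tendstoD) auto
    then show "\<forall>\<^sub>F i in F. dist (trunc_mean (\<lambda>w. Y i w - Z w)) 0 < e"
    proof eventually_elim
      case (elim i)
      have "trunc_mean (\<lambda>w. Y i w - Z w)
          \<le> expectation (\<lambda>w. e/2 + indicator {w \<in> space M. \<bar>Y i w - Z w\<bar> > e/2} w)"
        unfolding trunc_mean_def
        by (intro integral_mono Bochner_Integration.integrable_add integrable_const trunc_integrable integrable_real_indicator)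
          (use \<open>e > 0\<close> in \<open>auto simp: indicator_def min_def emeasure_eq_measure\<close>)
      also have "\<dots> = e/2 + prob {w \<in> space M. \<bar>Y i w - Z w\<bar> > e/2}"
        by (subst Bochner_Integration.integral_add) (auto simp: prob_space Int_absorb1 emeasure_eq_measure intro!: integrable_real_indicator)
      finally show ?case using elim by (simp add: trunc_mean_nonneg)
    qed
  qed
next
  assume *: "((\<lambda>i. trunc_mean (\<lambda>w. Y i w - Z w)) \<longlongrightarrow> 0) F"
  show "tendsto_in_prob Y Z F"
    unfolding tendsto_in_prob_def
  proof (intro allI impI)
    fix e :: real assume "e > 0"
    \<comment> \<open>Truncation caps the variable at 1, so on the event the lower bound for
      Markov's inequality is \<open>min 1 e\<close>.\<close>
    define c where "c = min 1 e"
    have c: "c > 0" "c \<le> 1" "c \<le> e" using \<open>e > 0\<close> by (auto simp: c_def)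
    have le: "prob {w \<in> space M. \<bar>Y i w - Z w\<bar> > e} \<le> trunc_mean (\<lambda>w. Y i w - Z w) / c" for i
    proof -
      have "expectation (\<lambda>w. c * indicator {w \<in> space M. \<bar>Y i w - Z w\<bar> > e} w) \<le> trunc_mean (\<lambda>w. Y i w - Z w)"
        unfolding trunc_mean_def
        by (intro integral_mono integrable_mult_right trunc_integrable integrable_real_indicator)
          (use c in \<open>auto simp: indicator_def min_def emeasure_eq_measure\<close>)
      then have "c * prob {w \<in> space M. \<bar>Y i w - Z w\<bar> > e} \<le> trunc_mean (\<lambda>w. Y i w - Z w)"
        by (simp add: Int_absorb1)
      then show ?thesis using c by (simp add: field_simps)
    qed
    show "((\<lambda>i. prob {w \<in> space M. \<bar>Y i w - Z w\<bar> > e}) \<longlongrightarrow> 0) F"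
    proof (rule tendsto_sandwich[OF _ _ tendsto_const])
      show "((\<lambda>i. trunc_mean (\<lambda>w. Y i w - Z w) / c) \<longlongrightarrow> 0) F"
        using tendsto_divide[OF * tendsto_const[of c]] c by simp
    qed (auto simp: le)
  qed
qed

lemma indep_vars_borel_iff_atMost:
  fixes X :: "'i \<Rightarrow> 'a \<Rightarrow> real"
  assumes "finite I" "I \<noteq> {}" and rv: "\<And>i. i \<in> I \<Longrightarrow> X i \<in> borel_measurable M"
  shows "indep_vars (\<lambda>_. borel) X I \<longleftrightarrow>
    (\<forall>A\<in>I \<rightarrow> insert UNIV (range atMost). prob (\<Inter>j\<in>I. X j -` A j \<inter> space M) = (\<Prod>j\<in>I. prob (X j -` A j \<inter> space M)))"
proof (rule indep_vars_finite)
  \<comment> \<open>The closed half-lines form a generator stable under intersection;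
    \<open>UNIV\<close> is adjoined so that the whole space belongs to it.\<close>
  show "Int_stable (insert UNIV (range (atMost :: real \<Rightarrow> real set)))"
    by (auto simp: Int_stable_def)
  have "sets (borel :: real measure) = sigma_sets UNIV (range atMost)"
    by (subst borel_eq_atMost) simp
  also have "\<dots> = sigma_sets UNIV (insert UNIV (range atMost))"
    by (rule sigma_sets_eqI) (auto intro: sigma_sets_top)
  finally show "sets (borel :: real measure) = sigma_sets (space borel) (insert UNIV (range atMost))"
    by simp
qed (use assms in auto)

text \<open>The product formula for expectations of bounded Lipschitz functions survives limits in
  probability; indicators of half-lines are pointwise limits of such functions, and half-lines
  decide independence.\<close>

lemma indep_vars_tendsto:
  fixes X :: "nat \<Rightarrow> 'i \<Rightarrow> 'a \<Rightarrow> real"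
  assumes I: "finite I" and indep: "\<And>k. indep_vars (\<lambda>_. borel) (X k) I"
    and rv: "\<And>i. i \<in> I \<Longrightarrow> Y i \<in> borel_measurable M"
    and lim: "\<And>i. i \<in> I \<Longrightarrow> (\<lambda>k. trunc_mean (\<lambda>w. X k i w - Y i w)) \<longlonglongrightarrow> 0"
  shows "indep_vars (\<lambda>_. borel) Y I"
proof (cases "I = {}")
  case True
  then show ?thesis by (simp add: indep_vars_def indep_sets_def)
next
  case False
  have rvX [measurable]: "X k i \<in> borel_measurable M" if "i \<in> I" for k i
    using indep[of k] that by (auto simp: indep_vars_def)
  note rv [measurable]
  \<comment> \<open>The modulus \<open>C * min 1 |x - y|\<close> encodes boundedness and the
    Lipschitz property at once, so that all errors are multiples of
    \<open>trunc_mean\<close>.\<close>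
  have Lipschitz: "expectation (\<lambda>w. \<Prod>i\<in>I. g i (Y i w)) = (\<Prod>i\<in>I. expectation (\<lambda>w. g i (Y i w)))"
    if [measurable]: "\<And>i. g i \<in> borel_measurable borel" and g01: "\<And>i x. 0 \<le> g i x \<and> g i x \<le> 1"
      and C: "\<And>i x y. \<bar>g i x - g i y\<bar> \<le> C * min 1 \<bar>x - y\<bar>" for g :: "'i \<Rightarrow> real \<Rightarrow> real" and C
  proof -
    have int: "integrable M (\<lambda>w. g i (Z w))" if "Z \<in> borel_measurable M" for Z i
      using that by (intro integrable_const_bound[where B=1]) (auto simp: g01)
    have intp: "integrable M (\<lambda>w. \<Prod>i\<in>I. g i (Z i w))" if "\<And>i. i \<in> I \<Longrightarrow> Z i \<in> borel_measurable M" for Z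
      using that by (intro integrable_const_bound[where B=1]) (auto simp: g01 abs_prod intro!: prod_le_1)
    have ine: "\<bar>expectation (\<lambda>w. g i (X k i w)) - expectation (\<lambda>w. g i (Y i w))\<bar> \<le> C * trunc_mean (\<lambda>w. X k i w - Y i w)"
      if "i \<in> I" for i k
    proof -
      have "\<bar>expectation (\<lambda>w. g i (X k i w)) - expectation (\<lambda>w. g i (Y i w))\<bar> = \<bar>expectation (\<lambda>w. g i (X k i w) - g i (Y i w))\<bar>"
        using that by (simp add: int)
      also have "\<dots> \<le> expectation (\<lambda>w. C * min 1 \<bar>X k i w - Y i w\<bar>)"
        using that C by (intro abs_integral_le) (auto simp: int)
      finally show ?thesis using that by (simp add: trunc_mean_def)
    qed
    have lim1: "(\<lambda>k. expectation (\<lambda>w. g i (X k i w))) \<longlonglongrightarrow> expectation (\<lambda>w. g i (Y i w))" if "i \<in> I" for i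
    proof (rule LIM_zero_cancel, rule Lim_null_comparison)
      show "(\<lambda>k. C * trunc_mean (\<lambda>w. X k i w - Y i w)) \<longlonglongrightarrow> 0"
        using tendsto_mult_right_zero[OF lim[OF that]] by simp
    qed (use ine[OF that] in auto)
    have lim2: "(\<lambda>k. expectation (\<lambda>w. \<Prod>i\<in>I. g i (X k i w))) \<longlonglongrightarrow> expectation (\<lambda>w. \<Prod>i\<in>I. g i (Y i w))"
    proof (rule LIM_zero_cancel, rule Lim_null_comparison)
      show "(\<lambda>k. \<Sum>i\<in>I. C * trunc_mean (\<lambda>w. X k i w - Y i w)) \<longlonglongrightarrow> 0"
        using lim by (intro tendsto_null_sum tendsto_mult_right_zero)
      have "norm (expectation (\<lambda>w. \<Prod>i\<in>I. g i (X k i w)) - expectation (\<lambda>w. \<Prod>i\<in>I. g i (Y i w)))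
          \<le> (\<Sum>i\<in>I. C * trunc_mean (\<lambda>w. X k i w - Y i w))" for k
      proof -
        have "norm (expectation (\<lambda>w. \<Prod>i\<in>I. g i (X k i w)) - expectation (\<lambda>w. \<Prod>i\<in>I. g i (Y i w)))
            = \<bar>expectation (\<lambda>w. (\<Prod>i\<in>I. g i (X k i w)) - (\<Prod>i\<in>I. g i (Y i w)))\<bar>"
          by (subst Bochner_Integration.integral_diff) (auto intro!: intp)
        also have "\<dots> \<le> expectation (\<lambda>w. \<Sum>i\<in>I. C * min 1 \<bar>X k i w - Y i w\<bar>)"
        proof (rule abs_integral_le)
          fix w assume "w \<in> space M"
          have "\<bar>(\<Prod>i\<in>I. g i (X k i w)) - (\<Prod>i\<in>I. g i (Y i w))\<bar> \<le> (\<Sum>i\<in>I. \<bar>g i (X k i w) - g i (Y i w)\<bar>)"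
            using norm_prod_diff[of I "\<lambda>i. g i (X k i w)" "\<lambda>i. g i (Y i w)"] g01 by auto
          also have "\<dots> \<le> (\<Sum>i\<in>I. C * min 1 \<bar>X k i w - Y i w\<bar>)"
            by (intro sum_mono C)
          finally show "\<bar>(\<Prod>i\<in>I. g i (X k i w)) - (\<Prod>i\<in>I. g i (Y i w))\<bar> \<le> (\<Sum>i\<in>I. C * min 1 \<bar>X k i w - Y i w\<bar>)" .
        qed (auto intro!: intp)
        also have "\<dots> = (\<Sum>i\<in>I. C * trunc_mean (\<lambda>w. X k i w - Y i w))"
          by (subst Bochner_Integration.integral_sum) (auto simp: trunc_mean_def)
        finally show ?thesis .
      qed
      then show "\<forall>\<^sub>F k in sequentially. norm (expectation (\<lambda>w. \<Prod>i\<in>I. g i (X k i w)) - expectation (\<lambda>w. \<Prod>i\<in>I. g i (Y i w)))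
          \<le> (\<Sum>i\<in>I. C * trunc_mean (\<lambda>w. X k i w - Y i w))" by simp
    qed
    have "expectation (\<lambda>w. \<Prod>i\<in>I. g i (X k i w)) = (\<Prod>i\<in>I. expectation (\<lambda>w. g i (X k i w)))" for k
      by (intro indep_vars_lebesgue_integral I indep_vars_compose2[OF indep] int) auto
    then have "(\<lambda>k. expectation (\<lambda>w. \<Prod>i\<in>I. g i (X k i w))) \<longlonglongrightarrow> (\<Prod>i\<in>I. expectation (\<lambda>w. g i (Y i w)))"
      using lim1 by (auto intro!: tendsto_prod)
    with lim2 show ?thesis by (rule LIMSEQ_unique)
  qed
  show ?thesis
  proof (subst indep_vars_borel_iff_atMost[OF I False rv], assumption, intro ballI)
    fix A :: "'i \<Rightarrow> real set" assume A: "A \<in> I \<rightarrow> insert UNIV (range atMost)"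
    \<comment> \<open>A ramp equal to 1 on the half-line \<open>A i\<close> and falling to 0 over a
      length \<open>1 / n\<close>; \<open>Sup (A i)\<close> recovers the end point of the half-line.
      For \<open>A i = UNIV\<close> the ramp is constantly 1.\<close>
    define g :: "nat \<Rightarrow> 'i \<Rightarrow> real \<Rightarrow> real" where
      "g n i y = (if i \<in> I \<and> A i \<noteq> UNIV then max 0 (min 1 (1 - real n * (y - Sup (A i)))) else 1)" for n i y
    have gm [measurable]: "g n i \<in> borel_measurable borel" for n i
      unfolding g_def by (cases "i \<in> I \<and> A i \<noteq> UNIV") simp_all
    have g01: "0 \<le> g n i x \<and> g n i x \<le> 1" for n i x by (auto simp: g_def)
    have gC: "\<bar>g n i x - g n i y\<bar> \<le> (real n + 1) * min 1 \<bar>x - y\<bar>" for n i x y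
    proof -
      have 1: "\<bar>max 0 (min 1 a) - max 0 (min 1 b)\<bar> \<le> min 1 \<bar>a - b\<bar>" for a b :: real
        by (auto simp: max_def min_def)
      have 2: "min 1 (c * d) \<le> (c + 1) * min 1 d" if "c \<ge> 0" "d \<ge> 0" for c d :: real
        using that by (auto simp: min_def algebra_simps)
      have "\<bar>g n i x - g n i y\<bar> \<le> min 1 \<bar>real n * (y - x)\<bar>"
        using 1[of "1 - real n * (x - Sup (A i))" "1 - real n * (y - Sup (A i))"]
        by (auto simp: g_def algebra_simps)
      also have "\<bar>real n * (y - x)\<bar> = real n * \<bar>x - y\<bar>" by (simp add: abs_mult abs_minus_commute)
      finally show ?thesis using 2[of "real n" "\<bar>x - y\<bar>"] by linarith
    qed
    have glim: "(\<lambda>n. g n i y) \<longlonglongrightarrow> indicator (A i) y" if "i \<in> I" for i y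
    proof (cases "A i = UNIV")
      case True then show ?thesis by (simp add: g_def)
    next
      case False
      with A that obtain a where a: "A i = {..a}" by auto
      show ?thesis
      proof (cases "y \<le> a")
        case True
        then have "g n i y = 1" for n
          using that False by (simp add: g_def a mult_le_0_iff max_def min_def)
        then show ?thesis using True by (simp add: a)
      next
        case ya: False
        obtain m :: nat where m: "1 < real m * (y - a)"
          using reals_Archimedean3[of "y - a"] ya by auto
        have "g n i y = 0" if "n \<ge> m" for n
        proof -
          have "real m * (y - a) \<le> real n * (y - a)" using that ya by (intro mult_right_mono) auto
          then show ?thesis using m \<open>i \<in> I\<close> False by (simp add: g_def a)
        qed
        then have "\<forall>\<^sub>F n in sequentially. g n i y = indicator (A i) y"
          using ya by (auto simp: eventually_sequentially a)
        then show ?thesis by (rule tendsto_eventually)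
      qed
    qed
    have eq: "expectation (\<lambda>w. \<Prod>i\<in>I. g n i (Y i w)) = (\<Prod>i\<in>I. expectation (\<lambda>w. g n i (Y i w)))" for n
      by (rule Lipschitz[OF gm g01 gC])
    have Am [measurable]: "A i \<in> sets borel" if "i \<in> I" for i
      using funcset_mem[OF A that] by auto
    have l1: "(\<lambda>n. expectation (\<lambda>w. g n i (Y i w))) \<longlonglongrightarrow> prob (Y i -` A i \<inter> space M)" if "i \<in> I" for i
    proof -
      have [measurable]: "Y i \<in> borel_measurable M" "A i \<in> sets borel" using that by auto
      have "(\<lambda>n. expectation (\<lambda>w. g n i (Y i w))) \<longlonglongrightarrow> expectation (\<lambda>w. indicator (A i) (Y i w))"
        by (rule integral_dominated_convergence[where w="\<lambda>_. 1"])
          (use that g01 glim in auto)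
      also have "expectation (\<lambda>w. indicat_real (A i) (Y i w)) = expectation (indicator (Y i -` A i \<inter> space M))"
        by (intro Bochner_Integration.integral_cong) (auto simp: indicator_def)
      finally show ?thesis by (simp add: Int_absorb1)
    qed
    have l2: "(\<lambda>n. expectation (\<lambda>w. \<Prod>i\<in>I. g n i (Y i w))) \<longlonglongrightarrow> prob (\<Inter>j\<in>I. Y j -` A j \<inter> space M)"
    proof -
      have "(\<lambda>n. expectation (\<lambda>w. \<Prod>i\<in>I. g n i (Y i w))) \<longlonglongrightarrow> expectation (\<lambda>w. \<Prod>i\<in>I. indicator (A i) (Y i w))"
        by (rule integral_dominated_convergence[where w="\<lambda>_. 1"])
          (use g01 glim in \<open>auto simp: abs_prod intro!: tendsto_prod prod_le_1\<close>)
      also have "expectation (\<lambda>w. \<Prod>i\<in>I. indicat_real (A i) (Y i w)) = expectation (indicator (\<Inter>j\<in>I. Y j -` A j \<inter> space M))"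
      proof (rule Bochner_Integration.integral_cong[OF refl])
        fix w assume "w \<in> space M"
        have "finite J \<Longrightarrow> (\<Prod>i\<in>J. indicator (A i) (Y i w)) = (of_bool (\<forall>i\<in>J. Y i w \<in> A i) :: real)" for J
          by (induction J rule: finite_induct) (auto simp: indicator_def)
        then show "(\<Prod>i\<in>I. indicator (A i) (Y i w)) = indicat_real (\<Inter>j\<in>I. Y j -` A j \<inter> space M) w"
          using False I \<open>w \<in> space M\<close> by (auto simp: indicator_def)
      qed
      finally show ?thesis using False by (simp add: Int_absorb1 sets.sets_into_space)
    qed
    have "(\<lambda>n. \<Prod>i\<in>I. expectation (\<lambda>w. g n i (Y i w))) \<longlonglongrightarrow> (\<Prod>i\<in>I. prob (Y i -` A i \<inter> space M))"
      using l1 by (intro tendsto_prod)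
    with l2 show "prob (\<Inter>j\<in>I. Y j -` A j \<inter> space M) = (\<Prod>j\<in>I. prob (Y j -` A j \<inter> space M))"
      unfolding eq by (rule LIMSEQ_unique)
  qed
qed

text \<open>This is \<open>indep_vars_tendsto\<close> for the constant sequence
  \<open>X\<close>.\<close>

lemma indep_vars_cong_AE:
  fixes X Y :: "'i \<Rightarrow> 'a \<Rightarrow> real"
  assumes "indep_vars (\<lambda>_. borel) X I" "finite I" and rv: "\<And>i. i \<in> I \<Longrightarrow> Y i \<in> borel_measurable M"
    and eq: "\<And>i. i \<in> I \<Longrightarrow> AE w in M. X i w = Y i w"
  shows "indep_vars (\<lambda>_. borel) Y I"
proof (rule indep_vars_tendsto[OF assms(2) assms(1) rv])
  fix i assume i: "i \<in> I"
  then have [measurable]: "X i \<in> borel_measurable M" "Y i \<in> borel_measurable M"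
    using assms(1) rv by (auto simp: indep_vars_def)
  have "trunc_mean (\<lambda>w. X i w - Y i w) = 0"
    using eq[OF i] by (subst trunc_mean_eq_0_iff) auto
  then show "(\<lambda>k. trunc_mean (\<lambda>w. X i w - Y i w)) \<longlonglongrightarrow> 0" by simp
qed

text \<open>Independence makes the joint law a product, so by Fubini the sum stays square integrable
  with \<open>Y\<close> frozen at almost every value; removing that constant leaves
  \<open>X\<close>. This carries a second moment back to earlier times of the process.\<close>

lemma sq_integrable_of_indep_sum:
  assumes indep: "indep_var borel X borel Y" and sq: "sq_integrable M (\<lambda>w. X w + Y w)"
  shows "sq_integrable M X"
proof -
  have [measurable]: "X \<in> borel_measurable M" "Y \<in> borel_measurable M"
    using indep by (auto dest: indep_var_rv1 indep_var_rv2)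
  interpret X: prob_space "distr M borel X" by (rule prob_space_distr) simp
  interpret Y: prob_space "distr M borel Y" by (rule prob_space_distr) simp
  interpret XY: pair_prob_space "distr M borel X" "distr M borel Y" ..
  interpret YX: pair_prob_space "distr M borel Y" "distr M borel X" ..
  have eq: "distr M borel X \<Otimes>\<^sub>M distr M borel Y = distr M (borel \<Otimes>\<^sub>M borel) (\<lambda>x. (X x, Y x))"
    using indep by (simp add: indep_var_distribution_eq)
  have "integrable (distr M borel X \<Otimes>\<^sub>M distr M borel Y) (\<lambda>(x, y). (x + y)\<^sup>2)"
    unfolding eq using sq by (subst integrable_distr_eq) (auto simp: sq_integrable_def)
  from XY.integrable_product_swap[OF this]
  have "AE y in distr M borel Y. integrable (distr M borel X) (\<lambda>x. (x + y)\<^sup>2)"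
    using YX.AE_integrable_fst'[of "\<lambda>(y, x). (x + y)\<^sup>2"] by simp
  then have "\<exists>y. integrable (distr M borel X) (\<lambda>x. (x + y)\<^sup>2)"
    using Y.AE_contr by auto
  then obtain y where "integrable (distr M borel X) (\<lambda>x. (x + y)\<^sup>2)" ..
  then have "sq_integrable M (\<lambda>w. X w + y)"
    by (auto simp: sq_integrable_def integrable_distr_eq)
  from sq_integrable_diff[OF this sq_integrable_const[of y]] show ?thesis by simp
qed

end

section \<open>The sliding hump argument\<close>

text \<open>If \<open>Q n (space N)\<close> stayed large along a subsequence, there would be disjoint humps \<open>H j\<close> carrying most
  of it; on the union of every other hump \<open>Q\<close> would then oscillate instead of converging.\<close>

lemma sliding_hump:
  fixes Q :: "nat \<Rightarrow> 'b set \<Rightarrow> real" and G :: "nat \<Rightarrow> 'b set"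
  assumes G: "\<And>k. G k \<in> sets N" and mono: "\<And>k l. k \<le> l \<Longrightarrow> G k \<subseteq> G l"
    and nonneg: "\<And>n A. 0 \<le> Q n A"
    and sub: "\<And>n A B. A \<in> sets N \<Longrightarrow> B \<in> sets N \<Longrightarrow> A \<inter> B = {} \<Longrightarrow> Q n (A \<union> B) \<le> Q n A + Q n B"
    and sub': "\<And>n A B. A \<in> sets N \<Longrightarrow> B \<in> sets N \<Longrightarrow> A \<inter> B = {} \<Longrightarrow> Q n A \<le> Q n (A \<union> B) + Q n B"
    and conv: "\<And>A. A \<in> sets N \<Longrightarrow> convergent (\<lambda>n. Q n A)"
    and tail: "\<And>n e. e > 0 \<Longrightarrow> \<exists>K. \<forall>k\<ge>K. \<forall>B\<in>sets N. B \<inter> G k = {} \<longrightarrow> Q n B \<le> e"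
    and unif: "\<And>k e. e > 0 \<Longrightarrow> \<exists>n0. \<forall>n\<ge>n0. \<forall>B\<in>sets N. B \<subseteq> G k \<longrightarrow> Q n B \<le> e"
  shows "(\<lambda>n. Q n (space N)) \<longlonglongrightarrow> 0"
proof (rule ccontr)
  assume "\<not> ?thesis"
  then obtain e0 where e0: "e0 > 0" "\<And>n0. \<exists>n\<ge>n0. \<not> norm (Q n (space N) - 0) < e0"
    unfolding LIMSEQ_iff by blast
  \<comment> \<open>The budget: of \<open>10 * e\<close> the two sides of a hump cost
    \<open>2 * e\<close>, leaving \<open>8 * e\<close> on it; on the chosen union \<open>Q\<close>
    is then at least \<open>6 * e\<close> at even steps and at most \<open>2 * e\<close> at odd
    ones.\<close>
  define e where "e = e0 / 10"
  have e: "e > 0" and big: "\<And>n0. \<exists>n\<ge>n0. 10 * e \<le> Q n (space N)"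
    using e0 nonneg by (auto simp: e_def not_less)
  \<comment> \<open>A state pairs an index \<open>n\<close> with a level \<open>k\<close>.
    \<open>P\<close> says that \<open>Q n\<close> is large in total yet small off
    \<open>G k\<close>; \<open>R\<close> moves on to an \<open>n\<close> so late that
    \<open>Q\<close> is small inside the old \<open>G\<close>.\<close>
  define P where "P p \<longleftrightarrow> 10 * e \<le> Q (fst p) (space N) \<and> (\<forall>B\<in>sets N. B \<inter> G (snd p) = {} \<longrightarrow> Q (fst p) B \<le> e)"
    for p :: "nat \<times> nat"
  define R where "R p p' \<longleftrightarrow> fst p < fst p' \<and> snd p \<le> snd p' \<and> (\<forall>B\<in>sets N. B \<subseteq> G (snd p) \<longrightarrow> Q (fst p') B \<le> e)"
    for p p' :: "nat \<times> nat"
  have next_ex: "\<exists>p'. P p' \<and> R p p'" for p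
  proof -
    obtain n0 where n0: "\<forall>n\<ge>n0. \<forall>B\<in>sets N. B \<subseteq> G (snd p) \<longrightarrow> Q n B \<le> e"
      using unif[OF e] by blast
    obtain n where n: "n \<ge> max n0 (Suc (fst p))" "10 * e \<le> Q n (space N)" using big by blast
    obtain K where K: "\<forall>k\<ge>K. \<forall>B\<in>sets N. B \<inter> G k = {} \<longrightarrow> Q n B \<le> e" using tail[OF e] by blast
    have "\<forall>B\<in>sets N. B \<inter> G (max K (snd p)) = {} \<longrightarrow> Q n B \<le> e"
      using K by (meson max.cobounded1)
    then have "P (n, max K (snd p)) \<and> R p (n, max K (snd p))"
      using n0 n by (auto simp: P_def R_def)
    then show ?thesis by blast
  qed
  have "\<exists>f. \<forall>j. P (f j) \<and> R (f j) (f (Suc j))"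
    by (rule dependent_nat_choice) (use next_ex in blast)+
  then obtain f where f: "\<And>j. P (f j)" "\<And>j. R (f j) (f (Suc j))" by blast
  define n where "n j = fst (f j)" for j
  define k where "k j = snd (f j)" for j
  have n_less: "n j < n (Suc j)" and k_le: "k j \<le> k (Suc j)" for j
    using f(2)[of j] by (auto simp: R_def n_def k_def)
  have n_mono: "strict_mono n" using n_less by (simp add: strict_mono_Suc_iff)
  have k_mono: "i \<le> j \<Longrightarrow> k i \<le> k j" for i j by (rule lift_Suc_mono_le[of k, OF k_le])
  have large: "10 * e \<le> Q (n j) (space N)" for j using f(1)[of j] by (simp add: P_def n_def)
  have outer: "Q (n j) B \<le> e" if "B \<in> sets N" "B \<inter> G (k j) = {}" for j B
    using f(1)[of j] that by (simp add: P_def n_def k_def)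
  have inner: "Q (n (Suc j)) B \<le> e" if "B \<in> sets N" "B \<subseteq> G (k j)" for j B
    using f(2)[of j] that by (simp add: R_def n_def k_def)
  define H where "H j = G (k (Suc j)) - G (k j)" for j
  have H: "H j \<in> sets N" for j using G by (auto simp: H_def)
  have rest: "Q (n (Suc j)) (B \<inter> G (k j) \<union> (B - G (k (Suc j)))) \<le> 2 * e" if "B \<in> sets N" for B j
  proof -
    have "Q (n (Suc j)) (B \<inter> G (k j) \<union> (B - G (k (Suc j))))
        \<le> Q (n (Suc j)) (B \<inter> G (k j)) + Q (n (Suc j)) (B - G (k (Suc j)))"
      using that G mono[OF k_le[of j]] by (intro sub) auto
    moreover have "Q (n (Suc j)) (B \<inter> G (k j)) \<le> e" using that G by (intro inner) auto
    moreover have "Q (n (Suc j)) (B - G (k (Suc j))) \<le> e" using that G by (intro outer) auto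
    ultimately show ?thesis by simp
  qed
  have HQ: "8 * e \<le> Q (n (Suc j)) (H j)" for j
  proof -
    let ?C = "space N \<inter> G (k j) \<union> (space N - G (k (Suc j)))"
    have eq: "space N = H j \<union> ?C"
      using sets.sets_into_space[OF G] mono[OF k_le[of j]] by (auto simp: H_def)
    have "Q (n (Suc j)) (H j \<union> ?C) \<le> Q (n (Suc j)) (H j) + Q (n (Suc j)) ?C"
      using G mono[OF k_le[of j]] by (intro sub H) (auto simp: H_def)
    then have "Q (n (Suc j)) (space N) \<le> Q (n (Suc j)) (H j) + Q (n (Suc j)) ?C"
      unfolding eq[symmetric] .
    then show ?thesis using large[of "Suc j"] rest[of "space N" j] by simp
  qed
  define A where "A = (\<Union>j\<in>{j. even j}. H j)"
  have A: "A \<in> sets N" unfolding A_def using H by (intro sets.countable_UN') auto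
  have A_H: "A \<inter> H j = (if even j then H j else {})" for j
  proof -
    have "H i \<inter> H j = {}" if "i \<noteq> j" for i j
    proof -
      have "H i \<inter> H j = {}" if "i < j" for i j
        using mono[OF k_mono[of "Suc i" j]] that by (auto simp: H_def)
      with that show ?thesis by (metis Int_commute nat_neq_iff)
    qed
    then have "i = j" if "x \<in> H i" "x \<in> H j" for i x using that by blast
    then show ?thesis by (auto simp: A_def)
  qed
  have split: "A = (A \<inter> H j) \<union> (A \<inter> G (k j) \<union> (A - G (k (Suc j))))" for j
    using mono[OF k_le[of j]] by (auto simp: H_def)
  have ev: "6 * e \<le> Q (n (Suc j)) A" if "even j" for j
  proof -
    have "Q (n (Suc j)) (H j) \<le> Q (n (Suc j)) (H j \<union> (A \<inter> G (k j) \<union> (A - G (k (Suc j)))))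
        + Q (n (Suc j)) (A \<inter> G (k j) \<union> (A - G (k (Suc j))))"
      using G A by (intro sub' H) (auto simp: H_def)
    also have "H j \<union> (A \<inter> G (k j) \<union> (A - G (k (Suc j)))) = A"
      using split[of j] A_H[of j] that by auto
    finally show ?thesis using HQ[of j] rest[OF A, of j] by simp
  qed
  have od: "Q (n (Suc j)) A \<le> 2 * e" if "odd j" for j
    using split[of j] A_H[of j] that rest[OF A, of j] by simp
  obtain l where l: "(\<lambda>n. Q n A) \<longlonglongrightarrow> l" using conv[OF A] by (auto simp: convergent_def)
  have "(\<lambda>j. Q (n (Suc (2 * j))) A) \<longlonglongrightarrow> l"
    using LIMSEQ_subseq_LIMSEQ[OF l, of "\<lambda>j. n (Suc (2 * j))"] n_mono
    by (simp add: strict_mono_def comp_def)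
  then have "6 * e \<le> l" by (rule LIMSEQ_le_const) (use ev in auto)
  moreover have "(\<lambda>j. Q (n (Suc (2 * j + 1))) A) \<longlonglongrightarrow> l"
    using LIMSEQ_subseq_LIMSEQ[OF l, of "\<lambda>j. n (Suc (2 * j + 1))"] n_mono
    by (simp add: strict_mono_def comp_def)
  then have "l \<le> 2 * e" by (rule LIMSEQ_le_const2) (use od in auto)
  ultimately show False using e by simp
qed

section \<open>Kolmogorov's inequality\<close>

context prob_space
begin

lemma expectation_square_sum_indep:
  fixes X :: "'i \<Rightarrow> 'a \<Rightarrow> real"
  assumes "finite I" "indep_vars (\<lambda>_. borel) X I"
    and "\<And>i. i \<in> I \<Longrightarrow> sq_integrable M (X i)" "\<And>i. i \<in> I \<Longrightarrow> expectation (X i) = 0"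
  shows "expectation (\<lambda>w. (\<Sum>i\<in>I. X i w)\<^sup>2) = (\<Sum>i\<in>I. expectation (\<lambda>w. (X i w)\<^sup>2))"
  using assms
proof (induction I rule: finite_induct)
  case (insert j I)
  have sq: "sq_integrable M (X j)" "sq_integrable M (\<lambda>w. \<Sum>i\<in>I. X i w)"
    using insert.prems by (auto intro!: sq_integrable_sum)
  have "expectation (\<lambda>w. X j w * (\<Sum>i\<in>I. X i w)) = expectation (X j) * expectation (\<lambda>w. \<Sum>i\<in>I. X i w)"
    using insert.hyps insert.prems sq
    by (intro indep_var_lebesgue_integral indep_vars_sum sq_integrable_integrable) auto
  also have "expectation (X j) = 0" using insert.prems by simp
  finally have "expectation (\<lambda>w. (X j w + (\<Sum>i\<in>I. X i w))\<^sup>2)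
      = expectation (\<lambda>w. (X j w)\<^sup>2) + expectation (\<lambda>w. (\<Sum>i\<in>I. X i w)\<^sup>2)"
    using integral_square_add[OF sq] by simp
  moreover have "indep_vars (\<lambda>_. borel) X I"
    using insert.prems(1) by (rule indep_vars_subset) auto
  ultimately show ?case using insert by simp
qed simp

text \<open>Split by the first \<open>k\<close> at which the partial sum reaches \<open>a\<close>.
  On that event the remaining sum is centred and independent of the past, so it can only increase
  the second moment. The start \<open>m\<close> is free because the bound is applied to
  tails.\<close>

lemma Kolmogorov_inequality:
  fixes X :: "nat \<Rightarrow> 'a \<Rightarrow> real"
  assumes indep: "indep_vars (\<lambda>_. borel) X {m..<m + n}"
    and sq: "\<And>i. sq_integrable M (X i)" and mean: "\<And>i. expectation (X i) = 0" and a: "a > 0"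
  shows "a\<^sup>2 * prob {w \<in> space M. \<exists>k\<le>n. a \<le> \<bar>\<Sum>i\<in>{m..<m + k}. X i w\<bar>}
    \<le> (\<Sum>i\<in>{m..<m + n}. expectation (\<lambda>w. (X i w)\<^sup>2))"
proof -
  have Xm [measurable]: "X i \<in> borel_measurable M" for i using sq by (simp add: sq_integrable_def)
  define S where "S k w = (\<Sum>i\<in>{m..<m + k}. X i w)" for k w
  have Sm [measurable]: "S k \<in> borel_measurable M" for k unfolding S_def by measurable
  have sqS: "sq_integrable M (S k)" for k unfolding S_def by (intro sq_integrable_sum sq)
  define T where "T k = {w \<in> space M. a \<le> \<bar>S k w\<bar> \<and> (\<forall>j\<in>{..<k}. \<bar>S j w\<bar> < a)}" for k
  have Tm [measurable]: "T k \<in> sets M" for k unfolding T_def by measurable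
  have disj: "disjoint_family_on T {..n}"
  proof -
    have "T i \<inter> T j = {}" if "i < j" for i j
    proof (rule equals0I)
      fix w assume "w \<in> T i \<inter> T j"
      then have "a \<le> \<bar>S i w\<bar>" "\<bar>S i w\<bar> < a" using that by (auto simp: T_def)
      then show False by simp
    qed
    then show ?thesis unfolding disjoint_family_on_def by (metis Int_commute nat_neq_iff)
  qed
  have UT: "{w \<in> space M. \<exists>k\<le>n. a \<le> \<bar>S k w\<bar>} = (\<Union>k\<in>{..n}. T k)"
  proof (intro equalityI subsetI)
    fix w assume "w \<in> {w \<in> space M. \<exists>k\<le>n. a \<le> \<bar>S k w\<bar>}"
    then obtain k where k: "w \<in> space M" "k \<le> n" "a \<le> \<bar>S k w\<bar>" by auto
    define l where "l = (LEAST k. a \<le> \<bar>S k w\<bar>)"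
    have "a \<le> \<bar>S l w\<bar>" unfolding l_def by (rule LeastI) (rule k)
    moreover have "l \<le> k" unfolding l_def by (rule Least_le) (rule k)
    moreover have "\<bar>S j w\<bar> < a" if "j < l" for j
      using not_less_Least[of j "\<lambda>k. a \<le> \<bar>S k w\<bar>"] that by (auto simp: l_def)
    ultimately have "w \<in> T l" "l \<le> n" using k by (auto simp: T_def)
    then show "w \<in> (\<Union>k\<in>{..n}. T k)" by auto
  qed (auto simp: T_def)
  have ind_sq: "integrable M (\<lambda>w. indicator (T k) w * (S n w)\<^sup>2)" for k
    using integrable_real_mult_indicator[OF Tm sq_integrable_square[OF sqS]] by (simp add: mult.commute)
  have step: "a\<^sup>2 * prob (T k) \<le> expectation (\<lambda>w. indicator (T k) w * (S n w)\<^sup>2)" if "k \<le> n" for k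
  proof -
    \<comment> \<open>\<open>min j k\<close> keeps the sum among the coordinates
      \<open>{m..<m + k}\<close>, so every \<open>s j\<close> is measurable on that product
      space.\<close>
    define s where "s j f = (\<Sum>i\<in>{m..<m + min j k}. f i)" for j and f :: "nat \<Rightarrow> real"
    have [measurable]: "s j \<in> borel_measurable (PiM {m..<m + k} (\<lambda>_. borel))" for j
      unfolding s_def by (intro borel_measurable_sum measurable_component_singleton) auto
    \<comment> \<open>\<open>u\<close> and \<open>v\<close> express
      \<open>indicator (T k) w * S k w\<close> and the remaining sum through disjoint blocks of
      coordinates, which gives their independence.\<close>
    define u where "u f = (if a \<le> \<bar>s k f\<bar> \<and> (\<forall>j\<in>{..<k}. \<bar>s j f\<bar> < a) then s k f else 0)" for f
    have um: "u \<in> borel_measurable (PiM {m..<m + k} (\<lambda>_. borel))"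
      unfolding u_def by measurable
    define v where "v f = (\<Sum>i\<in>{m + k..<m + n}. f i)" for f :: "nat \<Rightarrow> real"
    have vm: "v \<in> borel_measurable (PiM {m + k..<m + n} (\<lambda>_. borel))"
      unfolding v_def by (intro borel_measurable_sum measurable_component_singleton) auto
    define U where "U w = u (\<lambda>i\<in>{m..<m + k}. X i w)" for w
    define W where "W w = v (\<lambda>i\<in>{m + k..<m + n}. X i w)" for w
    have sX: "s j (\<lambda>i\<in>{m..<m + k}. X i w) = S j w" if "j \<le> k" for j w
      unfolding s_def S_def using that by (intro sum.cong) auto
    have U: "U w = indicator (T k) w * S k w" if "w \<in> space M" for w
      using that by (auto simp: U_def u_def sX T_def indicator_def)
    have W: "W w = (\<Sum>i\<in>{m + k..<m + n}. X i w)" for w by (simp add: W_def v_def)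
    have SW: "S n w = S k w + W w" for w
      unfolding S_def W using that by (subst sum.atLeastLessThan_concat) auto
    have "indep_var borel U borel W"
      using indep_var_compose[OF indep_var_restrict[OF indep, of "{m..<m + k}" "{m + k..<m + n}"] um vm] that
      by (auto simp: U_def[abs_def] W_def[abs_def] comp_def)
    moreover have sqW: "sq_integrable M W" unfolding W by (intro sq_integrable_sum sq)
    moreover have iU: "integrable M (\<lambda>w. indicator (T k) w * S k w)"
      using integrable_real_mult_indicator[OF Tm sq_integrable_integrable[OF sqS]] by (simp add: mult.commute)
    moreover have "integrable M U"
      using iU by (subst Bochner_Integration.integrable_cong[OF refl U])
    ultimately have EUW: "expectation (\<lambda>w. U w * W w) = expectation U * expectation W"
      and iUW: "integrable M (\<lambda>w. U w * W w)"
      by (simp_all add: indep_var_lebesgue_integral indep_var_integrable sq_integrable_integrable)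
    have EW: "expectation W = 0"
      unfolding W by (subst Bochner_Integration.integral_sum) (auto simp: mean intro: sq_integrable_integrable sq)
    \<comment> \<open>The cross term has expectation 0. Adding it makes the comparison pointwise:
      only the square of \<open>W w\<close> is dropped from the expanded square of
      \<open>S n w\<close>.\<close>
    have "a\<^sup>2 * prob (T k) = expectation (\<lambda>w. a\<^sup>2 * indicator (T k) w + 2 * (U w * W w))"
      by (subst Bochner_Integration.integral_add)
        (auto simp: EUW EW iUW Int_absorb1 sets.sets_into_space emeasure_eq_measure)
    also have "\<dots> \<le> expectation (\<lambda>w. indicator (T k) w * (S n w)\<^sup>2)"
    proof (rule integral_mono)
      fix w assume w: "w \<in> space M"
      show "a\<^sup>2 * indicator (T k) w + 2 * (U w * W w) \<le> indicator (T k) w * (S n w)\<^sup>2"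
      proof (cases "w \<in> T k")
        case True
        then have "a\<^sup>2 \<le> (S k w)\<^sup>2"
          using a power_mono[of a "\<bar>S k w\<bar>" 2] by (simp add: T_def)
        then have "a\<^sup>2 + 2 * (S k w * W w) \<le> (S k w + W w)\<^sup>2"
          by (simp add: power2_sum add_increasing2)
        then show ?thesis using True by (simp add: U[OF w] SW)
      qed (simp add: U[OF w])
    qed (auto simp: iUW ind_sq emeasure_eq_measure)
    finally show ?thesis .
  qed
  have "prob (\<Union>k\<in>{..n}. T k) = (\<Sum>k\<le>n. prob (T k))"
    using disj by (intro finite_measure_finite_Union) auto
  then have "a\<^sup>2 * prob (\<Union>k\<in>{..n}. T k) = (\<Sum>k\<le>n. a\<^sup>2 * prob (T k))" by (simp add: sum_distrib_left)
  also have "\<dots> \<le> (\<Sum>k\<le>n. expectation (\<lambda>w. indicator (T k) w * (S n w)\<^sup>2))"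
    by (intro sum_mono step) auto
  also have "\<dots> = expectation (\<lambda>w. \<Sum>k\<le>n. indicator (T k) w * (S n w)\<^sup>2)"
    by (subst Bochner_Integration.integral_sum) (auto simp: ind_sq)
  also have "\<dots> \<le> expectation (\<lambda>w. (S n w)\<^sup>2)"
  proof (rule integral_mono)
    fix w
    have "(\<Sum>k\<le>n. indicator (T k) w * (S n w)\<^sup>2) = indicator (\<Union>k\<in>{..n}. T k) w * (S n w)\<^sup>2"
      using disj by (subst indicator_UN_disjoint) (auto simp: sum_distrib_right)
    then show "(\<Sum>k\<le>n. indicator (T k) w * (S n w)\<^sup>2) \<le> (S n w)\<^sup>2"
      by (rule ord_eq_le_trans) (auto simp: indicator_def)
  qed (intro Bochner_Integration.integrable_sum ind_sq sq_integrable_square sqS)+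
  also have "\<dots> = (\<Sum>i\<in>{m..<m + n}. expectation (\<lambda>w. (X i w)\<^sup>2))"
    unfolding S_def by (rule expectation_square_sum_indep) (auto simp: indep sq mean)
  finally show ?thesis unfolding UT[symmetric] S_def .
qed

text \<open>Kolmogorov's one-series theorem. The maximal inequality bounds the probability that some
  partial sum from \<open>m\<close> on reaches \<open>a\<close> by a tail of the variance series;
  this happening for all \<open>m\<close> at once is a null event, so the partial sums are almost
  surely Cauchy.\<close>

lemma AE_summable_indep:
  fixes X :: "nat \<Rightarrow> 'a \<Rightarrow> real"
  assumes indep: "indep_vars (\<lambda>_. borel) X UNIV"
    and sq: "\<And>i. sq_integrable M (X i)" and mean: "\<And>i. expectation (X i) = 0"
    and sm: "summable (\<lambda>i. expectation (\<lambda>w. (X i w)\<^sup>2))"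
  shows "AE w in M. summable (\<lambda>i. X i w)"
proof -
  have Xm [measurable]: "X i \<in> borel_measurable M" for i using sq by (simp add: sq_integrable_def)
  define B where "B a m = {w \<in> space M. \<exists>k. a \<le> \<bar>\<Sum>i\<in>{m..<m + k}. X i w\<bar>}" for a :: real and m
  have Bm [measurable]: "B a m \<in> sets M" for a m unfolding B_def by measurable
  have PB: "a\<^sup>2 * prob (B a m) \<le> e" if a: "a > 0"
    and e: "\<And>n. (\<Sum>i\<in>{m..<m + n}. expectation (\<lambda>w. (X i w)\<^sup>2)) \<le> e" for a m e
  proof -
    \<comment> \<open>The inequality covers finitely many partial sums; continuity from below
      extends it to all of them.\<close>
    let ?C = "\<lambda>n. {w \<in> space M. \<exists>k\<le>n. a \<le> \<bar>\<Sum>i\<in>{m..<m + k}. X i w\<bar>}"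
    have "(\<lambda>n. prob (?C n)) \<longlonglongrightarrow> prob (\<Union>n. ?C n)"
      by (intro finite_Lim_measure_incseq incseq_SucI) (auto intro: le_SucI)
    also have "(\<Union>n. ?C n) = B a m" by (auto simp: B_def)
    finally have "(\<lambda>n. a\<^sup>2 * prob (?C n)) \<longlonglongrightarrow> a\<^sup>2 * prob (B a m)" by (intro tendsto_intros)
    moreover have "a\<^sup>2 * prob (?C n) \<le> e" for n
      using Kolmogorov_inequality[OF indep_vars_subset[OF indep] sq mean a, of m n] e[of n] by simp
    ultimately show ?thesis by (intro LIMSEQ_le_const2) auto
  qed
  have "AE w in M. \<exists>m. \<forall>k. \<bar>\<Sum>i\<in>{m..<m + k}. X i w\<bar> < inverse (real (Suc j))" for j
  proof -
    define a where "a = inverse (real (Suc j))"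
    have a: "a > 0" by (simp add: a_def)
    have le: "prob (\<Inter>m. B a m) \<le> e" if "e > 0" for e
    proof -
      have "a\<^sup>2 * e > 0" using a that by simp
      then obtain m where m: "\<And>n. norm (\<Sum>i\<in>{m..<n}. expectation (\<lambda>w. (X i w)\<^sup>2)) < a\<^sup>2 * e"
        using sm unfolding summable_Cauchy by blast
      have "a\<^sup>2 * prob (B a m) \<le> a\<^sup>2 * e"
        by (rule PB[OF a]) (metis m abs_le_D1 less_imp_le real_norm_def)
      then have "prob (B a m) \<le> e" using a by simp
      moreover have "prob (\<Inter>m. B a m) \<le> prob (B a m)" by (intro finite_measure_mono) auto
      ultimately show ?thesis by simp
    qed
    have "prob (\<Inter>m. B a m) \<le> 0" by (rule field_le_epsilon) (simp add: le)
    then have "prob (\<Inter>m. B a m) = 0" by (simp add: measure_le_0_iff)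
    moreover have "(\<Inter>m. B a m) \<in> sets M" by measurable
    ultimately have "(\<Inter>m. B a m) \<in> null_sets M" by (simp add: null_sets_def emeasure_eq_measure)
    then show ?thesis
      by (rule AE_I') (auto simp: B_def a_def not_less)
  qed
  then have "AE w in M. \<forall>j. \<exists>m. \<forall>k. \<bar>\<Sum>i\<in>{m..<m + k}. X i w\<bar> < inverse (real (Suc j))"
    by (simp add: AE_all_countable)
  then show ?thesis
  proof eventually_elim
    case (elim w)
    show ?case unfolding summable_Cauchy
    proof (intro allI impI)
      fix e :: real assume "e > 0"
      \<comment> \<open>The block from \<open>p\<close> to \<open>n\<close> is the difference of two
        blocks that start at \<open>m\<close>, hence the half.\<close>
      then obtain j where j: "inverse (real (Suc j)) < e / 2" using reals_Archimedean[of "e/2"] by auto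
      from elim obtain m where m: "\<And>k. \<bar>\<Sum>i\<in>{m..<m + k}. X i w\<bar> < inverse (real (Suc j))" by blast
      have "norm (\<Sum>i\<in>{p..<n}. X i w) < e" if "p \<ge> m" for p n
      proof (cases "p \<le> n")
        case True
        have "(\<Sum>i\<in>{m..<n}. X i w) = (\<Sum>i\<in>{m..<p}. X i w) + (\<Sum>i\<in>{p..<n}. X i w)"
          using that True by (simp add: sum.atLeastLessThan_concat)
        then show ?thesis using m[of "n - m"] m[of "p - m"] j that True by simp
      qed (use \<open>e > 0\<close> in auto)
      then show "\<exists>N. \<forall>m\<ge>N. \<forall>n. norm (\<Sum>i\<in>{m..<n}. X i w) < e" by blast
    qed
  qed
qed

end

section \<open>Moments of Levy processes\<close>

text \<open>Cauchy's functional equation. The defect \<open>g\<close> vanishes at nonnegative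
  rationals, so its bound on \<open>[0, d)\<close> extends to all times, and then
  \<open>g (n * t) = n * g t\<close> leaves only the value 0.\<close>

lemma additive_bounded_imp_linear:
  fixes f :: "real \<Rightarrow> real"
  assumes add: "\<And>s t. 0 \<le> s \<Longrightarrow> 0 \<le> t \<Longrightarrow> f (s + t) = f s + f t"
    and d: "0 < d" and bound: "\<And>t. 0 \<le> t \<Longrightarrow> t < d \<Longrightarrow> \<bar>f t\<bar> \<le> C" and t: "0 \<le> t"
  shows "f t = t * f 1"
proof -
  define g where "g t = f t - t * f 1" for t
  have g_add: "g (s + t) = g s + g t" if "0 \<le> s" "0 \<le> t" for s t
    using add[OF that] by (simp add: g_def algebra_simps)
  have g0: "g 0 = 0" using g_add[of 0 0] by simp
  have g_nat: "g (real n * t) = real n * g t" if "0 \<le> t" for n t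
  proof (induction n)
    case (Suc n)
    have "g (real (Suc n) * t) = g (real n * t + t)" by (simp add: algebra_simps)
    also have "\<dots> = real n * g t + g t" using that Suc.IH by (subst g_add) auto
    also have "\<dots> = real (Suc n) * g t" by (simp add: algebra_simps)
    finally show ?case .
  qed (simp add: g0)
  have g_rat: "g (real k / real m) = 0" if "m > 0" for k m :: nat
  proof -
    have "real m * g (real k / real m) = g (real k)"
      using g_nat[of "real k / real m" m] that by simp
    also have "\<dots> = 0" using g_nat[of 1 k] by (simp add: g_def)
    finally show ?thesis using that by simp
  qed
  define B where "B = C + d * \<bar>f 1\<bar>"
  have gB: "\<bar>g t\<bar> \<le> B" if "0 \<le> t" "t < d" for t
  proof -
    have "\<bar>g t\<bar> \<le> \<bar>f t\<bar> + t * \<bar>f 1\<bar>" using that by (simp add: g_def abs_mult[symmetric] abs_triangle_ineq4[THEN order_trans] abs_mult)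
    also have "\<dots> \<le> B" using bound[OF that] that by (auto simp: B_def intro!: add_mono mult_right_mono)
    finally show ?thesis .
  qed
  have all: "\<bar>g x\<bar> \<le> B" if x: "0 \<le> x" for x
  proof -
    obtain m :: nat where m: "m > 0" "1 / real m < d"
      using d by (metis real_arch_inverse inverse_eq_divide neq0_conv)
    \<comment> \<open>The multiple \<open>k / m\<close> of \<open>1 / m\<close> just below
      \<open>x\<close> leaves a remainder shorter than \<open>d\<close>, and \<open>g\<close>
      vanishes at \<open>k / m\<close>.\<close>
    define k where "k = nat \<lfloor>x * real m\<rfloor>"
    have k: "real k \<le> x * real m" "x * real m < real k + 1"
      using x by (auto simp: k_def)
    have r: "real k / real m \<le> x" "x - real k / real m < 1 / real m"
    proof -
      show "real k / real m \<le> x" using k m by (simp add: pos_divide_le_eq)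
      have "x < (real k + 1) / real m" using k m by (simp add: pos_less_divide_eq)
      then show "x - real k / real m < 1 / real m" by (simp add: add_divide_distrib)
    qed
    have "g x = g (real k / real m) + g (x - real k / real m)"
      using g_add[of "real k / real m" "x - real k / real m"] r by simp
    then show ?thesis using g_rat[OF m(1)] gB[of "x - real k / real m"] r m by simp
  qed
  have "g t = 0"
  proof (rule ccontr)
    assume "g t \<noteq> 0"
    then obtain n :: nat where n: "B < real n * \<bar>g t\<bar>" using reals_Archimedean3[of "\<bar>g t\<bar>"] by auto
    have "real n * \<bar>g t\<bar> = \<bar>g (real n * t)\<bar>" using g_nat[OF t, of n] by (simp add: abs_mult)
    also have "\<dots> \<le> B" using t by (intro all) simp
    finally show False using n by simp
  qed
  then show ?thesis by (simp add: g_def)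
qed

context prob_space
begin

section \<open>Independence of reindexed and of combined families\<close>

lemma indep_vars_reindex_inj:
  fixes X :: "'i \<Rightarrow> 'a \<Rightarrow> real"
  assumes "inj_on h J" "indep_vars (\<lambda>_. borel) X I" "h ` J \<subseteq> I"
  shows "indep_vars (\<lambda>_. borel) (\<lambda>j. X (h j)) J"
proof -
  have "indep_vars (\<lambda>_. borel) (\<lambda>j w. (\<lambda>i\<in>{h j}. X i w) (h j)) J"
    by (rule indep_vars_compose2[OF indep_vars_restrict[OF assms(2), of J "\<lambda>j. {h j}"]])
      (use assms in \<open>auto simp: disjoint_family_on_def inj_on_def\<close>)
  then show ?thesis by simp
qed

text \<open>Events of the two families are preimages under the independent paths \<open>P1\<close>
  and \<open>P2\<close>, so a joint event is the preimage of a rectangle and its probability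
  factors. This glues the increments on the two sides of time 0.\<close>

lemma indep_vars_union:
  fixes X :: "'i \<Rightarrow> 'a \<Rightarrow> real"
  assumes paths: "indep_var N1 P1 N2 P2"
    and X1: "\<And>i. i \<in> I \<Longrightarrow> e i \<in> borel_measurable N1" "\<And>i w. i \<in> I \<Longrightarrow> w \<in> space M \<Longrightarrow> X i w = e i (P1 w)"
    and X2: "\<And>i. i \<in> J \<Longrightarrow> e i \<in> borel_measurable N2" "\<And>i w. i \<in> J \<Longrightarrow> w \<in> space M \<Longrightarrow> X i w = e i (P2 w)"
    and I: "indep_vars (\<lambda>_. borel) X I" and J: "indep_vars (\<lambda>_. borel) X J" and IJ: "I \<inter> J = {}"
  shows "indep_vars (\<lambda>_. borel) X (I \<union> J)"
proof -
  let ?F = "\<lambda>i. {X i -` B \<inter> space M |B. B \<in> sets borel}"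
  have rv: "X i \<in> borel_measurable M" if "i \<in> I \<union> J" for i
    using I J that by (auto simp: indep_vars_def)
  have P: "P1 \<in> measurable M N1" "P2 \<in> measurable M N2"
    using paths by (auto dest: indep_var_rv1 indep_var_rv2)
  have prod: "prob (space M \<inter> (\<Inter>i\<in>K. X i -` B i)) = (\<Prod>i\<in>K. prob (X i -` B i \<inter> space M))"
    if "indep_vars (\<lambda>_. borel) X I'" "K \<subseteq> I'" "finite K" "\<And>i. i \<in> K \<Longrightarrow> B i \<in> sets borel" for I' K B
  proof (cases "K = {}")
    case False
    have "prob (\<Inter>i\<in>K. X i -` B i \<inter> space M) = (\<Prod>i\<in>K. prob (X i -` B i \<inter> space M))"
      using that False by (intro indep_varsD[OF that(1)]) auto
    moreover have "(\<Inter>i\<in>K. X i -` B i \<inter> space M) = space M \<inter> (\<Inter>i\<in>K. X i -` B i)" using False by auto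
    ultimately show ?thesis by simp
  qed (simp add: prob_space)
  have "indep_sets ?F (I \<union> J)"
  proof (rule indep_setsI)
    show "?F i \<subseteq> events" if "i \<in> I \<union> J" for i using rv[OF that] by (auto intro: measurable_sets)
    fix A K assume K: "K \<noteq> {}" "K \<subseteq> I \<union> J" "finite K" and "\<forall>i\<in>K. A i \<in> ?F i"
    then have "\<forall>i\<in>K. \<exists>B. A i = X i -` B \<inter> space M \<and> B \<in> sets borel" by auto
    then obtain B where B: "\<And>i. i \<in> K \<Longrightarrow> A i = X i -` B i \<inter> space M" "\<And>i. i \<in> K \<Longrightarrow> B i \<in> sets borel" by metis
    define K1 K2 where "K1 = K \<inter> I" and "K2 = K \<inter> J"
    have KK: "K = K1 \<union> K2" "K1 \<inter> K2 = {}" "finite K1" "finite K2" using K IJ by (auto simp: K1_def K2_def)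
    \<comment> \<open>For empty \<open>K1\<close> the bare intersection would be
      \<open>UNIV\<close>; intersecting with the space gives a measurable set in that case as
      well.\<close>
    define S1 where "S1 = space N1 \<inter> (\<Inter>i\<in>K1. e i -` B i \<inter> space N1)"
    define S2 where "S2 = space N2 \<inter> (\<Inter>i\<in>K2. e i -` B i \<inter> space N2)"
    have S1: "S1 \<in> sets N1"
    proof (cases "K1 = {}")
      case False
      have "(\<Inter>i\<in>K1. e i -` B i \<inter> space N1) \<in> sets N1"
      proof (rule sets.finite_INT[OF KK(3) False])
        fix i assume "i \<in> K1"
        then show "e i -` B i \<inter> space N1 \<in> sets N1"
          using measurable_sets[OF X1(1)[of i] B(2)[of i]] by (simp add: K1_def)
      qed
      then show ?thesis by (simp add: S1_def)
    qed (simp add: S1_def)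
    have S2: "S2 \<in> sets N2"
    proof (cases "K2 = {}")
      case False
      have "(\<Inter>i\<in>K2. e i -` B i \<inter> space N2) \<in> sets N2"
      proof (rule sets.finite_INT[OF KK(4) False])
        fix i assume "i \<in> K2"
        then show "e i -` B i \<inter> space N2 \<in> sets N2"
          using measurable_sets[OF X2(1)[of i] B(2)[of i]] by (simp add: K2_def)
      qed
      then show ?thesis by (simp add: S2_def)
    qed (simp add: S2_def)
    have e1: "P1 -` S1 \<inter> space M = space M \<inter> (\<Inter>i\<in>K1. X i -` B i)"
      using measurable_space[OF P(1)] X1(2) by (auto simp: S1_def K1_def)
    have e2: "P2 -` S2 \<inter> space M = space M \<inter> (\<Inter>i\<in>K2. X i -` B i)"
      using measurable_space[OF P(2)] X2(2) by (auto simp: S2_def K2_def)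
    have p1: "prob (space M \<inter> (\<Inter>i\<in>K1. X i -` B i)) = (\<Prod>i\<in>K1. prob (X i -` B i \<inter> space M))"
      by (rule prod[OF I _ KK(3)]) (auto simp: K1_def intro: B(2))
    have p2: "prob (space M \<inter> (\<Inter>i\<in>K2. X i -` B i)) = (\<Prod>i\<in>K2. prob (X i -` B i \<inter> space M))"
      by (rule prod[OF J _ KK(4)]) (auto simp: K2_def intro: B(2))
    have "(\<Inter>i\<in>K. A i) = (\<lambda>w. (P1 w, P2 w)) -` (S1 \<times> S2) \<inter> space M"
    proof -
      have "(\<Inter>i\<in>K. A i) = (P1 -` S1 \<inter> space M) \<inter> (P2 -` S2 \<inter> space M)"
        unfolding e1 e2 using KK(1) K(1) B(1) by auto
      then show ?thesis by auto
    qed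
    then have "prob (\<Inter>i\<in>K. A i) = prob (P1 -` S1 \<inter> space M) * prob (P2 -` S2 \<inter> space M)"
      using indep_varD[OF paths S1 S2] by simp
    also have "\<dots> = (\<Prod>i\<in>K1. prob (X i -` B i \<inter> space M)) * (\<Prod>i\<in>K2. prob (X i -` B i \<inter> space M))"
      unfolding e1 e2 p1 p2 ..
    also have "\<dots> = (\<Prod>i\<in>K. prob (X i -` B i \<inter> space M))"
      unfolding KK(1) using KK by (subst prod.union_disjoint) auto
    finally show "prob (\<Inter>i\<in>K. A i) = (\<Prod>i\<in>K. prob (A i))" using B by simp
  qed
  then show ?thesis using rv by (simp add: indep_vars_def2)
qed

section \<open>One-sided Levy processes: second moments, linearity in time, left limits\<close>

lemma levy_measurable: "levy_process L \<Longrightarrow> 0 \<le> t \<Longrightarrow> L t \<in> borel_measurable M"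
  by (simp add: levy_process_def)

lemma levy_indep_incr:
  assumes L: "levy_process L" and st: "0 \<le> s" "s \<le> t"
  shows "indep_var borel (\<lambda>w. L s w - L 0 w) borel (\<lambda>w. L t w - L s w)"
proof -
  \<comment> \<open>Independent increments are stated for monotone sequences on all of nat, so the
    times 0, \<open>s\<close>, \<open>t\<close> are continued by \<open>t\<close>.\<close>
  define r where "r i = (if i = 0 then 0 else if i = 1 then s else t)" for i :: nat
  have "mono r" using st by (auto simp: mono_def r_def)
  moreover have "0 \<le> r 0" by (simp add: r_def)
  ultimately have "indep_vars (\<lambda>_. borel) (\<lambda>i w. L (r (Suc i)) w - L (r i) w) {..<2}"
    using L unfolding levy_process_def by blast
  moreover have "{..<2::nat} = insert 0 {1}" by auto
  ultimately have "indep_vars (\<lambda>_. borel) (\<lambda>i w. L (r (Suc i)) w - L (r i) w) (insert 0 {1})" by simp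
  from indep_vars_sum[OF _ _ this] show ?thesis by (simp add: r_def)
qed

lemma levy_incr_distr:
  assumes L: "levy_process L" and st: "0 \<le> s" "s \<le> t"
  shows "distr M borel (\<lambda>w. L t w - L s w) = distr M borel (L (t - s))"
proof -
  have "\<forall>s\<ge>0. \<forall>h\<ge>0. distr M borel (\<lambda>w. L (s + h) w - L s w) = distr M borel (L h)"
    using L by (simp add: levy_process_def)
  from this[rule_format, of s "t - s"] st show ?thesis by simp
qed

lemma distr_eq_moments:
  assumes eq: "distr M borel X = distr M borel Y" and [measurable]: "X \<in> borel_measurable M" "Y \<in> borel_measurable M"
  shows "sq_integrable M X \<longleftrightarrow> sq_integrable M Y" "expectation X = expectation Y"
    "expectation (\<lambda>w. (X w)\<^sup>2) = expectation (\<lambda>w. (Y w)\<^sup>2)"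
proof -
  have "integrable M (\<lambda>w. (X w)\<^sup>2) \<longleftrightarrow> integrable (distr M borel X) (\<lambda>x. x\<^sup>2)"
    by (simp add: integrable_distr_eq)
  also have "\<dots> \<longleftrightarrow> integrable M (\<lambda>w. (Y w)\<^sup>2)" unfolding eq by (simp add: integrable_distr_eq)
  finally show "sq_integrable M X \<longleftrightarrow> sq_integrable M Y" by (simp add: sq_integrable_def)
  have "expectation X = (\<integral>x. x \<partial>distr M borel X)" by (simp add: integral_distr)
  also have "\<dots> = expectation Y" unfolding eq by (simp add: integral_distr)
  finally show "expectation X = expectation Y" .
  have "expectation (\<lambda>w. (X w)\<^sup>2) = (\<integral>x. x\<^sup>2 \<partial>distr M borel X)" by (simp add: integral_distr)
  also have "\<dots> = expectation (\<lambda>w. (Y w)\<^sup>2)" unfolding eq by (simp add: integral_distr)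
  finally show "expectation (\<lambda>w. (X w)\<^sup>2) = expectation (\<lambda>w. (Y w)\<^sup>2)" .
qed

lemma levy_incr_moments:
  assumes L: "levy_process L" and st: "0 \<le> s" "s \<le> t"
  shows "sq_integrable M (\<lambda>w. L t w - L s w) \<longleftrightarrow> sq_integrable M (L (t - s))"
    "expectation (\<lambda>w. L t w - L s w) = expectation (L (t - s))"
    "expectation (\<lambda>w. (L t w - L s w)\<^sup>2) = expectation (\<lambda>w. (L (t - s) w)\<^sup>2)"
proof -
  have m: "(\<lambda>w. L t w - L s w) \<in> borel_measurable M" "L (t - s) \<in> borel_measurable M"
    using st by (auto intro!: borel_measurable_diff levy_measurable[OF L])
  show "sq_integrable M (\<lambda>w. L t w - L s w) \<longleftrightarrow> sq_integrable M (L (t - s))"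
    "expectation (\<lambda>w. L t w - L s w) = expectation (L (t - s))"
    "expectation (\<lambda>w. (L t w - L s w)\<^sup>2) = expectation (\<lambda>w. (L (t - s) w)\<^sup>2)"
    by (rule distr_eq_moments[OF levy_incr_distr[OF L st] m])+
qed

text \<open>Up to time 1 the increment of \<open>L\<close> over the unit interval is a sum of two
  independent ones, and \<open>sq_integrable_of_indep_sum\<close> applies; later times are reached
  in unit steps by stationarity.\<close>

lemma levy_sq_integrable:
  assumes L: "levy_process L" and sq1: "sq_integrable M (L 1)" and t: "0 \<le> t"
  shows "sq_integrable M (L t)"
proof -
  have unit: "sq_integrable M (L t)" if t: "0 \<le> t" "t \<le> 1" for t
  proof -
    have "sq_integrable M (\<lambda>w. L 1 w - L 0 w)" using levy_incr_moments(1)[OF L, of 0 1] sq1 by simp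
    then have "sq_integrable M (\<lambda>w. (L t w - L 0 w) + (L 1 w - L t w))" by simp
    then have "sq_integrable M (\<lambda>w. L t w - L 0 w)"
      by (rule sq_integrable_of_indep_sum[OF levy_indep_incr[OF L t]])
    then show ?thesis using levy_incr_moments(1)[OF L, of 0 t] t by simp
  qed
  have "\<forall>t. 0 \<le> t \<longrightarrow> t \<le> real (Suc n) \<longrightarrow> sq_integrable M (L t)" for n
  proof (induction n)
    case 0
    then show ?case using unit by simp
  next
    case (Suc n)
    show ?case
    proof (intro allI impI)
      fix t assume t: "0 \<le> t" "t \<le> real (Suc (Suc n))"
      show "sq_integrable M (L t)"
      proof (cases "t \<le> 1")
        case False
        then have "sq_integrable M (L (t - 1))" using Suc t by simp
        then have "sq_integrable M (\<lambda>w. L t w - L 1 w)"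
          using levy_incr_moments(1)[OF L, of 1 t] False by simp
        from sq_integrable_add[OF this sq1] show ?thesis by simp
      qed (use unit t in auto)
    qed
  qed
  moreover obtain n :: nat where "t \<le> real n" using real_arch_simple by blast
  then have "t \<le> real (Suc n)" by simp
  ultimately show ?thesis using t by blast
qed

text \<open>Independent stationary increments make mean and variance additive in time. The variance
  is monotone, hence locally bounded; the mean is bounded near 0 by stochastic continuity. Cauchy's
  equation then makes both linear.\<close>

lemma levy_moments:
  assumes L: "levy_process L" and sq1: "sq_integrable M (L 1)" and st: "0 \<le> s" "s \<le> t"
  shows "sq_integrable M (\<lambda>w. L t w - L s w)"
    "expectation (\<lambda>w. L t w - L s w) = expectation (L 1) * (t - s)"
    "expectation (\<lambda>w. (L t w - L s w)\<^sup>2) = variance (L 1) * (t - s) + (expectation (L 1))\<^sup>2 * (t - s)\<^sup>2"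
proof -
  note sq = levy_sq_integrable[OF L sq1]
  define m where "m t = expectation (L t)" for t
  define v where "v t = expectation (\<lambda>w. (L t w)\<^sup>2) - (m t)\<^sup>2" for t
  have var: "variance (L t) = v t" if "0 \<le> t" for t
    unfolding v_def m_def using sq[OF that]
    by (intro variance_eq sq_integrable_integrable sq_integrable_square)
  have v_nonneg: "0 \<le> v t" if "0 \<le> t" for t unfolding var[OF that, symmetric] by simp
  have add: "m (s + t) = m s + m t" "v (s + t) = v s + v t" if st: "0 \<le> s" "0 \<le> t" for s t
  proof -
    define A where "A w = L s w - L 0 w" for w
    define B where "B w = L (s + t) w - L s w" for w
    have sqs: "sq_integrable M A" "sq_integrable M B"
      unfolding A_def B_def using st by (auto intro!: sq_integrable_diff sq)
    note int = sqs[THEN sq_integrable_integrable]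
    have AB: "expectation (\<lambda>w. A w * B w) = expectation A * expectation B"
      using levy_indep_incr[OF L, of s "s + t"] st int
      unfolding A_def B_def by (intro indep_var_lebesgue_integral) auto
    have EA: "expectation A = m s" "expectation (\<lambda>w. (A w)\<^sup>2) = v s + (m s)\<^sup>2"
      using levy_incr_moments[OF L, of 0 s] st by (auto simp: A_def[abs_def] m_def v_def)
    have EB: "expectation B = m t" "expectation (\<lambda>w. (B w)\<^sup>2) = v t + (m t)\<^sup>2"
      using levy_incr_moments[OF L, of s "s + t"] st by (auto simp: B_def[abs_def] m_def v_def)
    have AB_sum: "A w + B w = L (s + t) w - L 0 w" for w by (simp add: A_def B_def)
    have "m (s + t) = expectation (\<lambda>w. A w + B w)" "v (s + t) + (m (s + t))\<^sup>2 = expectation (\<lambda>w. (A w + B w)\<^sup>2)"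
      unfolding AB_sum using levy_incr_moments[OF L, of 0 "s + t"] st by (auto simp: m_def v_def)
    then have 1: "m (s + t) = m s + m t" and "v (s + t) + (m (s + t))\<^sup>2 = v s + (m s)\<^sup>2 + 2 * (m s * m t) + (v t + (m t)\<^sup>2)"
      using int integral_square_add[OF sqs] EA EB AB by auto
    then show "m (s + t) = m s + m t" "v (s + t) = v s + v t"
      by (auto simp: power2_sum)
  qed
  have v_le: "v t \<le> v 1" if "0 \<le> t" "t \<le> 1" for t
    using add(2)[of t "1 - t"] v_nonneg[of "1 - t"] that by simp
  have v_lin: "v t = t * v 1" if "0 \<le> t" for t
    by (rule additive_bounded_imp_linear[of v 1 "v 1"]) (use add v_le v_nonneg that in auto)
  have "tendsto_in_prob L (L 0) (at 0 within {0..})" using L by (simp add: levy_process_def)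
  then have "((\<lambda>t. prob {w \<in> space M. \<bar>L t w - L 0 w\<bar> > 1}) \<longlongrightarrow> 0) (at 0 within {0..})"
    unfolding tendsto_in_prob_def by simp
  then have "\<forall>\<^sub>F t in at 0 within {0..}. prob {w \<in> space M. \<bar>L t w - L 0 w\<bar> > 1} < 1/2"
    by (rule order_tendstoD) simp
  then obtain d0 where d0: "d0 > 0" "\<And>t. 0 < t \<Longrightarrow> t < d0 \<Longrightarrow> prob {w \<in> space M. \<bar>L t w - L 0 w\<bar> > 1} < 1/2"
    unfolding eventually_at by (force simp: dist_real_def)
  \<comment> \<open>The root is the \<open>c\<close> below, which brings Chebyshev's bound under
    1/2; the extra 1 is the deviation allowed by stochastic continuity.\<close>
  define C where "C = sqrt (2 * v 1 + 1) + 1"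
  have C: "1 \<le> C" using v_nonneg[of 1] by (simp add: C_def)
  have m_bound: "\<bar>m t\<bar> \<le> C" if t: "0 \<le> t" "t < min 1 d0" for t
  proof (cases "t = 0")
    case True
    then show ?thesis using add(1)[of 0 0] C by simp
  next
    case False
    define c where "c = sqrt (2 * v 1 + 1)"
    have c: "c > 0" "c\<^sup>2 = 2 * v 1 + 1" using v_nonneg[of 1] by (auto simp: c_def)
    have [measurable]: "L t \<in> borel_measurable M" "L 0 \<in> borel_measurable M"
      using t by (auto intro: levy_measurable[OF L])
    have "prob {w \<in> space M. c \<le> \<bar>L t w - m t\<bar>} \<le> variance (L t) / c\<^sup>2"
      unfolding m_def using c sq[OF t(1)]
      by (intro Chebyshev_inequality) (auto intro: sq_integrable_square)
    also have "\<dots> \<le> v 1 / c\<^sup>2" unfolding var[OF t(1)] by (rule divide_right_mono) (use v_le[of t] t in auto)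
    also have "\<dots> < 1/2" using c v_nonneg[of 1] by (simp add: field_simps)
    finally have 1: "prob {w \<in> space M. c \<le> \<bar>L t w - m t\<bar>} < 1/2" .
    have 2: "prob {w \<in> space M. \<bar>L t w - L 0 w\<bar> > 1} < 1/2" using d0(2)[of t] t False by simp
    have L0: "AE w in M. L 0 w = 0" using L by (simp add: levy_process_def)
    show ?thesis
    proof (rule ccontr)
      assume neg: "\<not> \<bar>m t\<bar> \<le> C"
      \<comment> \<open>If \<open>|m t|\<close> exceeded \<open>C\<close>, two events of probability
        below 1/2 each would cover almost everything.\<close>
      have "1 \<le> prob ({w \<in> space M. c \<le> \<bar>L t w - m t\<bar>} \<union> {w \<in> space M. \<bar>L t w - L 0 w\<bar> > 1})"
      proof -
        have "AE w in M. w \<in> {w \<in> space M. c \<le> \<bar>L t w - m t\<bar>} \<union> {w \<in> space M. \<bar>L t w - L 0 w\<bar> > 1}"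
          using L0 AE_space
        proof eventually_elim
          case (elim w)
          then show ?case using neg by (auto simp: C_def c_def[symmetric])
        qed
        then show ?thesis by (subst (asm) prob_eq_1[symmetric]) auto
      qed
      also have "\<dots> \<le> prob {w \<in> space M. c \<le> \<bar>L t w - m t\<bar>} + prob {w \<in> space M. \<bar>L t w - L 0 w\<bar> > 1}"
        by (intro measure_Un_le) auto
      finally show False using 1 2 by simp
    qed
  qed
  have m_lin: "m t = t * m 1" if "0 \<le> t" for t
    by (rule additive_bounded_imp_linear[of m "min 1 d0" C]) (use add m_bound d0(1) that in auto)
  show "sq_integrable M (\<lambda>w. L t w - L s w)" using st by (intro sq_integrable_diff sq) auto
  show "expectation (\<lambda>w. L t w - L s w) = expectation (L 1) * (t - s)"
    using levy_incr_moments(2)[OF L st] m_lin[of "t - s"] st by (simp add: m_def)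
  show "expectation (\<lambda>w. (L t w - L s w)\<^sup>2) = variance (L 1) * (t - s) + (expectation (L 1))\<^sup>2 * (t - s)\<^sup>2"
  proof -
    have "expectation (\<lambda>w. (L t w - L s w)\<^sup>2) = v (t - s) + (m (t - s))\<^sup>2"
      using levy_incr_moments(3)[OF L st] by (simp add: v_def)
    also have "\<dots> = v 1 * (t - s) + (m 1)\<^sup>2 * (t - s)\<^sup>2"
      using v_lin[of "t - s"] m_lin[of "t - s"] st by (simp add: power_mult_distrib)
    finally show ?thesis by (simp add: var m_def)
  qed
qed

text \<open>There are no fixed discontinuities: along \<open>u n\<close> increasing to
  \<open>t\<close> the values converge almost surely to the left limit and in probability to
  \<open>L t\<close>.\<close>

lemma levy_left_limit:
  assumes L: "levy_process L" and t: "0 < t"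
  shows "AE w in M. Lim (at_left t) (\<lambda>s. L s w) = L t w"
proof -
  \<comment> \<open>The offset 2 keeps every \<open>u n\<close> strictly between 0 and
    \<open>t\<close>.\<close>
  define u where "u n = t - t / real (n + 2)" for n
  have u: "0 < u n" "u n < t" for n using t by (auto simp: u_def field_simps add_pos_nonneg)
  have u_lim: "u \<longlonglongrightarrow> t"
  proof -
    have "(\<lambda>n. t - t / real (n + 2)) \<longlonglongrightarrow> t - 0"
      by (intro tendsto_diff tendsto_const LIMSEQ_ignore_initial_segment lim_const_over_n)
    then show ?thesis by (simp add: u_def[abs_def])
  qed
  have um [measurable]: "L (u n) \<in> borel_measurable M" and [measurable]: "L t \<in> borel_measurable M" for n
    using levy_measurable[OF L] u[of n] t by auto
  define Z where "Z w = lim (\<lambda>n. L (u n) w)" for w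
  have [measurable]: "Z \<in> borel_measurable M" unfolding Z_def by measurable
  have "AE w in M. cadlag_on_nonneg (\<lambda>t. L t w)" using L by (simp add: levy_process_def)
  then have lims: "AE w in M. (\<lambda>n. L (u n) w) \<longlonglongrightarrow> Z w \<and> Lim (at_left t) (\<lambda>s. L s w) = Z w"
  proof eventually_elim
    case (elim w)
    then obtain l where l: "((\<lambda>s. L s w) \<longlongrightarrow> l) (at_left t)" using t by (auto simp: cadlag_on_nonneg_def)
    have "(\<lambda>n. L (u n) w) \<longlonglongrightarrow> l"
      using l[unfolded tendsto_at_iff_sequentially, rule_format, of u] u u_lim by (simp add: comp_def less_imp_neq)
    moreover have "Lim (at_left t) (\<lambda>s. L s w) = l" by (rule tendsto_Lim[OF _ l]) simp
    ultimately show ?case by (auto simp: Z_def limI)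
  qed
  have "(\<lambda>n. trunc_mean (\<lambda>w. L (u n) w - Z w)) \<longlonglongrightarrow> expectation (\<lambda>w. 0)"
    unfolding trunc_mean_def
  proof (rule integral_dominated_convergence[where w="\<lambda>_. 1"])
    show "AE w in M. (\<lambda>n. min 1 \<bar>L (u n) w - Z w\<bar>) \<longlonglongrightarrow> 0"
      using lims
    proof eventually_elim
      case (elim w)
      then have "(\<lambda>n. min 1 \<bar>L (u n) w - Z w\<bar>) \<longlonglongrightarrow> min 1 \<bar>Z w - Z w\<bar>"
        by (intro tendsto_intros) auto
      then show ?case by simp
    qed
  qed auto
  then have 1: "(\<lambda>n. trunc_mean (\<lambda>w. L (u n) w - Z w)) \<longlonglongrightarrow> 0" by simp
  have "tendsto_in_prob L (L t) (at t within {0..})" using L t by (simp add: levy_process_def)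
  moreover have "filterlim u (at t within {0..}) sequentially"
    using u u_lim by (auto simp: filterlim_at less_imp_le less_imp_neq)
  ultimately have "tendsto_in_prob (\<lambda>n. L (u n)) (L t) sequentially"
    unfolding tendsto_in_prob_def using filterlim_compose by fast
  then have 2: "(\<lambda>n. trunc_mean (\<lambda>w. L (u n) w - L t w)) \<longlonglongrightarrow> 0"
    by (simp add: tendsto_in_prob_iff_trunc_mean)
  have "trunc_mean (\<lambda>w. Z w - L t w) \<le> trunc_mean (\<lambda>w. L (u n) w - Z w) + trunc_mean (\<lambda>w. L (u n) w - L t w)" for n
  proof -
    have "trunc_mean (\<lambda>w. Z w - L t w) = trunc_mean (\<lambda>w. - (L (u n) w - Z w) + (L (u n) w - L t w))" by simp
    also have "\<dots> \<le> trunc_mean (\<lambda>w. - (L (u n) w - Z w)) + trunc_mean (\<lambda>w. L (u n) w - L t w)"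
      by (rule trunc_mean_add_le) auto
    finally show ?thesis using trunc_mean_uminus[of "\<lambda>w. L (u n) w - Z w"] by simp
  qed
  then have "trunc_mean (\<lambda>w. Z w - L t w) \<le> 0 + 0"
    by (intro LIMSEQ_le_const[OF tendsto_add[OF 1 2]]) auto
  then have "trunc_mean (\<lambda>w. Z w - L t w) = 0" using trunc_mean_nonneg by (simp add: antisym)
  then have "AE w in M. Z w - L t w = 0" by (simp add: trunc_mean_eq_0_iff)
  with lims show ?thesis by eventually_elim simp
qed

end

section \<open>The \<open>L\<^sup>2\<close> integral\<close>

text \<open>Both norms matter: the second moment of the integral contains the integral of the square
  of \<open>f\<close>, from the variance, and the squared integral of \<open>f\<close>, from the
  drift.\<close>

definition L12 :: "(real \<Rightarrow> real) \<Rightarrow> bool" where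
  "L12 f \<longleftrightarrow> integrable lborel f \<and> sq_integrable lborel f"

lemma L12D [dest]: "L12 f \<Longrightarrow> integrable lborel f" "L12 f \<Longrightarrow> sq_integrable lborel f"
  by (simp_all add: L12_def)

lemma L12_measurable [measurable_dest]: "L12 f \<Longrightarrow> f \<in> borel_measurable borel"
  by (auto simp: L12_def)

lemma L12_add: "L12 f \<Longrightarrow> L12 g \<Longrightarrow> L12 (\<lambda>x. f x + g x)"
  by (auto simp: L12_def intro: sq_integrable_add)

lemma L12_diff: "L12 f \<Longrightarrow> L12 g \<Longrightarrow> L12 (\<lambda>x. f x - g x)"
  by (auto simp: L12_def intro: sq_integrable_diff)

lemma L12_cmult: "L12 f \<Longrightarrow> L12 (\<lambda>x. c * f x)"
  by (auto simp: L12_def intro: sq_integrable_cmult)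

lemma L12_bound:
  assumes "L12 g" and [measurable]: "f \<in> borel_measurable borel" and le: "\<And>x. \<bar>f x\<bar> \<le> \<bar>g x\<bar>"
  shows "L12 f"
proof -
  have "integrable lborel f"
    by (rule Bochner_Integration.integrable_bound[of _ g]) (use assms in auto)
  moreover have "integrable lborel (\<lambda>x. (f x)\<^sup>2)"
    by (rule Bochner_Integration.integrable_bound[OF sq_integrable_square[OF L12D(2)[OF assms(1)]]])
      (use le in \<open>auto simp: abs_le_square_iff\<close>)
  ultimately show ?thesis by (simp add: L12_def sq_integrable_def)
qed

lemma L12_mult_indicator:
  assumes "L12 f" and [measurable]: "A \<in> sets borel"
  shows "L12 (\<lambda>x. f x * indicator A x)"
proof (rule L12_bound[OF assms(1)])
  have [measurable]: "f \<in> borel_measurable borel" using assms(1) by measurable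
  show "(\<lambda>x. f x * indicator A x) \<in> borel_measurable borel" by measurable
qed (simp add: indicator_def)

lemma bounded_borel_emeasure: "A \<in> bounded_borel \<Longrightarrow> emeasure lborel A < \<infinity>"
  using emeasure_bounded_finite[of A] by (simp only: bounded_borel_def mem_Collect_eq)

lemma L12_indicator:
  assumes "A \<in> bounded_borel"
  shows "L12 (indicator A)"
proof -
  have "integrable lborel (indicat_real A)"
    using assms bounded_borel_emeasure[OF assms]
    by (intro integrable_real_indicator) (auto simp: bounded_borel_def)
  moreover have "(\<lambda>x. (indicat_real A x)\<^sup>2) = indicat_real A" by (auto simp: indicator_def)
  ultimately show ?thesis by (auto simp: L12_def sq_integrable_def)
qed

lemma bounded_borel_Ioc: "{a<..b::real} \<in> bounded_borel"
  by (simp add: bounded_borel_def)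

lemma integral_sq_diff_le:
  assumes "L12 f" "L12 g" "L12 F"
  shows "(LBINT x. (f x - g x)\<^sup>2) \<le> 2 * (LBINT x. (f x - F x)\<^sup>2) + 2 * (LBINT x. (g x - F x)\<^sup>2)"
  using integral_square_add_le[of lborel "\<lambda>x. f x - F x" "\<lambda>x. F x - g x"] assms
  by (auto simp: power2_commute[of "F _" "g _"] intro!: sq_integrable_diff)

lemma integral_diff_abs_le:
  assumes "L12 f" "L12 F"
  shows "\<bar>(LBINT x. f x) - (LBINT x. F x)\<bar> \<le> (LBINT x. \<bar>f x - F x\<bar>)"
proof -
  have eq: "(LBINT x. f x) - (LBINT x. F x) = (LBINT x. f x - F x)"
    using assms by (simp add: L12_def)
  show ?thesis
    unfolding eq by (rule abs_integral_le) (use assms in \<open>auto simp: L12_def\<close>)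
qed

text \<open>Cutting off at \<open>n\<close> supplies the bounded support; the bound by
  \<open>2 * |f x|\<close> is kept for dominated convergence.\<close>

lemma step_function_approx:
  fixes f :: "real \<Rightarrow> real"
  assumes [measurable]: "f \<in> borel_measurable borel"
  obtains g where "\<And>n::nat. step_function (g n)" "\<And>x. (\<lambda>n. g n x) \<longlonglongrightarrow> f x"
    "\<And>n x. \<bar>g n x\<bar> \<le> 2 * \<bar>f x\<bar>"
proof -
  obtain F where F: "\<And>i. simple_function borel (F i)" "\<And>x. (\<lambda>i. F i x) \<longlonglongrightarrow> f x"
    "\<And>i x. dist (F i x) 0 \<le> 2 * dist (f x) 0"
    using borel_measurable_implies_sequence_metric[OF assms, of 0] by auto
  define g where "g n x = F n x * indicator {- real n..real n} x" for n x
  show thesis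
  proof
    show "step_function (g n)" for n
      unfolding step_function_def
    proof
      show "simple_function borel (g n)" unfolding g_def using F(1)[of n] by (intro simple_function_mult simple_function_indicator) auto
      show "bounded {x. g n x \<noteq> 0}"
        by (rule bounded_subset[of "{- real n..real n}"]) (auto simp: g_def indicator_def)
    qed
    show "(\<lambda>n. g n x) \<longlonglongrightarrow> f x" for x
    proof (rule Lim_transform_eventually[OF F(2)])
      show "\<forall>\<^sub>F n in sequentially. F n x = g n x"
        using eventually_ge_at_top[of "nat \<lceil>\<bar>x\<bar>\<rceil>"]
        by eventually_elim (auto simp: g_def indicator_def nat_le_iff ceiling_le_iff)
    qed
    show "\<bar>g n x\<bar> \<le> 2 * \<bar>f x\<bar>" for n x
      using F(3)[of n x] by (auto simp: g_def indicator_def)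
  qed
qed

lemma step_function_representation:
  assumes "step_function g"
  shows "finite (range g - {0})" "\<And>y. y \<noteq> 0 \<Longrightarrow> g -` {y} \<in> bounded_borel"
    "\<And>x. g x = (\<Sum>y\<in>range g - {0}. y * indicator (g -` {y}) x)"
proof -
  have sf: "simple_function borel g" and b: "bounded {x. g x \<noteq> 0}"
    using assms by (auto simp: step_function_def)
  show fin: "finite (range g - {0})" using simple_functionD(1)[OF sf] by simp
  show "g -` {y} \<in> bounded_borel" if "y \<noteq> 0" for y
    using simple_functionD(2)[OF sf, of "{y}"] that
    by (auto simp: bounded_borel_def intro: bounded_subset[OF b])
  show "g x = (\<Sum>y\<in>range g - {0}. y * indicator (g -` {y}) x)" for x
  proof -
    have "(\<Sum>y\<in>range g - {0}. y * indicator (g -` {y}) x) = (\<Sum>y\<in>range g - {0}. if y = g x then y else 0)"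
      by (intro sum.cong) (auto simp: indicator_def)
    then show ?thesis using fin by (simp add: sum.delta)
  qed
qed

lemma bounded_borel_Int: "A \<in> sets borel \<Longrightarrow> B \<in> bounded_borel \<Longrightarrow> A \<inter> B \<in> bounded_borel"
  by (auto simp: bounded_borel_def)

text \<open>One dominating \<open>w\<close> gives convergence in both norms under which the integral
  is continuous.\<close>

lemma dominated_L12:
  fixes f :: "nat \<Rightarrow> real \<Rightarrow> real"
  assumes "L12 w" and [measurable]: "\<And>n. f n \<in> borel_measurable borel" "F \<in> borel_measurable borel"
    and lim: "AE x in lborel. (\<lambda>n. f n x) \<longlonglongrightarrow> F x" and dom: "\<And>n x. \<bar>f n x - F x\<bar> \<le> \<bar>w x\<bar>"
  shows "(\<lambda>n. LBINT x. \<bar>f n x - F x\<bar>) \<longlonglongrightarrow> 0" "(\<lambda>n. LBINT x. (f n x - F x)\<^sup>2) \<longlonglongrightarrow> 0"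
proof -
  have [measurable]: "w \<in> borel_measurable borel" using assms(1) by measurable
  have lim0: "AE x in lborel. (\<lambda>n. f n x - F x) \<longlonglongrightarrow> 0"
    using lim by eventually_elim (simp add: LIM_zero)
  have "(\<lambda>n. LBINT x. \<bar>f n x - F x\<bar>) \<longlonglongrightarrow> (\<integral>x. 0 \<partial>(lborel :: real measure))"
  proof (rule integral_dominated_convergence[where w="\<lambda>x. \<bar>w x\<bar>"])
    show "AE x in lborel. (\<lambda>n. \<bar>f n x - F x\<bar>) \<longlonglongrightarrow> 0"
      using lim0 by eventually_elim (rule tendsto_rabs_zero)
  qed (use assms(1) dom in auto)
  then show "(\<lambda>n. LBINT x. \<bar>f n x - F x\<bar>) \<longlonglongrightarrow> 0" by simp
  have "(\<lambda>n. LBINT x. (f n x - F x)\<^sup>2) \<longlonglongrightarrow> (\<integral>x. 0 \<partial>(lborel :: real measure))"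
  proof (rule integral_dominated_convergence[where w="\<lambda>x. (w x)\<^sup>2"])
    show "AE x in lborel. (\<lambda>n. (f n x - F x)\<^sup>2) \<longlonglongrightarrow> 0"
      using lim0 by eventually_elim (use tendsto_power[of _ 0 sequentially 2] in force)
    show "integrable lborel (\<lambda>x. (w x)\<^sup>2)" using assms(1) by (auto simp: L12_def sq_integrable_def)
  qed (use dom in \<open>auto simp: abs_le_square_iff\<close>)
  then show "(\<lambda>n. LBINT x. (f n x - F x)\<^sup>2) \<longlonglongrightarrow> 0" by simp
qed

text \<open>The right-hand side is what polarising \<open>|t - s|\<close> over the four end points
  produces in \<open>incr_mult\<close>.\<close>

lemma measure_Int_Ioc:
  fixes a b c d :: real
  assumes "a \<le> b" "c \<le> d"
  shows "2 * measure lborel ({a<..b} \<inter> {c<..d}) = \<bar>b - c\<bar> + \<bar>a - d\<bar> - \<bar>b - d\<bar> - \<bar>a - c\<bar>"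
proof -
  have "{a<..b} \<inter> {c<..d} = {max a c<..min b d}" by auto
  then show ?thesis using assms by (simp add: measure_def max_def min_def abs_if)
qed

text \<open>What the integral takes from the process: moments for times in either order, and
  independence along grids through 0, the point where the two one-sided copies meet.\<close>

locale L2_increments = prob_space M for M :: "'a measure" +
  fixes L :: "real \<Rightarrow> 'a \<Rightarrow> real" and \<mu> V :: real
  assumes L_measurable [measurable]: "\<And>t. L t \<in> borel_measurable M"
    and incr_sq: "\<And>s t. sq_integrable M (\<lambda>w. L t w - L s w)"
    and incr_mean: "\<And>s t. expectation (\<lambda>w. L t w - L s w) = \<mu> * (t - s)"
    and incr_square: "\<And>s t. expectation (\<lambda>w. (L t w - L s w)\<^sup>2) = V * \<bar>t - s\<bar> + \<mu>\<^sup>2 * (t - s)\<^sup>2"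
    and incr_indep: "\<And>t n. mono t \<Longrightarrow> 0 \<in> t ` {..n::nat} \<Longrightarrow>
      indep_vars (\<lambda>_. borel) (\<lambda>i w. L (t (Suc i)) w - L (t i) w) {..<n}"
begin

text \<open>A relation instead of a function, so that no value has to be shown independent of a
  representation. It is the linear and topological closure of the increments; rule induction gives
  the moment formulas, uniqueness follows from them, and existence is a separate result.\<close>

inductive stoch_int :: "(real \<Rightarrow> real) \<Rightarrow> ('a \<Rightarrow> real) \<Rightarrow> bool" where
  base: "a \<le> b \<Longrightarrow> stoch_int (indicator {a<..b}) (\<lambda>w. L b w - L a w)"
| add: "stoch_int f Y \<Longrightarrow> stoch_int g Z \<Longrightarrow> stoch_int (\<lambda>x. f x + g x) (\<lambda>w. Y w + Z w)"
| cmult: "stoch_int f Y \<Longrightarrow> stoch_int (\<lambda>x. c * f x) (\<lambda>w. c * Y w)"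
| lim: "(\<And>n::nat. stoch_int (f n) (Y n)) \<Longrightarrow> L12 F \<Longrightarrow> sq_integrable M Z \<Longrightarrow>
    (\<lambda>n. LBINT x. \<bar>f n x - F x\<bar>) \<longlonglongrightarrow> 0 \<Longrightarrow> (\<lambda>n. LBINT x. (f n x - F x)\<^sup>2) \<longlonglongrightarrow> 0 \<Longrightarrow>
    (\<lambda>n. expectation (\<lambda>w. (Y n w - Z w)\<^sup>2)) \<longlonglongrightarrow> 0 \<Longrightarrow> stoch_int F Z"

lemma stoch_int_L12: "stoch_int f Y \<Longrightarrow> L12 f"
  by (induction rule: stoch_int.induct)
    (auto intro: L12_indicator bounded_borel_Ioc L12_add L12_cmult)

lemma stoch_int_sq: "stoch_int f Y \<Longrightarrow> sq_integrable M Y"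
  by (induction rule: stoch_int.induct)
    (auto intro: incr_sq sq_integrable_add sq_integrable_cmult)

lemma stoch_int_measurable [measurable_dest]: "stoch_int f Y \<Longrightarrow> Y \<in> borel_measurable M"
  by (simp add: stoch_int_sq sq_integrable_measurable)

lemma integral_tendsto_L1:
  assumes "\<And>n. L12 (f n)" "L12 F" "(\<lambda>n. LBINT x. \<bar>f n x - F x\<bar>) \<longlonglongrightarrow> 0"
  shows "(\<lambda>n. LBINT x. f n x) \<longlonglongrightarrow> (LBINT x. F x)"
  by (rule LIM_zero_cancel, rule Lim_null_comparison[OF _ assms(3)])
    (use integral_diff_abs_le[OF assms(1,2)] in auto)

section \<open>First and second moments of the integral\<close>

lemma stoch_int_mean: "stoch_int f Y \<Longrightarrow> expectation Y = \<mu> * (LBINT x. f x)"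
proof (induction rule: stoch_int.induct)
  case (base a b)
  then show ?case by (simp add: incr_mean measure_def)
next
  case (add f Y g Z)
  then show ?case
    using stoch_int_L12 stoch_int_sq by (simp add: L12_def sq_integrable_integrable distrib_left)
next
  case (cmult f Y c)
  then show ?case by simp
next
  case (lim f Y F Z)
  have "(\<lambda>n. expectation (\<lambda>w. Y n w * 1)) \<longlonglongrightarrow> expectation (\<lambda>w. Z w * 1)"
    by (rule tendsto_integral_mult_L2) (use lim in \<open>auto intro: stoch_int_sq sq_integrable_const\<close>)
  moreover have "(\<lambda>n. expectation (Y n)) \<longlonglongrightarrow> \<mu> * (LBINT x. F x)"
    unfolding lim.IH by (intro tendsto_intros integral_tendsto_L1) (use lim stoch_int_L12 in auto)
  ultimately show ?case using LIMSEQ_unique by simp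
qed

lemma incr_mult:
  assumes "a \<le> b" "c \<le> d"
  shows "expectation (\<lambda>w. (L b w - L a w) * (L d w - L c w))
    = V * measure lborel ({a<..b} \<inter> {c<..d}) + \<mu>\<^sup>2 * ((b - a) * (d - c))"
proof -
  have int: "integrable M (\<lambda>w. (L t w - L s w)\<^sup>2)" for s t
    using incr_sq by (rule sq_integrable_square)
  \<comment> \<open>Polarisation handles overlapping intervals without cutting them into independent
    pieces.\<close>
  have eq: "(\<lambda>w. (L b w - L a w) * (L d w - L c w)) =
      (\<lambda>w. ((L b w - L c w)\<^sup>2 + (L a w - L d w)\<^sup>2 - (L b w - L d w)\<^sup>2 - (L a w - L c w)\<^sup>2) / 2)"
    by (auto simp: power2_eq_square field_simps)
  have "expectation (\<lambda>w. (L b w - L a w) * (L d w - L c w))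
      = (V * \<bar>b - c\<bar> + \<mu>\<^sup>2 * (b - c)\<^sup>2 + (V * \<bar>a - d\<bar> + \<mu>\<^sup>2 * (a - d)\<^sup>2)
         - (V * \<bar>b - d\<bar> + \<mu>\<^sup>2 * (b - d)\<^sup>2) - (V * \<bar>a - c\<bar> + \<mu>\<^sup>2 * (a - c)\<^sup>2)) / 2"
    unfolding eq by (simp add: int incr_square)
  also have "\<dots> = (V * (\<bar>b - c\<bar> + \<bar>a - d\<bar> - \<bar>b - d\<bar> - \<bar>a - c\<bar>)) / 2 + \<mu>\<^sup>2 * ((b - a) * (d - c))"
    by (simp add: power2_eq_square field_simps)
  also have "\<dots> = V * measure lborel ({a<..b} \<inter> {c<..d}) + \<mu>\<^sup>2 * ((b - a) * (d - c))"
    unfolding measure_Int_Ioc[OF assms, symmetric] by simp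
  finally show ?thesis .
qed

text \<open>The formula is bilinear and continuous in each argument, so it extends from intervals
  one argument at a time: \<open>stoch_int_mult\<close> applies this once with an increment as
  \<open>Z\<close> and once with a general \<open>Z\<close>.\<close>

lemma stoch_int_mult_of_base:
  assumes h: "stoch_int h Z" and f: "stoch_int f Y"
    and base: "\<And>a b. a \<le> b \<Longrightarrow> expectation (\<lambda>w. (L b w - L a w) * Z w)
      = V * (LBINT x. indicator {a<..b} x * h x) + \<mu>\<^sup>2 * ((LBINT x. indicator {a<..b} x) * (LBINT x. h x))"
  shows "expectation (\<lambda>w. Y w * Z w)
    = V * (LBINT x. f x * h x) + \<mu>\<^sup>2 * ((LBINT x. f x) * (LBINT x. h x))"
  using f
proof (induction rule: stoch_int.induct)
  case (base a b)
  then show ?case by (rule assms(3))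
next
  case (add f Y g Z')
  have "L12 f" "L12 g" "sq_integrable M Y" "sq_integrable M Z'" "L12 h" "sq_integrable M Z"
    using add h stoch_int_L12 stoch_int_sq by auto
  then have "integrable lborel (\<lambda>x. f x * h x)" "integrable lborel (\<lambda>x. g x * h x)"
    "integrable M (\<lambda>w. Y w * Z w)" "integrable M (\<lambda>w. Z' w * Z w)"
    "integrable lborel f" "integrable lborel g"
    by (auto intro!: sq_integrable_mult)
  then show ?case using add by (simp add: distrib_right distrib_left)
next
  case (cmult f Y e)
  have eq1: "(\<lambda>w. e * Y w * Z w) = (\<lambda>w. e * (Y w * Z w))"
    and eq2: "(\<lambda>x. e * f x * h x) = (\<lambda>x. e * (f x * h x))" by auto
  show ?case unfolding eq1 eq2 integral_mult_right_zero cmult.IH by (simp add: algebra_simps)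
next
  case (lim f Y F Z')
  have "(\<lambda>n. expectation (\<lambda>w. Y n w * Z w)) \<longlonglongrightarrow> expectation (\<lambda>w. Z' w * Z w)"
    by (rule tendsto_integral_mult_L2) (use h lim.hyps stoch_int_sq in auto)
  moreover have "(\<lambda>n. LBINT x. f n x * h x) \<longlonglongrightarrow> (LBINT x. F x * h x)"
    by (rule tendsto_integral_mult_L2) (use h lim.hyps stoch_int_L12 in auto)
  then have "(\<lambda>n. expectation (\<lambda>w. Y n w * Z w)) \<longlonglongrightarrow>
      V * (LBINT x. F x * h x) + \<mu>\<^sup>2 * ((LBINT x. F x) * (LBINT x. h x))"
    unfolding lim.IH
    by (intro tendsto_intros integral_tendsto_L1[OF stoch_int_L12[OF lim.hyps(1)] lim.hyps(2) lim.hyps(4)])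
  ultimately show ?case by (rule LIMSEQ_unique)
qed

lemma stoch_int_mult:
  assumes "stoch_int f Y" "stoch_int g Z"
  shows "expectation (\<lambda>w. Y w * Z w)
    = V * (LBINT x. f x * g x) + \<mu>\<^sup>2 * ((LBINT x. f x) * (LBINT x. g x))"
proof (rule stoch_int_mult_of_base[OF assms(2,1)])
  fix a b :: real assume ab: "a \<le> b"
  have "expectation (\<lambda>w. Z w * (L b w - L a w))
      = V * (LBINT x. g x * indicator {a<..b} x) + \<mu>\<^sup>2 * ((LBINT x. g x) * (LBINT x. indicator {a<..b} x))"
  proof (rule stoch_int_mult_of_base[OF stoch_int.base[OF ab] assms(2)])
    fix c d :: real assume "c \<le> d"
    then show "expectation (\<lambda>w. (L d w - L c w) * (L b w - L a w)) = V * (LBINT x. indicator {c<..d} x * indicator {a<..b} x)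
        + \<mu>\<^sup>2 * ((LBINT x. indicator {c<..d} x) * (LBINT x. indicator {a<..b} x))"
      using incr_mult[OF _ ab, of c d] ab by (simp add: indicator_inter_arith[symmetric] measure_def)
  qed
  then show "expectation (\<lambda>w. (L b w - L a w) * Z w) = V * (LBINT x. indicator {a<..b} x * g x)
      + \<mu>\<^sup>2 * ((LBINT x. indicator {a<..b} x) * (LBINT x. g x))"
    by (simp only: mult.commute)
qed

lemma stoch_int_square:
  assumes "stoch_int f Y"
  shows "expectation (\<lambda>w. (Y w)\<^sup>2) = V * (LBINT x. (f x)\<^sup>2) + \<mu>\<^sup>2 * (LBINT x. f x)\<^sup>2"
  using stoch_int_mult[OF assms assms] by (simp add: power2_eq_square)

lemma V_nonneg: "0 \<le> V"
proof -
  have "0 \<le> expectation (\<lambda>w. (L 1 w - L 0 w - expectation (\<lambda>w. L 1 w - L 0 w))\<^sup>2)" by simp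
  also have "\<dots> = V"
    using incr_sq[of 1 0] incr_mean[of 1 0] incr_square[of 1 0]
    by (subst variance_eq) (auto simp: sq_integrable_def intro: sq_integrable_integrable[unfolded sq_integrable_def])
  finally show ?thesis .
qed

section \<open>Linearity, uniqueness and limits of the integral\<close>

lemma stoch_int_diff:
  assumes "stoch_int f Y" "stoch_int g Z"
  shows "stoch_int (\<lambda>x. f x - g x) (\<lambda>w. Y w - Z w)"
  using stoch_int.add[OF assms(1) stoch_int.cmult[OF assms(2), of "-1"]] by simp

lemma stoch_int_zero: "stoch_int (\<lambda>_. 0) (\<lambda>_. 0)"
  using stoch_int.cmult[OF stoch_int.base[of 0 0], of 0] by simp

lemma stoch_int_sum:
  "(\<And>i. i \<in> I \<Longrightarrow> stoch_int (f i) (Y i)) \<Longrightarrow> stoch_int (\<lambda>x. \<Sum>i\<in>I. f i x) (\<lambda>w. \<Sum>i\<in>I. Y i w)"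
  by (induction I rule: infinite_finite_induct) (auto intro: stoch_int_zero stoch_int.add)

text \<open>The rule \<open>lim\<close> with constant sequences: all three distances are 0.\<close>

lemma stoch_int_cong_AE:
  assumes fY: "stoch_int f Y" and [measurable]: "g \<in> borel_measurable borel" "Z \<in> borel_measurable M"
    and eq: "AE x in lborel. f x = g x" "AE w in M. Y w = Z w"
  shows "stoch_int g Z"
proof (rule stoch_int.lim[of "\<lambda>_. f" "\<lambda>_. Y"])
  note [measurable] = stoch_int_measurable[OF fY] L12_measurable[OF stoch_int_L12[OF fY]]
  have "integrable lborel f \<longleftrightarrow> integrable lborel g" "integrable lborel (\<lambda>x. (f x)\<^sup>2) \<longleftrightarrow> integrable lborel (\<lambda>x. (g x)\<^sup>2)"
    by (intro integrable_cong_AE; use eq(1) in auto)+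
  then show "L12 g" using stoch_int_L12[OF fY] by (simp add: L12_def sq_integrable_def)
  have "integrable M (\<lambda>w. (Y w)\<^sup>2) \<longleftrightarrow> integrable M (\<lambda>w. (Z w)\<^sup>2)"
    by (intro integrable_cong_AE; use eq(2) in auto)
  then show "sq_integrable M Z" using stoch_int_sq[OF fY] by (simp add: sq_integrable_def)
  have "(LBINT x. \<bar>f x - g x\<bar>) = 0" "(LBINT x. (f x - g x)\<^sup>2) = 0"
    by (intro integral_eq_zero_AE; use eq(1) in auto)+
  then show "(\<lambda>n::nat. LBINT x. \<bar>f x - g x\<bar>) \<longlonglongrightarrow> 0" "(\<lambda>n::nat. LBINT x. (f x - g x)\<^sup>2) \<longlonglongrightarrow> 0"
    by simp_all
  have "expectation (\<lambda>w. (Y w - Z w)\<^sup>2) = 0"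
    by (intro integral_eq_zero_AE; use eq(2) in auto)
  then show "(\<lambda>n::nat. expectation (\<lambda>w. (Y w - Z w)\<^sup>2)) \<longlonglongrightarrow> 0" by simp
qed (rule fY)

text \<open>The difference is an integral of the zero function, so its second moment
  vanishes.\<close>

lemma stoch_int_unique:
  assumes "stoch_int f Y" "stoch_int f Z"
  shows "AE w in M. Y w = Z w"
proof -
  have "expectation (\<lambda>w. (Y w - Z w)\<^sup>2) = 0"
    using stoch_int_square[OF stoch_int_diff[OF assms]] by simp
  then have "AE w in M. (Y w - Z w)\<^sup>2 = 0"
    using sq_integrable_square[OF stoch_int_sq[OF stoch_int_diff[OF assms]]]
    by (subst (asm) integral_nonneg_eq_0_iff_AE) auto
  then show ?thesis by eventually_elim simp
qed

lemma stoch_int_diff_square_tendsto_0: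
  assumes "\<And>n. stoch_int (f n) (Y n)" "stoch_int F Z"
    and l1: "(\<lambda>n. LBINT x. \<bar>f n x - F x\<bar>) \<longlonglongrightarrow> 0" and l2: "(\<lambda>n. LBINT x. (f n x - F x)\<^sup>2) \<longlonglongrightarrow> 0"
  shows "(\<lambda>n. expectation (\<lambda>w. (Y n w - Z w)\<^sup>2)) \<longlonglongrightarrow> 0"
proof -
  have L: "L12 (f n)" "L12 F" for n using assms(1,2) stoch_int_L12 by auto
  have "(\<lambda>n. (LBINT x. f n x) - (LBINT x. F x)) \<longlonglongrightarrow> 0"
    using integral_tendsto_L1[OF L l1] by (rule LIM_zero)
  then have "(\<lambda>n. LBINT x. f n x - F x) \<longlonglongrightarrow> 0" using L by (simp add: L12_def)
  from tendsto_power[OF this, of 2]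
  have "(\<lambda>n. V * (LBINT x. (f n x - F x)\<^sup>2) + \<mu>\<^sup>2 * (LBINT x. f n x - F x)\<^sup>2) \<longlonglongrightarrow> V * 0 + \<mu>\<^sup>2 * 0"
    by (intro tendsto_intros l2) simp
  then show ?thesis
    using stoch_int_square[OF stoch_int_diff[OF assms(1,2)]] by simp
qed

text \<open>The second moment formula turns convergence of the integrands in both norms into a
  Cauchy sequence of square integrable variables, and completeness supplies the integral.\<close>

lemma stoch_int_limit_exists:
  assumes fn: "\<And>n::nat. stoch_int (f n) (Y n)" and F: "L12 F"
    and l1: "(\<lambda>n. LBINT x. \<bar>f n x - F x\<bar>) \<longlonglongrightarrow> 0" and l2: "(\<lambda>n. LBINT x. (f n x - F x)\<^sup>2) \<longlonglongrightarrow> 0"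
  obtains Z where "stoch_int F Z" "(\<lambda>n. expectation (\<lambda>w. (Y n w - Z w)\<^sup>2)) \<longlonglongrightarrow> 0"
proof -
  define D where "D n = (LBINT x. \<bar>f n x - F x\<bar>)" for n
  define E where "E n = (LBINT x. (f n x - F x)\<^sup>2)" for n
  have L: "L12 (f n)" for n using fn stoch_int_L12 by blast
  have nn: "0 \<le> D n" "0 \<le> E n" for n by (auto simp: D_def E_def)
  have le: "expectation (\<lambda>w. (Y m w - Y n w)\<^sup>2) \<le> V * (2 * E m + 2 * E n) + \<mu>\<^sup>2 * (D m + D n)\<^sup>2" for m n
  proof -
    have "\<bar>(LBINT x. f m x) - (LBINT x. f n x)\<bar> \<le> D m + D n"
      using integral_diff_abs_le[OF L F, of m] integral_diff_abs_le[OF L F, of n] unfolding D_def by linarith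
    then have "\<bar>LBINT x. f m x - f n x\<bar> \<le> \<bar>D m + D n\<bar>" using L nn[of m] nn[of n] by (simp add: L12_def)
    then have "(LBINT x. f m x - f n x)\<^sup>2 \<le> (D m + D n)\<^sup>2" by (simp add: abs_le_square_iff)
    then show ?thesis
      using stoch_int_square[OF stoch_int_diff[OF fn fn], of m n] integral_sq_diff_le[OF L L F, of m n] V_nonneg
      unfolding E_def by (auto intro!: add_mono mult_left_mono)
  qed
  have lim0: "(\<lambda>n. V * (4 * E n) + \<mu>\<^sup>2 * (2 * D n)\<^sup>2) \<longlonglongrightarrow> 0"
  proof -
    have "(\<lambda>n. V * (4 * E n) + \<mu>\<^sup>2 * (2 * D n)\<^sup>2) \<longlonglongrightarrow> V * (4 * 0) + \<mu>\<^sup>2 * (2 * 0)\<^sup>2"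
      using l1 l2 unfolding D_def[symmetric] E_def[symmetric] by (intro tendsto_intros)
    then show ?thesis by simp
  qed
  have Cauchy: "\<exists>N. \<forall>m\<ge>N. \<forall>n\<ge>N. expectation (\<lambda>w. (Y m w - Y n w)\<^sup>2) < e" if "e > 0" for e
  proof -
    obtain N where N: "\<And>n. n \<ge> N \<Longrightarrow> V * (4 * E n) + \<mu>\<^sup>2 * (2 * D n)\<^sup>2 < e"
      using order_tendstoD(2)[OF lim0 \<open>e > 0\<close>] by (auto simp: eventually_sequentially)
    have "expectation (\<lambda>w. (Y m w - Y n w)\<^sup>2) < e" if "m \<ge> N" "n \<ge> N" for m n
    proof -
      \<comment> \<open>Convexity of the square separates \<open>m\<close> from \<open>n\<close>, so
        that a single null sequence controls the Cauchy differences.\<close>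
      have "(D m + D n)\<^sup>2 \<le> ((2 * D m)\<^sup>2 + (2 * D n)\<^sup>2) / 2"
        using zero_le_power2[of "D m - D n"] by (simp add: power2_eq_square algebra_simps)
      then have "\<mu>\<^sup>2 * (D m + D n)\<^sup>2 \<le> \<mu>\<^sup>2 * (((2 * D m)\<^sup>2 + (2 * D n)\<^sup>2) / 2)"
        by (intro mult_left_mono) auto
      then have "2 * expectation (\<lambda>w. (Y m w - Y n w)\<^sup>2) \<le>
          (V * (4 * E m) + \<mu>\<^sup>2 * (2 * D m)\<^sup>2) + (V * (4 * E n) + \<mu>\<^sup>2 * (2 * D n)\<^sup>2)"
        using le[of m n] by (simp add: algebra_simps)
      then show ?thesis using N[OF that(1)] N[OF that(2)] by simp
    qed
    then show ?thesis by blast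
  qed
  obtain Z where Z: "sq_integrable M Z" "(\<lambda>n. expectation (\<lambda>w. (Y n w - Z w)\<^sup>2)) \<longlonglongrightarrow> 0"
    using L2_complete[of Y, OF stoch_int_sq[OF fn] Cauchy] by auto
  show thesis
    by (rule that[OF stoch_int.lim[of f Y, OF fn F Z(1) l1 l2 Z(2)] Z(2)])
qed

section \<open>Existence of the integral: from intervals to Borel sets, step functions and all of
  \<open>L12\<close>\<close>

lemma indicator_UN_L12_limit:
  assumes A: "\<And>n::nat. A n \<in> bounded_borel" "disjoint_family A" and U: "(\<Union>n. A n) \<in> bounded_borel"
  shows "(\<lambda>n. LBINT x. \<bar>(\<Sum>i<n. indicat_real (A i) x) - indicator (\<Union>n. A n) x\<bar>) \<longlonglongrightarrow> 0"
    "(\<lambda>n. LBINT x. ((\<Sum>i<n. indicat_real (A i) x) - indicator (\<Union>n. A n) x)\<^sup>2) \<longlonglongrightarrow> 0"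
proof -
  have [measurable]: "A n \<in> sets borel" for n using A(1) by (simp add: bounded_borel_def)
  have [measurable]: "(\<lambda>x. \<Sum>i<n. indicat_real (A i) x) \<in> borel_measurable borel" for n by measurable
  have [measurable]: "indicat_real (\<Union>n. A n) \<in> borel_measurable borel" by measurable
  have eq: "(\<Sum>i<n. indicator (A i) x) = indicat_real (\<Union>i<n. A i) x" for n x
    using A(2) by (subst indicator_UN_disjoint) (auto simp: disjoint_family_on_def)
  have lim: "(\<lambda>n. \<Sum>i<n. indicator (A i) x) \<longlonglongrightarrow> indicat_real (\<Union>n. A n) x" for x
  proof (cases "x \<in> (\<Union>n. A n)")
    case True
    then obtain m where m: "x \<in> A m" by auto
    have "\<forall>\<^sub>F n in sequentially. (\<Sum>i<n. indicator (A i) x) = indicat_real (\<Union>n. A n) x"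
      using eventually_gt_at_top[of m]
    proof eventually_elim
      case (elim n)
      then show ?case unfolding eq using m by (auto simp: indicator_def)
    qed
    then show ?thesis by (rule tendsto_eventually)
  qed (auto simp: eq indicator_def)
  have dom: "\<bar>(\<Sum>i<n. indicator (A i) x) - indicator (\<Union>n. A n) x\<bar> \<le> \<bar>indicat_real (\<Union>n. A n) x\<bar>" for n x
    unfolding eq by (auto simp: indicator_def)
  note d = dominated_L12[OF L12_indicator[OF U], of "\<lambda>n x. \<Sum>i<n. indicat_real (A i) x" "indicat_real (\<Union>n. A n)", OF _ _ _ dom]
  show "(\<lambda>n. LBINT x. \<bar>(\<Sum>i<n. indicat_real (A i) x) - indicator (\<Union>n. A n) x\<bar>) \<longlonglongrightarrow> 0"
    by (rule d(1)) (use lim in simp_all)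
  show "(\<lambda>n. LBINT x. ((\<Sum>i<n. indicat_real (A i) x) - indicator (\<Union>n. A n) x)\<^sup>2) \<longlonglongrightarrow> 0"
    by (rule d(2)) (use lim in simp_all)
qed

text \<open>Half-open intervals generate the Borel sets and are closed under intersection. Reversed
  end points give the empty set, which is \<open>{0<..0}\<close>, so the first case may assume
  \<open>a \<le> b\<close>.\<close>

lemma borel_sets_induct_Ioc [consumes 1, case_names Ioc compl union]:
  assumes "A \<in> sets (borel :: real measure)"
    and Ioc: "\<And>a b::real. a \<le> b \<Longrightarrow> P {a<..b}"
    and compl: "\<And>A. A \<in> sets borel \<Longrightarrow> P A \<Longrightarrow> P (- A)"
    and union: "\<And>A::nat \<Rightarrow> real set. disjoint_family A \<Longrightarrow> range A \<subseteq> sets borel \<Longrightarrow> (\<And>i. P (A i)) \<Longrightarrow> P (\<Union>i. A i)"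
  shows "P A"
proof -
  let ?G = "range (\<lambda>(a, b). {a<..b::real})"
  have sets: "sets (borel :: real measure) = sigma_sets UNIV ?G"
    by (subst borel_sigma_sets_Ioc) simp
  have "Int_stable ?G"
  proof (rule Int_stableI)
    fix A B assume "A \<in> ?G" "B \<in> ?G"
    then obtain a b c d where "A = {a<..b}" "B = {c<..d}" by auto
    then have "A \<inter> B = {max a c<..min b d}" by auto
    then show "A \<inter> B \<in> ?G" by auto
  qed
  moreover have "?G \<subseteq> Pow UNIV" by simp
  moreover have "A \<in> sigma_sets UNIV ?G" using assms(1) sets by simp
  ultimately show ?thesis
  proof (induction rule: sigma_sets_induct_disjoint)
    case (basic A)
    then obtain a b where "A = {a<..b}" by auto
    then show ?case using Ioc[of a b] Ioc[of 0 0] by (cases "a \<le> b") auto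
  next
    case empty
    then show ?case using Ioc[of 0 0] by simp
  next
    case (compl A)
    then show ?case using assms(3)[of A] sets by (simp add: Compl_eq_Diff_UNIV)
  next
    case (union A)
    then show ?case using assms(4)[of A] sets by simp
  qed
qed

lemma bounded_borel_subset_Ioc:
  assumes "A \<in> bounded_borel"
  obtains N where "0 \<le> N" "A \<subseteq> {-N<..N::real}"
proof -
  obtain N where "\<And>x. x \<in> A \<Longrightarrow> \<bar>x\<bar> \<le> N"
    using assms by (auto simp: bounded_borel_def bounded_iff)
  then have "A \<subseteq> {-(\<bar>N\<bar> + 1)<..\<bar>N\<bar> + 1}" by force
  then show thesis by (intro that[of "\<bar>N\<bar> + 1"]) auto
qed

text \<open>Complements of bounded sets are unbounded, so the Dynkin argument runs inside a fixed
  interval \<open>?J\<close> containing \<open>A\<close>.\<close>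

lemma stoch_int_indicator_exists:
  assumes A: "A \<in> bounded_borel"
  shows "\<exists>Y. stoch_int (indicator A) Y"
proof -
  obtain N where N: "0 \<le> N" "A \<subseteq> {-N<..N}" using bounded_borel_subset_Ioc[OF A] .
  let ?J = "{-N<..N}"
  have "A \<in> sets borel" using A by (simp add: bounded_borel_def)
  then have "\<exists>Y. stoch_int (indicator (A \<inter> ?J)) Y"
  proof (induction rule: borel_sets_induct_Ioc)
    case (Ioc a b)
    have "{a<..b} \<inter> ?J = (if max a (-N) \<le> min b N then {max a (-N)<..min b N} else {0<..0})" by auto
    then show ?case by (metis stoch_int.base order_refl)
  next
    case (compl A)
    then obtain Y where "stoch_int (indicator (A \<inter> ?J)) Y" by blast
    from stoch_int_diff[OF stoch_int.base[of "-N" N] this]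
    have "stoch_int (\<lambda>x. indicator ?J x - indicator (A \<inter> ?J) x) (\<lambda>w. L N w - L (-N) w - Y w)"
      using N by simp
    moreover have "(\<lambda>x. indicator ?J x - indicator (A \<inter> ?J) x :: real) = indicator (- A \<inter> ?J)"
      by (auto simp: indicator_def)
    ultimately show ?case by metis
  next
    case (union A)
    then obtain Y where Y: "\<And>i. stoch_int (indicator (A i \<inter> ?J)) (Y i)" by metis
    have b: "A i \<inter> ?J \<in> bounded_borel" for i
      using union by (intro bounded_borel_Int bounded_borel_Ioc) auto
    have U: "(\<Union>i. A i \<inter> ?J) = (\<Union>i. A i) \<inter> ?J" by auto
    have bU: "(\<Union>i. A i \<inter> ?J) \<in> bounded_borel"
      unfolding U using union by (intro bounded_borel_Int bounded_borel_Ioc) auto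
    have d: "disjoint_family (\<lambda>i. A i \<inter> ?J)" using union by (auto simp: disjoint_family_on_def)
    obtain Z where "stoch_int (indicator (\<Union>i. A i \<inter> ?J)) Z"
      by (rule stoch_int_limit_exists[OF stoch_int_sum[OF Y] L12_indicator[OF bU] indicator_UN_L12_limit[OF b d bU]])
    then show ?case unfolding U by blast
  qed
  then show ?thesis using N by (simp add: Int_absorb2)
qed

lemma stoch_int_step_exists:
  assumes "step_function g"
  shows "\<exists>Y. stoch_int g Y"
proof -
  note g = step_function_representation[OF assms]
  have "\<forall>y. \<exists>Y. y \<noteq> 0 \<longrightarrow> stoch_int (indicator (g -` {y})) Y"
    using stoch_int_indicator_exists[OF g(2)] by blast
  then obtain Y where Y: "\<And>y. y \<noteq> 0 \<Longrightarrow> stoch_int (indicator (g -` {y})) (Y y)" by metis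
  have "stoch_int (\<lambda>x. \<Sum>y\<in>range g - {0}. y * indicator (g -` {y}) x) (\<lambda>w. \<Sum>y\<in>range g - {0}. y * Y y w)"
    by (intro stoch_int_sum stoch_int.cmult Y) auto
  then show ?thesis unfolding g(3)[symmetric] by blast
qed

lemma stoch_int_exists:
  assumes f: "L12 f"
  shows "\<exists>Y. stoch_int f Y"
proof -
  have [measurable]: "f \<in> borel_measurable borel" using f by measurable
  obtain g where g: "\<And>n::nat. step_function (g n)" "\<And>x. (\<lambda>n. g n x) \<longlonglongrightarrow> f x" "\<And>n x. \<bar>g n x\<bar> \<le> 2 * \<bar>f x\<bar>"
    using step_function_approx[of f] by auto
  obtain Y where Y: "\<And>n. stoch_int (g n) (Y n)" using stoch_int_step_exists[OF g(1)] by metis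
  have [measurable]: "g n \<in> borel_measurable borel" for n using stoch_int_L12[OF Y[of n]] by measurable
  \<comment> \<open>The 3 is 2 + 1, from the bound on \<open>g n x\<close> and the triangle
    inequality.\<close>
  have dom: "\<bar>g n x - f x\<bar> \<le> \<bar>3 * f x\<bar>" for n x
    using g(3)[of n x] by (simp add: abs_mult)
  note d = dominated_L12[OF L12_cmult[OF f, of 3], of g f, OF _ _ _ dom]
  obtain Z where "stoch_int f Z"
    by (rule stoch_int_limit_exists[OF Y f d]) (use g in auto)
  then show ?thesis by blast
qed

section \<open>Independence over disjoint sets, by approximation on grids\<close>

text \<open>The cells of the grid \<open>T\<close> are the half-open intervals \<open>{t<..t'}\<close> between neighbouring points.\<close>

definition grid_step :: "real set \<Rightarrow> (real \<Rightarrow> real) \<Rightarrow> bool" where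
  "grid_step T s \<longleftrightarrow> finite T \<and> (\<forall>x y. x \<le> y \<longrightarrow> T \<inter> {x..<y} = {} \<longrightarrow> s x = s y) \<and>
    (\<forall>x. (\<forall>t\<in>T. x \<le> t) \<or> (\<forall>t\<in>T. t < x) \<longrightarrow> s x = 0)"

lemma grid_step_mono:
  assumes "grid_step T s" "T \<subseteq> T'" "finite T'"
  shows "grid_step T' s"
  unfolding grid_step_def
proof (intro conjI allI impI)
  fix x y assume "x \<le> y" "T' \<inter> {x..<y} = {}"
  then have "T \<inter> {x..<y} = {}" using assms(2) by auto
  then show "s x = s y" using assms(1) \<open>x \<le> y\<close> unfolding grid_step_def by blast
next
  fix x assume "(\<forall>t\<in>T'. x \<le> t) \<or> (\<forall>t\<in>T'. t < x)"
  then have "(\<forall>t\<in>T. x \<le> t) \<or> (\<forall>t\<in>T. t < x)" using assms(2) by auto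
  then show "s x = 0" using assms(1) unfolding grid_step_def by blast
qed (rule assms(3))

text \<open>Intervals are grid steps themselves, and the three closure rules preserve
  approximability in the L1 norm. This norm suffices because later only indicators are
  compared.\<close>

lemma stoch_int_grid_approx:
  "stoch_int f Y \<Longrightarrow> e > 0 \<Longrightarrow> \<exists>T s. grid_step T s \<and> integrable lborel s \<and> (LBINT x. \<bar>f x - s x\<bar>) < e"
proof (induction arbitrary: e rule: stoch_int.induct)
  case (base a b)
  have "grid_step {a, b} (indicator {a<..b})"
    unfolding grid_step_def
  proof (intro conjI allI impI)
    fix x y assume "x \<le> y" "{a, b} \<inter> {x..<y} = {}"
    then have "x \<le> a \<longleftrightarrow> y \<le> a" "x \<le> b \<longleftrightarrow> y \<le> b" by force+
    then show "indicator {a<..b} x = indicat_real {a<..b} y" by (auto simp: indicator_def)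
  qed auto
  then show ?case using base by (intro exI[of _ "{a, b}"] exI[of _ "indicator {a<..b}"]) auto
next
  case (add f Y g Z)
  from add.IH(1)[of "e/2"] add.prems obtain T s where s: "grid_step T s" "integrable lborel s" "(LBINT x. \<bar>f x - s x\<bar>) < e/2" by auto
  from add.IH(2)[of "e/2"] add.prems obtain T' s' where s': "grid_step T' s'" "integrable lborel s'" "(LBINT x. \<bar>g x - s' x\<bar>) < e/2" by auto
  have "integrable lborel f" "integrable lborel g" using add stoch_int_L12 by (auto simp: L12_def)
  note int = this s(2) s'(2)
  \<comment> \<open>The union of the two grids serves both summands.\<close>
  have fin: "finite (T \<union> T')" using s(1) s'(1) by (simp add: grid_step_def)
  have "grid_step (T \<union> T') s" "grid_step (T \<union> T') s'"
    using s(1) s'(1) fin by (auto elim: grid_step_mono)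
  then have "grid_step (T \<union> T') (\<lambda>x. s x + s' x)"
    unfolding grid_step_def by (metis add_0)
  moreover have "(LBINT x. \<bar>f x + g x - (s x + s' x)\<bar>) \<le> (LBINT x. \<bar>f x - s x\<bar> + \<bar>g x - s' x\<bar>)"
    using int by (intro integral_mono) auto
  then have "(LBINT x. \<bar>f x + g x - (s x + s' x)\<bar>) < e" using int s(3) s'(3) by simp
  ultimately show ?case using int by (intro exI[of _ "T \<union> T'"] exI[of _ "\<lambda>x. s x + s' x"]) auto
next
  case (cmult f Y c)
  \<comment> \<open>Adding 1 to \<open>|c|\<close> covers the case \<open>c = 0\<close>.\<close>
  have pos: "e / (\<bar>c\<bar> + 1) > 0" using cmult.prems by (simp add: field_simps)
  from cmult.IH[OF this] obtain T s where s: "grid_step T s" "integrable lborel s" "(LBINT x. \<bar>f x - s x\<bar>) < e / (\<bar>c\<bar> + 1)" by auto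
  have "grid_step T (\<lambda>x. c * s x)" using s(1) unfolding grid_step_def by (metis mult_zero_right)
  moreover have "(LBINT x. \<bar>c * f x - c * s x\<bar>) = \<bar>c\<bar> * (LBINT x. \<bar>f x - s x\<bar>)"
    by (simp add: abs_mult flip: right_diff_distrib)
  moreover have "\<bar>c\<bar> * (LBINT x. \<bar>f x - s x\<bar>) \<le> (\<bar>c\<bar> + 1) * (LBINT x. \<bar>f x - s x\<bar>)"
    by (intro mult_right_mono) auto
  moreover have "(\<bar>c\<bar> + 1) * (LBINT x. \<bar>f x - s x\<bar>) < e"
    using s(3) by (simp add: field_simps)
  ultimately show ?case using s(2) by (intro exI[of _ T] exI[of _ "\<lambda>x. c * s x"]) auto
next
  case (lim f Y F Z)
  have "\<forall>\<^sub>F n in sequentially. (LBINT x. \<bar>f n x - F x\<bar>) < e/2"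
    using lim by (intro order_tendstoD(2)[of _ 0]) auto
  then obtain n where n: "(LBINT x. \<bar>f n x - F x\<bar>) < e/2" by (auto simp: eventually_sequentially)
  from lim.IH[of "e/2" n] lim.prems obtain T s where s: "grid_step T s" "integrable lborel s" "(LBINT x. \<bar>f n x - s x\<bar>) < e/2" by auto
  have int: "integrable lborel (f n)" "integrable lborel F" "integrable lborel s"
    using lim s stoch_int_L12[OF lim.hyps(1)] by (auto simp: L12_def)
  have "(LBINT x. \<bar>F x - s x\<bar>) \<le> (LBINT x. \<bar>f n x - F x\<bar> + \<bar>f n x - s x\<bar>)"
    using int by (intro integral_mono) auto
  also have "\<dots> < e" using int n s(3) by simp
  finally show ?case using s by blast
qed

text \<open>The sets of values of a grid step function are unions of cells of one common grid, so disjoint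
  ones receive sums over disjoint sets of increments.\<close>

lemma grid_step_cells:
  assumes s: "grid_step T s" and I: "finite I" and disj: "disjoint_family_on P I" and P0: "\<And>i. i \<in> I \<Longrightarrow> 0 \<notin> P i"
  obtains X where "\<And>i. i \<in> I \<Longrightarrow> stoch_int (indicator (s -` P i)) (X i)" "indep_vars (\<lambda>_. borel) X I"
proof -
  \<comment> \<open>\<open>incr_indep\<close> is available for grids containing 0.\<close>
  define T' where "T' = insert 0 T"
  have T': "grid_step T' s" "finite T'" "T' \<noteq> {}" "0 \<in> T'"
    using s by (auto simp: T'_def grid_step_def intro: grid_step_mono[OF s])
  define xs where "xs = sorted_list_of_set T'"
  have xs: "sorted xs" "distinct xs" "set xs = T'" using T' by (simp_all add: xs_def)
  have ne: "xs \<noteq> []" using xs T' by auto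
  define n where "n = length xs - 1"
  have len: "length xs = Suc n" using ne by (simp add: n_def)
  \<comment> \<open>\<open>min i n\<close> continues the sorted grid as a constant, which makes
    \<open>t\<close> monotone on all of nat.\<close>
  define t where "t i = xs ! min i n" for i
  have t_mono: "mono t"
    unfolding t_def by (intro monoI sorted_nth_mono[OF xs(1)]) (auto simp: len)
  have T_eq: "T' = t ` {..n}"
  proof -
    have "t ` {..n} = (!) xs ` {..<length xs}" unfolding len t_def by (auto simp: less_Suc_eq_le)
    also have "\<dots> = set xs" by (auto simp: set_conv_nth)
    finally show ?thesis using xs by simp
  qed
  have gap: "T' \<inter> {x..<t (Suc i)} = {}" if "t i < x" for i x
  proof (rule equals0I)
    fix y assume y: "y \<in> T' \<inter> {x..<t (Suc i)}"
    then obtain j where j: "y = t j" by (auto simp: T_eq)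
    have "t i < t j" "t j < t (Suc i)" using y j that by auto
    then have "i < j" "j < Suc i" using t_mono by (auto simp: mono_def not_le[symmetric])
    then show False by simp
  qed
  have indep: "indep_vars (\<lambda>_. borel) (\<lambda>i w. L (t (Suc i)) w - L (t i) w) {..<n}"
    using T' T_eq by (intro incr_indep t_mono) auto
  \<comment> \<open>Since \<open>s\<close> is constant on half-open cells, its value at the right
    end point decides which set a cell belongs to.\<close>
  define K where "K i = {j\<in>{..<n}. s (t (Suc j)) \<in> P i}" for i
  define X where "X i w = (\<Sum>j\<in>K i. L (t (Suc j)) w - L (t j) w)" for i w
  have Kd: "disjoint_family_on K I" using disj by (auto simp: disjoint_family_on_def K_def)
  have eq: "indicator (s -` P i) x = (\<Sum>j\<in>K i. indicat_real {t j<..t (Suc j)} x)" if i: "i \<in> I" for i x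
  proof (cases "t 0 < x \<and> x \<le> t n")
    case False
    \<comment> \<open>Outside the range of the grid \<open>s\<close> vanishes, and 0 lies in no
      \<open>P i\<close>.\<close>
    have "s x = 0"
    proof -
      have "(\<forall>y\<in>T'. x \<le> y) \<or> (\<forall>y\<in>T'. y < x)"
      proof (cases "x \<le> t 0")
        case True
        then show ?thesis using t_mono by (auto simp: T_eq mono_def intro: order_trans)
      next
        case F: False
        then have "t n < x" using False by simp
        then show ?thesis using t_mono by (auto simp: T_eq mono_def intro: le_less_trans)
      qed
      then show ?thesis using T'(1) unfolding grid_step_def by blast
    qed
    have z: "indicat_real {t j<..t (Suc j)} x = 0" if "j \<in> K i" for j
    proof -
      have "t 0 \<le> t j" "t (Suc j) \<le> t n" using that t_mono by (auto simp: K_def mono_def)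
      then show ?thesis using False by (auto simp: indicator_def)
    qed
    then have "(\<Sum>j\<in>K i. indicat_real {t j<..t (Suc j)} x) = 0" by (intro sum.neutral ballI)
    then show ?thesis using P0[OF i] \<open>s x = 0\<close> by (simp only: indicator_def) simp
  next
    case True
    define j where "j = (LEAST j. x \<le> t (Suc j))"
    have ex: "x \<le> t (Suc (n - 1))" using True by (cases n) auto
    have j1: "x \<le> t (Suc j)" unfolding j_def by (rule LeastI[of "\<lambda>j. x \<le> t (Suc j)", OF ex])
    have j2: "t j < x"
    proof (cases j)
      case 0 then show ?thesis using True by simp
    next
      case (Suc k)
      then have "\<not> x \<le> t (Suc k)" using not_less_Least[of k "\<lambda>j. x \<le> t (Suc j)"] by (simp add: j_def)
      then show ?thesis using Suc by simp
    qed
    have jn: "j < n"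
    proof (rule ccontr)
      assume "\<not> j < n"
      then have "t j = t n" by (simp add: t_def)
      then show False using j2 True by simp
    qed
    have uniq: "k = j" if "t k < x" "x \<le> t (Suc k)" for k
    proof (rule ccontr)
      assume "k \<noteq> j"
      then consider "Suc k \<le> j" | "Suc j \<le> k" by linarith
      then show False
        using monoD[OF t_mono, of "Suc k" j] monoD[OF t_mono, of "Suc j" k] that j1 j2 by cases auto
    qed
    have sx: "s x = s (t (Suc j))" using T'(1) gap[OF j2] j1 by (auto simp: grid_step_def)
    have "(\<Sum>k\<in>K i. indicat_real {t k<..t (Suc k)} x) = (\<Sum>k\<in>K i. if k = j then 1 else 0)"
    proof (intro sum.cong refl)
      fix k
      show "indicat_real {t k<..t (Suc k)} x = (if k = j then 1 else 0)"
        using uniq[of k] j1 j2 by (cases "k = j") (auto simp: indicator_def)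
    qed
    also have "\<dots> = indicator (K i) j" by (simp add: K_def indicator_def)
    finally show ?thesis using sx jn by (simp add: indicator_def K_def)
  qed
  show thesis
  proof
    fix i assume i: "i \<in> I"
    have "stoch_int (\<lambda>x. \<Sum>j\<in>K i. indicat_real {t j<..t (Suc j)} x) (X i)"
      unfolding X_def by (intro stoch_int_sum stoch_int.base monoD[OF t_mono]) simp
    then show "stoch_int (indicator (s -` P i)) (X i)" unfolding eq[OF i, symmetric] by simp
  next
    have "indep_vars (\<lambda>_. borel) (\<lambda>i w. \<Sum>j\<in>K i. (\<lambda>j\<in>K i. L (t (Suc j)) w - L (t j) w) j) I"
      by (rule indep_vars_compose2[OF indep_vars_restrict[OF indep _ Kd]]) (auto simp: K_def)
    then show "indep_vars (\<lambda>_. borel) X I"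
      by (simp add: X_def[abs_def])
  qed
qed

text \<open>Encoding the disjoint sets as the level sets of one function \<open>p\<close> lets a single grid step function
  approximate all of them by disjoint sets simultaneously.\<close>

lemma stoch_int_indep:
  fixes A :: "nat \<Rightarrow> real set"
  assumes A: "\<And>i. A i \<in> bounded_borel" "disjoint_family A" and Y: "\<And>i. stoch_int (indicator (A i)) (Y i)"
  shows "indep_vars (\<lambda>_. borel) Y {..<n}"
proof -
  have [measurable]: "A i \<in> sets borel" for i using A(1) by (simp add: bounded_borel_def)
  \<comment> \<open>The values start at 1, so that 0 is left for the points outside the first
    \<open>n\<close> sets.\<close>
  define p where "p x = (\<Sum>i<n. (real i + 1) * indicator (A i) x)" for x
  have p: "stoch_int p (\<lambda>w. \<Sum>i<n. (real i + 1) * Y i w)"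
    unfolding p_def by (intro stoch_int_sum stoch_int.cmult Y)
  have p_eq: "p x = (if x \<in> A i then real i + 1 else p x)" if "i < n" for i x
  proof (cases "x \<in> A i")
    case True
    have "p x = (\<Sum>j<n. if j = i then real i + 1 else 0)"
      unfolding p_def
    proof (intro sum.cong refl)
      fix j assume "j \<in> {..<n}"
      have "x \<notin> A j" if "j \<noteq> i" using A(2) that True by (auto simp: disjoint_family_on_def)
      then show "(real j + 1) * indicator (A j) x = (if j = i then real i + 1 else 0)"
        using True by (auto simp: indicator_def)
    qed
    then show ?thesis using True that by simp
  qed simp
  have p_not: "p x = 0 \<or> (\<exists>j. j \<noteq> i \<and> p x = real j + 1)" if "x \<notin> A i" for i x
  proof (cases "\<exists>j<n. x \<in> A j")
    case True
    then obtain j where "j < n" "x \<in> A j" by auto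
    then show ?thesis using p_eq[of j x] that by auto
  next
    case False
    then show ?thesis by (auto simp: p_def intro!: sum.neutral)
  qed
  have "\<exists>T s. grid_step T s \<and> integrable lborel s \<and> (LBINT x. \<bar>p x - s x\<bar>) < inverse (real (Suc k))" for k
    using stoch_int_grid_approx[OF p, of "inverse (real (Suc k))"] by simp
  then obtain T s where s: "\<And>k. grid_step (T k) (s k)" "\<And>k. integrable lborel (s k)"
    "\<And>k. (LBINT x. \<bar>p x - s k x\<bar>) < inverse (real (Suc k))" by metis
  \<comment> \<open>Windows of radius 1/2 about the values of \<open>p\<close> are disjoint and miss
    0, as \<open>grid_step_cells\<close> requires.\<close>
  define P where "P i = {y::real. \<bar>y - (real i + 1)\<bar> < 1/2}" for i :: nat
  have Pd: "disjoint_family_on P {..<n}"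
  proof -
    have "i = j" if "y \<in> P i" "y \<in> P j" for i j y
    proof -
      have "\<bar>real i - real j\<bar> < 1" using that unfolding P_def mem_Collect_eq by linarith
      then show ?thesis by linarith
    qed
    then show ?thesis by (auto simp: disjoint_family_on_def)
  qed
  have P0: "0 \<notin> P i" for i by (simp add: P_def)
  have "\<exists>X. (\<forall>i\<in>{..<n}. stoch_int (indicator (s k -` P i)) (X i)) \<and> indep_vars (\<lambda>_. borel) X {..<n}" for k
    by (rule grid_step_cells[OF s(1)[of k] finite_lessThan Pd]) (use P0 in auto)
  then obtain X where X: "\<And>k i. i < n \<Longrightarrow> stoch_int (indicator (s k -` P i)) (X k i)"
    and Xi: "\<And>k. indep_vars (\<lambda>_. borel) (X k) {..<n}" by (metis lessThan_iff)
  show ?thesis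
  proof (rule indep_vars_tendsto[OF finite_lessThan Xi])
    fix i assume "i \<in> {..<n}"
    then have i: "i < n" by simp
    show "Y i \<in> borel_measurable M" using Y by (rule stoch_int_measurable)
    \<comment> \<open>A wrong membership forces \<open>|p x - s k x|\<close> to be at least 1/2,
      whence the factor 2.\<close>
    have le: "\<bar>indicat_real (s k -` P i) x - indicator (A i) x\<bar> \<le> 2 * \<bar>p x - s k x\<bar>" for k x
    proof (cases "x \<in> A i")
      case True
      then have "p x = real i + 1" using p_eq[OF i, of x] by simp
      then show ?thesis using True by (auto simp: indicator_def P_def abs_minus_commute)
    next
      case False
      have "1/2 < \<bar>p x - s k x\<bar>" if "\<bar>s k x - (real i + 1)\<bar> < 1/2"
        using p_not[OF False]
      proof (elim disjE exE conjE)
        fix j assume "j \<noteq> i" "p x = real j + 1"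
        then have "1 \<le> \<bar>real j - real i\<bar>" by linarith
        then show ?thesis using that \<open>p x = real j + 1\<close> by linarith
      qed (use that in linarith)
      then show ?thesis using False by (auto simp: indicator_def P_def)
    qed
    have D: "(LBINT x. \<bar>indicat_real (s k -` P i) x - indicator (A i) x\<bar>) \<le> 2 * inverse (real (Suc k))" for k
    proof -
      have "integrable lborel p" using stoch_int_L12[OF p] by blast
      then have "(LBINT x. \<bar>indicat_real (s k -` P i) x - indicator (A i) x\<bar>) \<le> (LBINT x. 2 * \<bar>p x - s k x\<bar>)"
        using le s(2)[of k] L12D(1)[OF stoch_int_L12[OF X[OF i, of k]]] L12D(1)[OF stoch_int_L12[OF Y[of i]]]
        by (intro integral_mono integrable_abs Bochner_Integration.integrable_diff integrable_mult_right) auto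
      then show ?thesis using s(3)[of k] by simp
    qed
    have l: "(\<lambda>k. LBINT x. \<bar>indicat_real (s k -` P i) x - indicator (A i) x\<bar>) \<longlonglongrightarrow> 0"
    proof (rule tendsto_sandwich[OF _ _ tendsto_const])
      show "(\<lambda>k. 2 * inverse (real (Suc k))) \<longlonglongrightarrow> 0"
        using tendsto_mult_right_zero[OF LIMSEQ_inverse_real_of_nat] .
    qed (use D in auto)
    \<comment> \<open>For indicators the squared L2 distance equals the L1 distance, so
      approximation in L1 controls both.\<close>
    have sq: "(indicat_real B x - indicator C x)\<^sup>2 = \<bar>indicat_real B x - indicator C x\<bar>" for B C and x :: real
      by (auto simp: indicator_def)
    show "(\<lambda>k. trunc_mean (\<lambda>w. X k i w - Y i w)) \<longlonglongrightarrow> 0"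
    proof (rule trunc_mean_tendsto_0_of_L2)
      show "sq_integrable M (\<lambda>w. X k i w - Y i w)" for k
        by (intro sq_integrable_diff stoch_int_sq[OF X[OF i]] stoch_int_sq[OF Y])
      show "(\<lambda>k. expectation (\<lambda>w. (X k i w - Y i w)\<^sup>2)) \<longlonglongrightarrow> 0"
        by (rule stoch_int_diff_square_tendsto_0[OF X[OF i] Y l]) (use l in \<open>simp add: sq\<close>)
    qed
  qed
qed

text \<open>Choosing one integral for each indicator gives the measure. Countable additivity is
  required as an almost sure series, which is more than mean square convergence: the one-series
  theorem applies to the centred values, whose variances are \<open>V\<close> times lengths of
  finite sum.\<close>

lemma random_measure_exists: "\<exists>\<Lambda>. is_random_measure_of \<Lambda> L"
proof -
  define \<Lambda> where "\<Lambda> A = (SOME Y. stoch_int (indicator A) Y)" for A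
  have \<Lambda>: "stoch_int (indicator A) (\<Lambda> A)" if "A \<in> bounded_borel" for A
    unfolding \<Lambda>_def by (rule someI_ex[OF stoch_int_indicator_exists[OF that]])
  have indep: "indep_vars (\<lambda>_. borel) (\<lambda>n. \<Lambda> (A n)) UNIV"
    if "range A \<subseteq> bounded_borel" "disjoint_family A" for A :: "nat \<Rightarrow> real set"
  proof -
    have fin: "indep_vars (\<lambda>_. borel) (\<lambda>n. \<Lambda> (A n)) {..<n}" for n
      by (rule stoch_int_indep[of A]) (use that \<Lambda> in auto)
    have "random_variable borel (\<Lambda> (A n))" for n
      using that by (intro stoch_int_measurable[OF \<Lambda>]) auto
    moreover have "indep_sets (\<lambda>i. {\<Lambda> (A i) -` B \<inter> space M |B. B \<in> sets borel}) UNIV"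
      unfolding indep_sets_finite_index_sets[of _ UNIV]
    proof (intro allI impI)
      fix J :: "nat set" assume J: "J \<subseteq> UNIV" "J \<noteq> {}" "finite J"
      then obtain n where "J \<subseteq> {..<n}" by (meson finite_nat_bounded)
      from indep_vars_subset[OF fin this]
      show "indep_sets (\<lambda>i. {\<Lambda> (A i) -` B \<inter> space M |B. B \<in> sets borel}) J"
        by (simp add: indep_vars_def2)
    qed
    ultimately show ?thesis by (simp add: indep_vars_def2)
  qed
  have sums: "AE w in M. (\<lambda>n. \<Lambda> (A n) w) sums \<Lambda> (\<Union>n. A n) w"
    if A: "range A \<subseteq> bounded_borel" "disjoint_family A" and U: "(\<Union>n. A n) \<in> bounded_borel" for A :: "nat \<Rightarrow> real set"
  proof -
    have An: "A n \<in> bounded_borel" for n using A by auto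
    note sA = \<Lambda>[OF An]
    have [measurable]: "\<Lambda> (A n) \<in> borel_measurable M" for n by (rule stoch_int_measurable[OF sA])
    define m where "m n = measure lborel (A n)" for n
    have "m sums measure lborel (\<Union>n. A n)"
      unfolding m_def using A An bounded_borel_emeasure[OF U]
      by (intro measure_UNION) (auto simp: bounded_borel_def)
    then have m: "summable m" by (rule sums_summable)
    \<comment> \<open>Centring makes the one-series theorem applicable; the subtracted means form a
      convergent series.\<close>
    define X where "X n w = \<Lambda> (A n) w - \<mu> * m n" for n w
    have sqX: "sq_integrable M (X n)" for n
      unfolding X_def by (intro sq_integrable_diff sq_integrable_const stoch_int_sq[OF sA])
    have EA: "expectation (\<Lambda> (A n)) = \<mu> * m n" for n
      using stoch_int_mean[OF sA[of n]] by (simp add: m_def)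
    have EX: "expectation (X n) = 0" for n
      unfolding X_def using sq_integrable_integrable[OF stoch_int_sq[OF sA[of n]]] by (simp add: EA prob_space)
    have EX2: "expectation (\<lambda>w. (X n w)\<^sup>2) = V * m n" for n
    proof -
      have "expectation (\<lambda>w. (X n w)\<^sup>2) = expectation (\<lambda>w. (\<Lambda> (A n) w)\<^sup>2) - (\<mu> * m n)\<^sup>2"
        unfolding X_def EA[symmetric]
        by (rule variance_eq) (use stoch_int_sq[OF sA[of n]] in \<open>auto intro: sq_integrable_integrable sq_integrable_square\<close>)
      also have "(\<lambda>x. (indicat_real (A n) x)\<^sup>2) = indicator (A n)" by (auto simp: indicator_def)
      with stoch_int_square[OF sA[of n]] have "expectation (\<lambda>w. (\<Lambda> (A n) w)\<^sup>2) = V * m n + (\<mu> * m n)\<^sup>2"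
        by (simp add: m_def power_mult_distrib)
      finally show ?thesis by simp
    qed
    have "indep_vars (\<lambda>_. borel) X UNIV"
      unfolding X_def using indep[OF A]
      by (rule indep_vars_compose2[where Y="\<lambda>n y. y - \<mu> * m n"]) simp
    then have "AE w in M. summable (\<lambda>n. X n w)"
      by (rule AE_summable_indep[OF _ sqX EX]) (simp add: EX2 summable_mult m)
    then have sm: "AE w in M. summable (\<lambda>n. \<Lambda> (A n) w)"
    proof eventually_elim
      case (elim w)
      from summable_add[OF elim summable_mult[OF m, of \<mu>]] show ?case by (simp add: X_def)
    qed
    have "AE w in M. (\<Sum>n. \<Lambda> (A n) w) = \<Lambda> (\<Union>n. A n) w"
    proof (rule AE_eq_of_L2_limit)
      show "sq_integrable M (\<lambda>w. \<Sum>i<n. \<Lambda> (A i) w)" for n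
        by (intro sq_integrable_sum stoch_int_sq[OF sA])
      show "AE w in M. (\<lambda>n. \<Sum>i<n. \<Lambda> (A i) w) \<longlonglongrightarrow> (\<Sum>n. \<Lambda> (A n) w)"
        using sm by eventually_elim (rule summable_LIMSEQ)
      show "(\<lambda>n. expectation (\<lambda>w. ((\<Sum>i<n. \<Lambda> (A i) w) - \<Lambda> (\<Union>n. A n) w)\<^sup>2)) \<longlonglongrightarrow> 0"
        by (rule stoch_int_diff_square_tendsto_0[OF stoch_int_sum[OF sA] \<Lambda>[OF U] indicator_UN_L12_limit[OF An A(2) U]])
    qed (auto intro: stoch_int_sq[OF \<Lambda>[OF U]])
    with sm show ?thesis
      by eventually_elim (use summable_sums in force)
  qed
  have "is_random_measure_of \<Lambda> L"
    unfolding is_random_measure_of_def independently_scattered_def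
    using indep sums stoch_int_measurable[OF \<Lambda>] stoch_int_unique[OF \<Lambda>[OF bounded_borel_Ioc] stoch_int.base]
    by auto
  then show ?thesis by blast
qed

section \<open>Random measures and random integrals\<close>

text \<open>\<open>random_measure_of\<close> is an arbitrary choice, so every random measure of
  \<open>L\<close> is treated. The sets on which it agrees with the integral form a Dynkin system:
  its series converge almost surely, those of the integral in mean square, and the two limits
  coincide.\<close>

lemma random_measure_stoch_int:
  assumes rm: "is_random_measure_of \<Lambda> L" and A: "A \<in> bounded_borel"
  shows "stoch_int (indicator A) (\<Lambda> A)"
proof -
  have sc: "independently_scattered \<Lambda>" and \<Lambda>_Ioc: "\<And>a b. a \<le> b \<Longrightarrow> AE w in M. \<Lambda> {a<..b} w = L b w - L a w"
    using rm by (auto simp: is_random_measure_of_def)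
  have \<Lambda>_meas [measurable]: "\<Lambda> B \<in> borel_measurable M" if "B \<in> bounded_borel" for B
    using sc that by (simp add: independently_scattered_def)
  have \<Lambda>_sums: "AE w in M. (\<lambda>n. \<Lambda> (F n) w) sums \<Lambda> (\<Union>n. F n) w"
    if "\<And>n. F n \<in> bounded_borel" "disjoint_family F" "(\<Union>n. F n) \<in> bounded_borel" for F :: "nat \<Rightarrow> real set"
    using sc that unfolding independently_scattered_def by blast
  have base: "stoch_int (indicator {a<..b}) (\<Lambda> {a<..b})" if "a \<le> b" for a b
    by (rule stoch_int_cong_AE[OF stoch_int.base[OF that]])
      (use \<Lambda>_Ioc[OF that] in \<open>auto intro: \<Lambda>_meas bounded_borel_Ioc\<close>)
  have empty: "AE w in M. \<Lambda> {} w = 0" using \<Lambda>_Ioc[of 0 0] by simp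
  obtain N where N: "0 \<le> N" "A \<subseteq> {-N<..N}" using bounded_borel_subset_Ioc[OF A] .
  let ?J = "{-N<..N}"
  have J: "?J \<in> bounded_borel" by (rule bounded_borel_Ioc)
  have "A \<in> sets borel" using A by (simp add: bounded_borel_def)
  then have "stoch_int (indicator (A \<inter> ?J)) (\<Lambda> (A \<inter> ?J))"
  proof (induction rule: borel_sets_induct_Ioc)
    case (Ioc a b)
    show ?case
    proof (cases "max a (-N) \<le> min b N")
      case True
      have "{a<..b} \<inter> ?J = {max a (-N)<..min b N}" by auto
      then show ?thesis using base[OF True] by simp
    next
      case False
      then have eq: "{a<..b} \<inter> ?J = {0<..0}" by auto
      show ?thesis unfolding eq by (rule base) simp
    qed
  next
    case (compl B)
    \<comment> \<open>Additivity is given for sequences, so two sets are padded with empty ones,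
      whose measure vanishes almost surely because \<open>{0<..0}\<close> is empty.\<close>
    define F :: "nat \<Rightarrow> real set" where "F n = (if n = 0 then B \<inter> ?J else if n = 1 then - B \<inter> ?J else {})" for n
    have b: "B \<inter> ?J \<in> bounded_borel" "- B \<inter> ?J \<in> bounded_borel"
      using compl by (auto intro!: bounded_borel_Int J)
    have Fb: "F n \<in> bounded_borel" for n using b by (simp add: F_def bounded_borel_def)
    have Fd: "disjoint_family F" by (auto simp: disjoint_family_on_def F_def)
    have FU: "(\<Union>n. F n) = ?J"
    proof
      show "?J \<subseteq> (\<Union>n. F n)"
      proof
        fix x assume "x \<in> ?J"
        then have "x \<in> F 0 \<or> x \<in> F 1" by (auto simp: F_def)
        then show "x \<in> (\<Union>n. F n)" by blast
      qed
    qed (auto simp: F_def split: if_splits)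
    have "AE w in M. \<Lambda> ?J w - \<Lambda> (B \<inter> ?J) w = \<Lambda> (- B \<inter> ?J) w"
      using \<Lambda>_sums[OF Fb Fd, unfolded FU, OF J] empty
    proof eventually_elim
      case (elim w)
      have "(\<lambda>n. \<Lambda> (F n) w) sums (\<Sum>n\<in>{0, 1}. \<Lambda> (F n) w)"
        by (rule sums_finite) (use elim in \<open>auto simp: F_def\<close>)
      with elim(1) have "\<Lambda> ?J w = (\<Sum>n\<in>{0, 1}. \<Lambda> (F n) w)" by (rule sums_unique2)
      then show ?case by (simp add: F_def)
    qed
    moreover have "(\<lambda>x. indicator ?J x - indicator (B \<inter> ?J) x) = indicat_real (- B \<inter> ?J)"
      by (auto simp: indicator_def)
    moreover have "stoch_int (\<lambda>x. indicator ?J x - indicator (B \<inter> ?J) x) (\<lambda>w. \<Lambda> ?J w - \<Lambda> (B \<inter> ?J) w)"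
      using N by (intro stoch_int_diff base compl) auto
    ultimately show ?case
      using b by (intro stoch_int_cong_AE[of _ _ "indicator (- B \<inter> ?J)" "\<Lambda> (- B \<inter> ?J)"])
        (auto simp: bounded_borel_def intro!: \<Lambda>_meas)
  next
    case (union B)
    define F where "F i = B i \<inter> ?J" for i
    have b: "F i \<in> bounded_borel" for i
      unfolding F_def using union by (intro bounded_borel_Int J) auto
    have U: "(\<Union>i. F i) = (\<Union>i. B i) \<inter> ?J" by (auto simp: F_def)
    have bU: "(\<Union>i. F i) \<in> bounded_borel"
      unfolding U using union by (intro bounded_borel_Int J) auto
    have d: "disjoint_family F" using union by (auto simp: disjoint_family_on_def F_def)
    have Y: "stoch_int (indicator (F i)) (\<Lambda> (F i))" for i using union by (simp add: F_def)
    obtain Z where Z: "stoch_int (indicator (\<Union>i. F i)) Z"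
      "(\<lambda>n. expectation (\<lambda>w. ((\<Sum>i<n. \<Lambda> (F i) w) - Z w)\<^sup>2)) \<longlonglongrightarrow> 0"
      by (rule stoch_int_limit_exists[OF stoch_int_sum[OF Y] L12_indicator[OF bU] indicator_UN_L12_limit[OF b d bU]])
    have "AE w in M. \<Lambda> (\<Union>i. F i) w = Z w"
    proof (rule AE_eq_of_L2_limit[OF _ stoch_int_sq[OF Z(1)] _ _ Z(2)])
      show "sq_integrable M (\<lambda>w. \<Sum>i<n. \<Lambda> (F i) w)" for n by (intro sq_integrable_sum stoch_int_sq[OF Y])
      show "AE w in M. (\<lambda>n. \<Sum>i<n. \<Lambda> (F i) w) \<longlonglongrightarrow> \<Lambda> (\<Union>i. F i) w"
        using \<Lambda>_sums[OF b d bU] by eventually_elim (simp add: sums_def)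
    qed (rule \<Lambda>_meas[OF bU])
    then have "stoch_int (indicator (\<Union>i. F i)) (\<Lambda> (\<Union>i. F i))"
      using bU by (intro stoch_int_cong_AE[OF Z(1)]) (auto simp: bounded_borel_def intro!: \<Lambda>_meas)
    then show ?case unfolding U .
  qed
  then show ?thesis using N by (simp add: Int_absorb2)
qed

lemma step_integral_stoch_int:
  assumes rm: "is_random_measure_of \<Lambda> L" and g: "step_function g" and A: "A \<in> sets borel"
  shows "stoch_int (\<lambda>x. g x * indicator A x) (step_integral \<Lambda> A g)"
proof -
  note r = step_function_representation[OF g]
  have "stoch_int (\<lambda>x. \<Sum>y\<in>range g - {0}. y * indicator (A \<inter> g -` {y}) x) (\<lambda>w. \<Sum>y\<in>range g - {0}. y * \<Lambda> (A \<inter> g -` {y}) w)"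
    by (intro stoch_int_sum stoch_int.cmult random_measure_stoch_int[OF rm] bounded_borel_Int A r(2)) auto
  moreover have "(\<Sum>y\<in>range g - {0}. y * indicator (A \<inter> g -` {y}) x) = g x * indicator A x" for x
  proof -
    have "(\<Sum>y\<in>range g - {0}. y * indicator (A \<inter> g -` {y}) x) = (\<Sum>y\<in>range g - {0}. y * indicator (g -` {y}) x) * indicator A x"
      unfolding sum_distrib_right by (intro sum.cong refl) (simp add: indicator_inter_arith)
    then show ?thesis by (simp only: r(3)[of x, symmetric])
  qed
  ultimately show ?thesis by (simp add: step_integral_def[abs_def])
qed

lemma tendsto_in_prob_of_stoch_int:
  assumes Y: "\<And>n. stoch_int (f n) (Y n)" and Z: "stoch_int F Z"
    and l: "(\<lambda>n. LBINT x. \<bar>f n x - F x\<bar>) \<longlonglongrightarrow> 0" "(\<lambda>n. LBINT x. (f n x - F x)\<^sup>2) \<longlonglongrightarrow> 0"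
  shows "tendsto_in_prob Y Z sequentially"
proof -
  have "(\<lambda>n. trunc_mean (\<lambda>w. Y n w - Z w)) \<longlonglongrightarrow> 0"
    by (intro trunc_mean_tendsto_0_of_L2 sq_integrable_diff stoch_int_sq[OF Y] stoch_int_sq[OF Z]
        stoch_int_diff_square_tendsto_0[OF Y Z l])
  then show ?thesis
    by (subst tendsto_in_prob_iff_trunc_mean) (auto intro: stoch_int_measurable[OF Y] stoch_int_measurable[OF Z])
qed

text \<open>One dominated sequence of step functions serves every Borel set \<open>A\<close> at
  once. This is the existence on which the choice in \<open>levy_integral\<close> relies.\<close>

lemma has_random_integral_of_stoch_int:
  assumes rm: "is_random_measure_of \<Lambda> L" and f: "stoch_int f Y"
  shows "has_random_integral \<Lambda> f Y"
proof -
  have Lf: "L12 f" by (rule stoch_int_L12[OF f])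
  then have fm [measurable]: "f \<in> borel_measurable borel" by measurable
  obtain g where g: "\<And>n::nat. step_function (g n)" "\<And>x. (\<lambda>n. g n x) \<longlonglongrightarrow> f x" "\<And>n x. \<bar>g n x\<bar> \<le> 2 * \<bar>f x\<bar>"
    using step_function_approx[of f] by auto
  have conv: "tendsto_in_prob (\<lambda>n. step_integral \<Lambda> A (g n)) Z sequentially"
    if A: "A \<in> sets borel" and Z: "stoch_int (\<lambda>x. f x * indicator A x) Z" for A Z
  proof -
    note s = step_integral_stoch_int[OF rm g(1) A]
    have dom: "\<bar>g n x * indicator A x - f x * indicator A x\<bar> \<le> \<bar>3 * f x\<bar>" for n x
      using g(3)[of n x] by (auto simp: indicator_def abs_mult)
    have m: "(\<lambda>x. g n x * indicator A x) \<in> borel_measurable borel" "(\<lambda>x. f x * indicator A x) \<in> borel_measurable borel" for n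
      using L12_measurable[OF stoch_int_L12[OF s]] L12_measurable[OF stoch_int_L12[OF Z]] by auto
    have lim: "AE x in lborel. (\<lambda>n. g n x * indicator A x) \<longlonglongrightarrow> f x * indicator A x"
      by (intro AE_I2 tendsto_mult_right g(2))
    show ?thesis
      by (rule tendsto_in_prob_of_stoch_int[OF s Z]; rule dominated_L12[OF L12_cmult[OF Lf, of 3] m lim dom])
  qed
  have "tendsto_in_prob (\<lambda>n. step_integral \<Lambda> UNIV (g n)) Y sequentially"
    by (rule conv) (use f in auto)
  moreover have "\<exists>Z. random_variable borel Z \<and> tendsto_in_prob (\<lambda>n. step_integral \<Lambda> A (g n)) Z sequentially"
    if "A \<in> sets borel" for A
    using stoch_int_exists[OF L12_mult_indicator[OF Lf that]] conv[OF that] stoch_int_measurable by blast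
  ultimately show ?thesis
    unfolding has_random_integral_def using g fm stoch_int_measurable[OF f]
    by (intro conjI exI[of _ g]) auto
qed

lemma trunc_mean_tendsto:
  assumes "\<And>n. Y n \<in> borel_measurable M" "Z \<in> borel_measurable M"
    and "(\<lambda>n. trunc_mean (\<lambda>w. Y n w - Z w)) \<longlonglongrightarrow> 0"
  shows "(\<lambda>n. trunc_mean (Y n)) \<longlonglongrightarrow> trunc_mean Z"
  by (rule LIM_zero_cancel, rule Lim_null_comparison[OF _ assms(3)])
    (use trunc_mean_diff_le[OF assms(1,2)] in auto)

text \<open>The sliding hump sets \<open>G k\<close> bound \<open>\<bar>x\<bar>\<close> and all \<open>\<bar>g n x - f x\<bar>\<close> by \<open>k\<close>: dominated convergence then
  applies inside \<open>G k\<close> as \<open>n\<close> grows, and outside as \<open>k\<close> grows.\<close>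

lemma stoch_int_of_has_random_integral:
  assumes rm: "is_random_measure_of \<Lambda> L" and Lf: "L12 f" and has: "has_random_integral \<Lambda> f Y"
  shows "stoch_int f Y"
proof -
  have fm [measurable]: "f \<in> borel_measurable borel" and Ym [measurable]: "Y \<in> borel_measurable M"
    using has by (auto simp: has_random_integral_def)
  obtain g where g: "\<And>n::nat. step_function (g n)" and glim: "AE x in lborel. (\<lambda>n. g n x) \<longlonglongrightarrow> f x"
    and gA: "\<And>A. A \<in> sets borel \<Longrightarrow> \<exists>Z. random_variable borel Z \<and> tendsto_in_prob (\<lambda>n. step_integral \<Lambda> A (g n)) Z sequentially"
    and gY: "tendsto_in_prob (\<lambda>n. step_integral \<Lambda> UNIV (g n)) Y sequentially"
    using has unfolding has_random_integral_def by blast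
  note s = step_integral_stoch_int[OF rm g]
  define d where "d n x = g n x - f x" for n x
  have "stoch_int (g n) (step_integral \<Lambda> UNIV (g n))" for n using s[of UNIV n] by simp
  then have Ld: "L12 (d n)" for n unfolding d_def by (intro L12_diff Lf) (rule stoch_int_L12)
  have dm [measurable]: "d n \<in> borel_measurable borel" for n using Ld[of n] by measurable
  have dlim: "AE x in lborel. (\<lambda>n. d n x) \<longlonglongrightarrow> 0"
    using glim by eventually_elim (simp add: d_def LIM_zero)
  have "\<forall>A. \<exists>Z. A \<in> sets borel \<longrightarrow> stoch_int (\<lambda>x. f x * indicator A x) Z"
    using stoch_int_exists[OF L12_mult_indicator[OF Lf]] by blast
  then obtain S where S: "\<And>A. A \<in> sets borel \<Longrightarrow> stoch_int (\<lambda>x. f x * indicator A x) (S A)" by metis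
  \<comment> \<open>The error over \<open>A\<close>, which is an integral of \<open>d n\<close>
    restricted to \<open>A\<close>; it is additive in \<open>A\<close> up to null sets.\<close>
  define \<nu> where "\<nu> n A w = step_integral \<Lambda> A (g n) w - S A w" for n A w
  have \<nu>: "stoch_int (\<lambda>x. d n x * indicator A x) (\<nu> n A)" if "A \<in> sets borel" for n A
    using stoch_int_diff[OF s[OF that, of n] S[OF that]]
    by (simp add: \<nu>_def[abs_def] d_def left_diff_distrib)
  note \<nu>m = stoch_int_measurable[OF \<nu>]
  define Q where "Q n A = (if A \<in> sets borel then trunc_mean (\<nu> n A) else 0)" for n A
  define G where "G k = {x. \<bar>x\<bar> \<le> real k \<and> (\<forall>n. \<bar>d n x\<bar> \<le> real k)}" for k
  have Gm [measurable]: "G k \<in> sets borel" for k unfolding G_def by measurable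
  have additive: "AE w in M. \<nu> n A w + \<nu> n B w = \<nu> n (A \<union> B) w"
    if "A \<in> sets borel" "B \<in> sets borel" "A \<inter> B = {}" for n A B
  proof (rule stoch_int_unique)
    have "d n x * indicator A x + d n x * indicator B x = d n x * indicator (A \<union> B) x" for x
      using that(3) by (auto simp: indicator_def)
    then show "stoch_int (\<lambda>x. d n x * indicator (A \<union> B) x) (\<lambda>w. \<nu> n A w + \<nu> n B w)"
      using stoch_int.add[OF \<nu>[OF that(1), of n] \<nu>[OF that(2), of n]] by simp
    show "stoch_int (\<lambda>x. d n x * indicator (A \<union> B) x) (\<nu> n (A \<union> B))"
      using that by (intro \<nu>) auto
  qed
  \<comment> \<open>An estimate uniform over all \<open>B\<close> inside \<open>C\<close>: the
    values of \<open>|d n|\<close> on \<open>C\<close> dominate both terms of the second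
    moment.\<close>
  have bound: "Q n B \<le> sqrt (V * (LBINT x. (d n x * indicator C x)\<^sup>2) + \<mu>\<^sup>2 * (LBINT x. \<bar>d n x * indicator C x\<bar>)\<^sup>2)"
    if B: "B \<in> sets borel" and C: "C \<in> sets borel" and BC: "B \<subseteq> C" for n B C
  proof -
    have LB: "L12 (\<lambda>x. d n x * indicator B x)" and LC: "L12 (\<lambda>x. d n x * indicator C x)"
      using B C by (auto intro: L12_mult_indicator Ld)
    have "(LBINT x. (d n x * indicator B x)\<^sup>2) \<le> (LBINT x. (d n x * indicator C x)\<^sup>2)"
      by (intro integral_mono sq_integrable_square L12D(2) LB LC) (use BC in \<open>auto simp: indicator_def\<close>)
    moreover have "\<bar>LBINT x. d n x * indicator B x\<bar> \<le> (LBINT x. \<bar>d n x * indicator C x\<bar>)"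
      by (intro abs_integral_le integrable_abs L12D(1) LB LC) (use BC in \<open>auto simp: indicator_def\<close>)
    then have "(LBINT x. d n x * indicator B x)\<^sup>2 \<le> (LBINT x. \<bar>d n x * indicator C x\<bar>)\<^sup>2"
      using power_mono[of "\<bar>LBINT x. d n x * indicator B x\<bar>" _ 2] by simp
    ultimately have "expectation (\<lambda>w. (\<nu> n B w)\<^sup>2) \<le>
        V * (LBINT x. (d n x * indicator C x)\<^sup>2) + \<mu>\<^sup>2 * (LBINT x. \<bar>d n x * indicator C x\<bar>)\<^sup>2"
      using stoch_int_square[OF \<nu>[OF B, of n]] V_nonneg by (auto intro!: add_mono mult_left_mono)
    then show ?thesis
      using trunc_mean_le_sqrt[OF stoch_int_sq[OF \<nu>[OF B, of n]]] B
      by (auto simp: Q_def intro: order_trans)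
  qed
  have small: "\<exists>k0. \<forall>k\<ge>k0. sqrt (V * (LBINT x. (h k x)\<^sup>2) + \<mu>\<^sup>2 * (LBINT x. \<bar>h k x\<bar>)\<^sup>2) \<le> e"
    if "e > 0" and w: "L12 w" and [measurable]: "\<And>k::nat. h k \<in> borel_measurable borel"
      and hlim: "AE x in lborel. (\<lambda>k. h k x) \<longlonglongrightarrow> 0" and dom: "\<And>k x. \<bar>h k x\<bar> \<le> \<bar>w x\<bar>" for e w h
  proof -
    have "(\<lambda>k. LBINT x. \<bar>h k x\<bar>) \<longlonglongrightarrow> 0" "(\<lambda>k. LBINT x. (h k x)\<^sup>2) \<longlonglongrightarrow> 0"
      using dominated_L12[OF w, of h "\<lambda>_. 0"] hlim dom by auto
    then have "(\<lambda>k. sqrt (V * (LBINT x. (h k x)\<^sup>2) + \<mu>\<^sup>2 * (LBINT x. \<bar>h k x\<bar>)\<^sup>2)) \<longlonglongrightarrow> sqrt (V * 0 + \<mu>\<^sup>2 * 0\<^sup>2)"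
      by (intro tendsto_intros)
    then have "\<forall>\<^sub>F k in sequentially. sqrt (V * (LBINT x. (h k x)\<^sup>2) + \<mu>\<^sup>2 * (LBINT x. \<bar>h k x\<bar>)\<^sup>2) < e"
      using \<open>e > 0\<close> by (intro order_tendstoD(2)) auto
    then show ?thesis by (auto simp: eventually_sequentially intro: less_imp_le)
  qed
  have QY: "(\<lambda>n. Q n A) \<longlonglongrightarrow> trunc_mean (\<lambda>w. Z w - S A w)"
    if A: "A \<in> sets borel" and Z: "Z \<in> borel_measurable M"
      and lim: "tendsto_in_prob (\<lambda>n. step_integral \<Lambda> A (g n)) Z sequentially" for A Z
  proof -
    have "(\<lambda>n. trunc_mean (\<lambda>w. step_integral \<Lambda> A (g n) w - Z w)) \<longlonglongrightarrow> 0"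
      using lim stoch_int_measurable[OF s[OF A]] Z by (simp add: tendsto_in_prob_iff_trunc_mean)
    then have "(\<lambda>n. trunc_mean (\<nu> n A)) \<longlonglongrightarrow> trunc_mean (\<lambda>w. Z w - S A w)"
      using \<nu>m[OF A] stoch_int_measurable[OF S[OF A]] Z
      by (intro trunc_mean_tendsto) (auto simp: \<nu>_def)
    then show ?thesis using A by (simp add: Q_def)
  qed
  have "(\<lambda>n. Q n (space borel)) \<longlonglongrightarrow> 0"
  proof (rule sliding_hump[where G = G])
    show "G k \<in> sets borel" for k by measurable
    show "G k \<subseteq> G l" if "k \<le> l" for k l
    proof
      fix x assume x: "x \<in> G k"
      have "real k \<le> real l" using that by simp
      then show "x \<in> G l" using x by (auto simp: G_def intro: order_trans)
    qed
    show "0 \<le> Q n A" for n A by (simp add: Q_def trunc_mean_nonneg)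
    show "Q n (A \<union> B) \<le> Q n A + Q n B" if AB: "A \<in> sets borel" "B \<in> sets borel" "A \<inter> B = {}" for n A B
    proof -
      have "trunc_mean (\<nu> n (A \<union> B)) = trunc_mean (\<lambda>w. \<nu> n A w + \<nu> n B w)"
        using additive[OF AB, of n] AB by (intro trunc_mean_cong_AE) (auto intro!: \<nu>m borel_measurable_add)
      then show ?thesis using trunc_mean_add_le[OF \<nu>m[OF AB(1)] \<nu>m[OF AB(2)], of n n] AB by (simp add: Q_def)
    qed
    show "Q n A \<le> Q n (A \<union> B) + Q n B" if AB: "A \<in> sets borel" "B \<in> sets borel" "A \<inter> B = {}" for n A B
    proof -
      have ABm: "A \<union> B \<in> sets borel" using AB by auto
      have "trunc_mean (\<nu> n A) = trunc_mean (\<lambda>w. \<nu> n (A \<union> B) w + - \<nu> n B w)"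
        using additive[OF AB, of n] AB
        by (intro trunc_mean_cong_AE) (auto intro!: \<nu>m borel_measurable_diff)
      also have "\<dots> \<le> trunc_mean (\<nu> n (A \<union> B)) + trunc_mean (\<lambda>w. - \<nu> n B w)"
        by (intro trunc_mean_add_le borel_measurable_uminus \<nu>m AB ABm)
      finally show ?thesis using AB ABm by (simp add: Q_def trunc_mean_uminus)
    qed
    show "convergent (\<lambda>n. Q n A)" if "A \<in> sets borel" for A
      using gA[OF that] QY[OF that] by (auto simp: convergent_def)
    show "\<exists>K. \<forall>k\<ge>K. \<forall>B\<in>sets borel. B \<inter> G k = {} \<longrightarrow> Q n B \<le> e" if "e > 0" for n e
    proof -
      have "AE x in lborel. (\<lambda>k. d n x * indicator (- G k) x) \<longlonglongrightarrow> 0"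
        using dlim
      proof eventually_elim
        case (elim x)
        \<comment> \<open>Where \<open>d n x\<close> converges it is bounded in \<open>n\<close>, so
          \<open>x\<close> lies in \<open>G k\<close> for all large \<open>k\<close>.\<close>
        then have "Bseq (\<lambda>n. d n x)" using convergentI convergent_imp_Bseq by blast
        then obtain c where c: "\<And>n. norm (d n x) \<le> c" by (auto simp: Bseq_def)
        have "\<forall>\<^sub>F k in sequentially. d n x * indicator (- G k) x = 0"
          using eventually_ge_at_top[of "nat \<lceil>max c \<bar>x\<bar>\<rceil>"]
        proof eventually_elim
          case (elim k)
          then have "max c \<bar>x\<bar> \<le> real k" by linarith
          then have "c \<le> real k" "\<bar>x\<bar> \<le> real k" by auto
          then have "x \<in> G k" using c by (auto simp: G_def intro: order_trans)
          then show ?case by simp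
        qed
        then show ?case by (rule tendsto_eventually)
      qed
      moreover have "\<bar>d n x * indicator (- G k) x\<bar> \<le> \<bar>d n x\<bar>" for k x by (simp add: indicator_def)
      moreover have "(\<lambda>x. d n x * indicator (- G k) x) \<in> borel_measurable borel" for k by measurable
      ultimately obtain K where K: "\<forall>k\<ge>K. sqrt (V * (LBINT x. (d n x * indicator (- G k) x)\<^sup>2)
          + \<mu>\<^sup>2 * (LBINT x. \<bar>d n x * indicator (- G k) x\<bar>)\<^sup>2) \<le> e"
        using small[OF \<open>e > 0\<close> Ld[of n], of "\<lambda>k x. d n x * indicator (- G k) x"] by blast
      have "Q n B \<le> e" if "k \<ge> K" "B \<in> sets borel" "B \<inter> G k = {}" for k B
      proof (rule order_trans[OF bound[of B "- G k" n] K[rule_format, OF that(1)]])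
        show "B \<subseteq> - G k" using that(3) by auto
      qed (use that(2) in auto)
      then show ?thesis by blast
    qed
    show "\<exists>n0. \<forall>n\<ge>n0. \<forall>B\<in>sets borel. B \<subseteq> G k \<longrightarrow> Q n B \<le> e" if "e > 0" for k e
    proof -
      have "AE x in lborel. (\<lambda>n. d n x * indicator (G k) x) \<longlonglongrightarrow> 0"
        using dlim by eventually_elim (rule tendsto_mult_left_zero)
      \<comment> \<open>Inside \<open>G k\<close> this fixed function dominates all
        \<open>d n\<close>.\<close>
      moreover have "L12 (\<lambda>x. real k * indicator {- real k..real k} x)"
        by (intro L12_cmult L12_indicator) (simp add: bounded_borel_def)
      moreover have "\<bar>d n x * indicator (G k) x\<bar> \<le> \<bar>real k * indicator {- real k..real k} x\<bar>" for n x
        by (auto simp: indicator_def G_def)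
      ultimately obtain n0 where "\<forall>n\<ge>n0. sqrt (V * (LBINT x. (d n x * indicator (G k) x)\<^sup>2)
          + \<mu>\<^sup>2 * (LBINT x. \<bar>d n x * indicator (G k) x\<bar>)\<^sup>2) \<le> e"
        using small[OF \<open>e > 0\<close>, of "\<lambda>x. real k * indicator {- real k..real k} x" "\<lambda>n x. d n x * indicator (G k) x"] by auto
      then have "\<forall>n\<ge>n0. \<forall>B\<in>sets borel. B \<subseteq> G k \<longrightarrow> Q n B \<le> e"
        using order_trans[OF bound[of _ "G k"]] Gm[of k] by blast
      then show ?thesis by blast
    qed
  qed
  moreover have "(\<lambda>n. Q n (space borel)) \<longlonglongrightarrow> trunc_mean (\<lambda>w. Y w - S UNIV w)"
    using QY[of UNIV Y] gY by simp
  \<comment> \<open>The same limit computed twice: from the convergence to \<open>Y\<close> and from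
    the sliding hump.\<close>
  ultimately have "trunc_mean (\<lambda>w. Y w - S UNIV w) = 0" using LIMSEQ_unique by blast
  moreover have SU: "stoch_int f (S UNIV)" using S[of UNIV] by simp
  moreover have [measurable]: "S UNIV \<in> borel_measurable M" by (rule stoch_int_measurable[OF SU])
  ultimately have "AE w in M. Y w - S UNIV w = 0" by (subst (asm) trunc_mean_eq_0_iff) auto
  then have "AE w in M. S UNIV w = Y w" by eventually_elim simp
  then show ?thesis by (intro stoch_int_cong_AE[OF SU]) auto
qed

text \<open>Both Hilbert choices get a witness; the last step then identifies whatever integral was
  chosen, which may stem from an arbitrary approximating sequence.\<close>

lemma stoch_int_levy_integral:
  assumes "L12 f"
  shows "stoch_int f (levy_integral L f)"
proof -
  have rm: "is_random_measure_of (random_measure_of L) L"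
    unfolding random_measure_of_def by (rule someI_ex[OF random_measure_exists])
  obtain Y where "stoch_int f Y" using stoch_int_exists[OF assms] by blast
  then have "\<exists>Y. has_random_integral (random_measure_of L) f Y"
    using has_random_integral_of_stoch_int[OF rm] by blast
  then have "has_random_integral (random_measure_of L) f (levy_integral L f)"
    unfolding levy_integral_def by (rule someI_ex)
  then show ?thesis by (rule stoch_int_of_has_random_integral[OF rm assms])
qed

end

section \<open>The two-sided process and the exponential kernel\<close>

lemma has_integral_exponential_density:
  assumes "0 < l"
  shows "has_bochner_integral lborel (exponential_density l) 1"
proof (rule has_bochner_integral_nn_integral)
  interpret prob_space "density lborel (exponential_density l)"
    by (rule prob_space_exponential_density[OF assms])
  show "(\<integral>\<^sup>+x. ennreal (exponential_density l x) \<partial>lborel) = ennreal 1"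
    using emeasure_space_1 by (simp add: emeasure_density)
qed (use assms in \<open>auto simp: exponential_density_nonneg\<close>)

text \<open>Between \<open>a\<close> and \<open>b\<close> the product is the constant
  \<open>exp (- l * (b - a))\<close>, and outside it decays at rate \<open>2 * l\<close>; so it is a
  combination of two exponential densities and the indicator of an interval.\<close>

lemma has_integral_exp_abs_mult:
  fixes l a b :: real
  assumes l: "0 < l" and ab: "a \<le> b"
  shows "has_bochner_integral lborel (\<lambda>u. exp (- l * \<bar>a - u\<bar>) * exp (- l * \<bar>b - u\<bar>))
    ((b - a) * exp (- l * (b - a)) + exp (- l * (b - a)) / l)"
proof -
  let ?E = "exponential_density (2 * l)"
  define c where "c = exp (- l * (b - a))"
  have E: "has_bochner_integral lborel ?E 1" using l by (intro has_integral_exponential_density) simp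
  have E1: "has_bochner_integral lborel (\<lambda>u. ?E (- b + 1 * u)) 1"
    using lborel_has_bochner_integral_real_affine_iff[of 1 ?E 1 "- b"] E by simp
  have E2: "has_bochner_integral lborel (\<lambda>u. ?E (a + (- 1) * u)) 1"
    using lborel_has_bochner_integral_real_affine_iff[of "- 1" ?E 1 a] E by simp
  have I: "has_bochner_integral lborel (indicat_real {a<..b}) (b - a)"
    using has_bochner_integral_real_indicator[of "{a<..b}" lborel] ab by (simp add: measure_def)
  \<comment> \<open>\<open>c / (2 * l)\<close> undoes the normalisation of the density, so that each
    outer piece starts with the value \<open>c\<close>.\<close>
  have "has_bochner_integral lborel
      (\<lambda>u. c / (2 * l) * ?E (- b + 1 * u) + c / (2 * l) * ?E (a + (- 1) * u) + c * indicat_real {a<..b} u)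
      (c / (2 * l) * 1 + c / (2 * l) * 1 + c * (b - a))"
    by (intro has_bochner_integral_add has_bochner_integral_mult_right E1 E2 I)
  also have "c / (2 * l) * 1 + c / (2 * l) * 1 + c * (b - a) = (b - a) * c + c / l"
    using l by (simp add: field_simps)
  finally have H: "has_bochner_integral lborel
      (\<lambda>u. c / (2 * l) * ?E (- b + 1 * u) + c / (2 * l) * ?E (a + (- 1) * u) + c * indicat_real {a<..b} u)
      ((b - a) * c + c / l)" .
  have "has_bochner_integral lborel (\<lambda>u. exp (- l * \<bar>a - u\<bar>) * exp (- l * \<bar>b - u\<bar>)) ((b - a) * c + c / l)"
  proof (rule has_bochner_integralI_AE[OF H])
    show "AE u in lborel. c / (2 * l) * ?E (- b + 1 * u) + c / (2 * l) * ?E (a + (- 1) * u) + c * indicat_real {a<..b} u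
        = exp (- l * \<bar>a - u\<bar>) * exp (- l * \<bar>b - u\<bar>)"
      \<comment> \<open>At the end points the pieces can overlap.\<close>
      using AE_lborel_singleton[of a] AE_lborel_singleton[of b]
    proof eventually_elim
      case (elim u)
      consider "u < a" | "a < u" "u < b" | "b < u" using elim by linarith
      then show ?case
      proof cases
        case 1
        then show ?thesis using l ab
          by (simp add: exponential_density_def c_def exp_add[symmetric] algebra_simps)
      next
        case 2
        then show ?thesis using l
          by (simp add: exponential_density_def c_def exp_add[symmetric] algebra_simps)
      next
        case 3
        then show ?thesis using l ab
          by (simp add: exponential_density_def c_def exp_add[symmetric] algebra_simps)
      qed
    qed
  qed simp
  then show ?thesis by (simp add: c_def)
qed

text \<open>The kernel is the square of the kernel with half the rate, so this is the case
  \<open>a = b\<close> of the product formula.\<close>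

lemma exp_abs_integral:
  fixes l a :: real
  assumes l: "0 < l"
  shows "has_bochner_integral lborel (\<lambda>u. exp (- l * \<bar>a - u\<bar>)) (2 / l)"
proof -
  have "exp (- (l / 2) * \<bar>a - u\<bar>) * exp (- (l / 2) * \<bar>a - u\<bar>) = exp (- l * \<bar>a - u\<bar>)" for u
    by (simp add: exp_add[symmetric])
  then show ?thesis
    using has_integral_exp_abs_mult[of "l / 2" a a] l by simp
qed

lemma L12_exp_abs:
  fixes l a :: real
  assumes l: "0 < l"
  shows "L12 (\<lambda>u. exp (- l * \<bar>a - u\<bar>))"
  using exp_abs_integral[OF l, of a] has_integral_exp_abs_mult[OF l, of a a]
  by (simp add: L12_def sq_integrable_def has_bochner_integral_iff power2_eq_square)

context prob_space
begin

section \<open>Increments of the two-sided process\<close>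

lemma moments_cong_AE:
  assumes "AE w in M. Y w = Z w" "Y \<in> borel_measurable M" "Z \<in> borel_measurable M"
  shows "sq_integrable M Y \<longleftrightarrow> sq_integrable M Z" "expectation Y = expectation Z"
    "expectation (\<lambda>w. (Y w)\<^sup>2) = expectation (\<lambda>w. (Z w)\<^sup>2)"
  by (rule distr_eq_moments[OF distr_cong_AE[OF refl refl assms(1) assms(2,3)] assms(2,3)])+

lemma variance_sq_integrable:
  assumes "sq_integrable M Y"
  shows "variance Y = expectation (\<lambda>w. (Y w)\<^sup>2) - (expectation Y)\<^sup>2"
  using assms by (intro variance_eq sq_integrable_integrable sq_integrable_square)

text \<open>At negative times the left limits of the second copy are almost surely its values. An
  increment on one side of 0 is therefore one of a single copy, and an increment across 0 is a sum
  of two independent ones.\<close>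

lemma two_sided_L2_increments:
  assumes two: "two_sided_levy_process L" and L1sq: "integrable M (\<lambda>w. (L 1 w)\<^sup>2)"
  shows "L2_increments M L (expectation (L 1)) (variance (L 1))"
proof -
  define \<mu> where "\<mu> = expectation (L 1)"
  define V where "V = variance (L 1)"
  have Lm [measurable]: "L t \<in> borel_measurable M" for t using two by (simp add: two_sided_levy_process_def)
  obtain L1 L2 where L1: "levy_process L1" and L2: "levy_process L2" and copies: "independent_copies L1 L2"
    and eq: "AE w in M. \<forall>t. L t w = (if t \<ge> 0 then L1 t w else - Lim (at_left (- t)) (\<lambda>s. L2 s w))"
    using two unfolding two_sided_levy_process_def by blast
  note m1 = levy_measurable[OF L1] and m2 = levy_measurable[OF L2]
  have pos: "AE w in M. L t w = L1 t w" if "0 \<le> t" for t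
    using eq by eventually_elim (use that in simp)
  \<comment> \<open>Time 0 is included because both copies start at 0 almost surely.\<close>
  have neg: "AE w in M. L t w = - L2 (- t) w" if "t \<le> 0" for t
  proof (cases "t = 0")
    case True
    have "AE w in M. L1 0 w = 0" "AE w in M. L2 0 w = 0" using L1 L2 by (auto simp: levy_process_def)
    with pos[of 0, OF order_refl] have "AE w in M. L 0 w = - L2 0 w" by eventually_elim simp
    then show ?thesis by (simp add: True)
  next
    case False
    then have "0 < - t" using that by simp
    from eq levy_left_limit[OF L2 this] show ?thesis
      by eventually_elim (use False that in auto)
  qed
  let ?N = "PiM {0..} (\<lambda>_. borel) :: (real \<Rightarrow> real) measure"
  define P1 where "P1 w = (\<lambda>t\<in>{0..}. L1 t w)" for w
  define P2 where "P2 w = (\<lambda>t\<in>{0..}. L2 t w)" for w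
  have paths: "indep_var ?N P1 ?N P2" and dist: "distr M ?N P1 = distr M ?N P2"
    using copies unfolding independent_copies_def P1_def[abs_def] P2_def[abs_def] by auto
  have P: "P1 \<in> measurable M ?N" "P2 \<in> measurable M ?N"
    using paths by (auto dest: indep_var_rv1 indep_var_rv2)
  have proj: "(\<lambda>f. f t) \<in> borel_measurable ?N" if "0 \<le> t" for t
    using that by (intro measurable_component_singleton) simp
  \<comment> \<open>Equality of the path laws passes the moments at time 1 from \<open>L1\<close> to
    \<open>L2\<close>.\<close>
  have dist1: "distr M borel (L1 1) = distr M borel (L2 1)"
  proof -
    have "distr M borel (L1 1) = distr (distr M ?N P1) borel (\<lambda>f. f 1)"
      using proj[of 1] P by (subst distr_distr) (auto simp: P1_def comp_def)
    also have "\<dots> = distr M borel (L2 1)"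
      unfolding dist using proj[of 1] P by (subst distr_distr) (auto simp: P2_def comp_def)
    finally show ?thesis .
  qed
  have sqL: "sq_integrable M (L 1)" using L1sq by (simp add: sq_integrable_def)
  note c1 = moments_cong_AE[OF pos[of 1] Lm m1[of 1], simplified]
  note c2 = distr_eq_moments[OF dist1 m1[of 1] m2[of 1], simplified]
  have sq: "sq_integrable M (L1 1)" "sq_integrable M (L2 1)" using sqL c1 c2 by simp_all
  have E: "expectation (L1 1) = \<mu>" "expectation (L2 1) = \<mu>" using c1 c2 by (simp_all add: \<mu>_def)
  have Va: "variance (L1 1) = V" "variance (L2 1) = V"
    using c1 c2 unfolding variance_sq_integrable[OF sq(1)] variance_sq_integrable[OF sq(2)] V_def variance_sq_integrable[OF sqL]
    by simp_all
  note mom1 = levy_moments[OF L1 sq(1), unfolded Va, unfolded E]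
  note mom2 = levy_moments[OF L2 sq(2), unfolded Va, unfolded E]
  \<comment> \<open>The moments are computed for an almost surely equal variable built from the
    copies and transferred afterwards.\<close>
  have key: "\<exists>Y. sq_integrable M Y \<and> expectation Y = \<mu> * (t - s) \<and>
      expectation (\<lambda>w. (Y w)\<^sup>2) = V * (t - s) + \<mu>\<^sup>2 * (t - s)\<^sup>2 \<and> (AE w in M. L t w - L s w = Y w)"
    if "s \<le> t" for s t
  proof -
    consider "0 \<le> s" | "t \<le> 0" | "s < 0" "0 < t" by linarith
    then show ?thesis
    proof cases
      case 1
      have "AE w in M. L t w - L s w = L1 t w - L1 s w"
        using pos[OF 1] pos[OF order_trans[OF 1 that]] by eventually_elim simp
      then show ?thesis using mom1[OF 1 that] by (intro exI[of _ "\<lambda>w. L1 t w - L1 s w"]) simp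
    next
      case 2
      have le: "0 \<le> - t" "- t \<le> - s" using 2 that by auto
      have "AE w in M. L t w - L s w = L2 (- s) w - L2 (- t) w"
        using neg[OF 2] neg[OF order_trans[OF that 2]] by eventually_elim simp
      then show ?thesis using mom2[OF le] by (intro exI[of _ "\<lambda>w. L2 (- s) w - L2 (- t) w"]) simp
    next
      case 3
      define A where "A w = L1 t w - L1 0 w" for w
      define B where "B w = L2 (- s) w - L2 0 w" for w
      have A: "sq_integrable M A" "expectation A = \<mu> * t" "expectation (\<lambda>w. (A w)\<^sup>2) = V * t + \<mu>\<^sup>2 * t\<^sup>2"
        using mom1[of 0 t] 3 unfolding A_def[abs_def] by simp_all
      have B: "sq_integrable M B" "expectation B = - \<mu> * s" "expectation (\<lambda>w. (B w)\<^sup>2) = - V * s + \<mu>\<^sup>2 * s\<^sup>2"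
        using mom2[of 0 "- s"] 3 unfolding B_def[abs_def] by simp_all
      have "indep_var borel ((\<lambda>f. f t - f 0) \<circ> P1) borel ((\<lambda>f. f (- s) - f 0) \<circ> P2)"
        using 3 by (intro indep_var_compose[OF paths] borel_measurable_diff proj) auto
      moreover have "(\<lambda>f. f t - f 0) \<circ> P1 = A" "(\<lambda>f. f (- s) - f 0) \<circ> P2 = B"
        using 3 by (auto simp: P1_def P2_def A_def B_def)
      ultimately have "indep_var borel A borel B" by simp
      then have AB: "expectation (\<lambda>w. A w * B w) = expectation A * expectation B"
        by (intro indep_var_lebesgue_integral sq_integrable_integrable A B)
      have "sq_integrable M (\<lambda>w. A w + B w)" using A B by (intro sq_integrable_add)
      moreover have "expectation (\<lambda>w. A w + B w) = \<mu> * (t - s)"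
        using A B by (simp add: sq_integrable_integrable algebra_simps)
      moreover have "expectation (\<lambda>w. (A w + B w)\<^sup>2) = V * (t - s) + \<mu>\<^sup>2 * (t - s)\<^sup>2"
        unfolding integral_square_add[OF A(1) B(1)] AB A B by (simp add: power2_eq_square algebra_simps)
      moreover have "AE w in M. L1 0 w = 0" "AE w in M. L2 0 w = 0" using L1 L2 by (auto simp: levy_process_def)
      then have "AE w in M. L t w - L s w = A w + B w"
        using pos[OF less_imp_le[OF 3(2)]] neg[OF less_imp_le[OF 3(1)]]
        by eventually_elim (simp add: A_def B_def)
      ultimately show ?thesis by blast
    qed
  qed
  have mom: "sq_integrable M (\<lambda>w. L t w - L s w) \<and> expectation (\<lambda>w. L t w - L s w) = \<mu> * (t - s) \<and>
      expectation (\<lambda>w. (L t w - L s w)\<^sup>2) = V * (t - s) + \<mu>\<^sup>2 * (t - s)\<^sup>2" if st: "s \<le> t" for s t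
  proof -
    obtain Y where Y: "sq_integrable M Y" "expectation Y = \<mu> * (t - s)"
      "expectation (\<lambda>w. (Y w)\<^sup>2) = V * (t - s) + \<mu>\<^sup>2 * (t - s)\<^sup>2" "AE w in M. L t w - L s w = Y w"
      using key[OF st] by blast
    have "(\<lambda>w. L t w - L s w) \<in> borel_measurable M" "Y \<in> borel_measurable M"
      using Y(1) by (auto simp: sq_integrable_def)
    from moments_cong_AE[OF Y(4) this] Y show ?thesis by simp
  qed
  have indep: "indep_vars (\<lambda>_. borel) (\<lambda>i w. L (r (Suc i)) w - L (r i) w) {..<n}"
    if r: "mono r" and zero: "0 \<in> r ` {..n}" for r :: "nat \<Rightarrow> real" and n
  proof -
    \<comment> \<open>The index of the grid point 0: the increments before it come from
      \<open>L2\<close>, the others from \<open>L1\<close>.\<close>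
    obtain k where k: "k \<le> n" "r k = 0" using zero by auto
    have t_neg: "r i \<le> 0" if "i \<le> k" for i using monoD[OF r that] k by simp
    have t_pos: "0 \<le> r i" if "k \<le> i" for i using monoD[OF r that] k by simp
    \<comment> \<open>Each increment as a functional of a single path, the form that
      \<open>indep_vars_union\<close> asks for.\<close>
    define e where "e i f = (if k \<le> i then f (r (Suc i)) - f (r i) else f (- r i) - f (- r (Suc i)))"
      for i and f :: "real \<Rightarrow> real"
    define X where "X i w = (if k \<le> i then e i (P1 w) else e i (P2 w))" for i w
    have X_pos: "X i = (\<lambda>w. L1 (r (Suc i)) w - L1 (r i) w)" if "k \<le> i" for i
      using that t_pos[of i] t_pos[of "Suc i"] by (auto simp: X_def e_def P1_def)
    have X_neg: "X i = (\<lambda>w. L2 (- r i) w - L2 (- r (Suc i)) w)" if "i < k" for i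
      using that t_neg[of i] t_neg[of "Suc i"] by (auto simp: X_def e_def P2_def)
    have "indep_vars (\<lambda>_. borel) X ({k..<n} \<union> {..<k})"
    proof (rule indep_vars_union[OF paths])
      show "e i \<in> borel_measurable ?N" if "i \<in> {k..<n}" for i
        using that t_pos[of i] t_pos[of "Suc i"] unfolding e_def by (auto intro!: borel_measurable_diff proj)
      show "e i \<in> borel_measurable ?N" if "i \<in> {..<k}" for i
        using that t_neg[of i] t_neg[of "Suc i"] unfolding e_def by (auto intro!: borel_measurable_diff proj)
      \<comment> \<open>Clipping at 0 makes the times admissible for \<open>L1\<close> and changes
        nothing from index \<open>k\<close> on.\<close>
      have "mono (\<lambda>i. max 0 (r i))" using r by (auto simp: mono_def max_def intro: order_trans)
      moreover have "0 \<le> max 0 (r 0)" by simp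
      ultimately have "indep_vars (\<lambda>_. borel) (\<lambda>i w. L1 (max 0 (r (Suc i))) w - L1 (max 0 (r i)) w) {..<n}"
        using L1[unfolded levy_process_def] by (elim conjE) (drule spec[of _ n], drule spec[of _ "\<lambda>i. max 0 (r i)"], simp)
      then have "indep_vars (\<lambda>_. borel) (\<lambda>i w. L1 (max 0 (r (Suc i))) w - L1 (max 0 (r i)) w) {k..<n}"
        by (rule indep_vars_subset) auto
      then show "indep_vars (\<lambda>_. borel) X {k..<n}"
        by (rule indep_vars_cong[THEN iffD1, rotated 3]) (use t_pos in \<open>auto simp: X_pos max_def\<close>)
      \<comment> \<open>The negative part of the grid run backwards; truncated subtraction freezes
        it beyond \<open>k\<close>.\<close>
      define q where "q j = - r (k - j)" for j
      have "mono q" unfolding q_def by (intro monoI) (auto intro!: monoD[OF r])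
      moreover have "0 \<le> q 0" using k by (simp add: q_def)
      ultimately have "indep_vars (\<lambda>_. borel) (\<lambda>i w. L2 (q (Suc i)) w - L2 (q i) w) {..<k}"
        using L2[unfolded levy_process_def] by (elim conjE) (drule spec[of _ k], drule spec[of _ q], simp)
      \<comment> \<open>Reversing the indices puts the increments of \<open>L2\<close> back into the
        order of the original grid.\<close>
      then have "indep_vars (\<lambda>_. borel) (\<lambda>i w. L2 (q (Suc (k - Suc i))) w - L2 (q (k - Suc i)) w) {..<k}"
        by (rule indep_vars_reindex_inj[of "\<lambda>i. k - Suc i", rotated]) (auto simp: inj_on_def)
      then show "indep_vars (\<lambda>_. borel) X {..<k}"
        by (rule indep_vars_cong[THEN iffD1, rotated 3]) (auto simp: X_neg q_def Suc_diff_Suc)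
    qed (auto simp: X_def)
    moreover have "{k..<n} \<union> {..<k} = {..<n}" using k by auto
    ultimately have "indep_vars (\<lambda>_. borel) X {..<n}" by simp
    then show ?thesis
    proof (rule indep_vars_cong_AE)
      fix i assume "i \<in> {..<n}"
      show "AE w in M. X i w = L (r (Suc i)) w - L (r i) w"
      proof (cases "k \<le> i")
        case True
        from pos[OF t_pos[OF True]] pos[OF t_pos[OF le_SucI[OF True]]] show ?thesis
          unfolding X_pos[OF True] by eventually_elim simp
      next
        case False
        then have ik: "i < k" by simp
        from neg[OF t_neg[OF less_imp_le[OF ik]]] neg[OF t_neg[OF Suc_leI[OF ik]]] show ?thesis
          unfolding X_neg[OF ik] by eventually_elim simp
      qed
    qed auto
  qed
  have incr: "sq_integrable M (\<lambda>w. L t w - L s w) \<and> expectation (\<lambda>w. L t w - L s w) = \<mu> * (t - s) \<and>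
      expectation (\<lambda>w. (L t w - L s w)\<^sup>2) = V * \<bar>t - s\<bar> + \<mu>\<^sup>2 * (t - s)\<^sup>2" for s t
  proof (cases "s \<le> t")
    case True
    then show ?thesis using mom[OF True] by simp
  next
    case False
    then have "t \<le> s" by simp
    note m = mom[OF this]
    have eq: "(\<lambda>w. L t w - L s w) = (\<lambda>w. - 1 * (L s w - L t w))" by auto
    have "sq_integrable M (\<lambda>w. L t w - L s w)" unfolding eq using m by (intro sq_integrable_cmult) simp
    moreover have "expectation (\<lambda>w. L t w - L s w) = \<mu> * (t - s)"
      unfolding eq integral_mult_right_zero using m by (simp add: algebra_simps)
    ultimately show ?thesis
      using m False by (simp add: power2_commute[of "L t _"] power2_commute[of t])
  qed
  have "L2_increments M L \<mu> V"
  proof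
    fix s t
    show "L t \<in> borel_measurable M" by (rule Lm)
    show "sq_integrable M (\<lambda>w. L t w - L s w)" using incr by blast
    show "expectation (\<lambda>w. L t w - L s w) = \<mu> * (t - s)" using incr by blast
    show "expectation (\<lambda>w. (L t w - L s w)\<^sup>2) = V * \<bar>t - s\<bar> + \<mu>\<^sup>2 * (t - s)\<^sup>2" using incr by blast
  qed (rule indep)
  then show ?thesis by (simp add: \<mu>_def V_def)
qed

lemma covariance_sq_integrable:
  assumes "sq_integrable M Y" "sq_integrable M Z"
  shows "covariance Y Z = expectation (\<lambda>w. Y w * Z w) - expectation Y * expectation Z"
proof -
  define a b where "a = expectation Y" and "b = expectation Z"
  have "covariance Y Z = expectation (\<lambda>w. Y w * Z w - b * Y w - a * Z w + a * b)"
    unfolding covariance_def a_def b_def by (simp add: algebra_simps)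
  also have "\<dots> = expectation (\<lambda>w. Y w * Z w) - b * a - a * b + a * b"
    using sq_integrable_mult[OF assms] sq_integrable_integrable[OF assms(1)] sq_integrable_integrable[OF assms(2)]
    by (simp add: prob_space a_def b_def)
  finally show ?thesis by (simp add: a_def b_def)
qed

end

theorem proposition4p1:
  fixes M :: "'a measure" and L X :: "real \<Rightarrow> 'a \<Rightarrow> real" and lam V \<mu> :: real
  assumes "prob_space M"
    and "lam > 0"
    and "prob_space.two_sided_levy_process M L"
    and "integrable M (\<lambda>\<omega>. (L 1 \<omega>)\<^sup>2)"
    and "V = prob_space.variance M (L 1)"
    and "\<mu> = prob_space.expectation M (L 1)"
    and "\<And>t. t \<ge> 0 \<Longrightarrow> X t \<in> borel_measurable M"
    and "\<And>t. t \<ge> 0 \<Longrightarrow>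
           AE \<omega> in M. X t \<omega> = prob_space.levy_integral M L (\<lambda>u. exp (- lam * \<bar>t - u\<bar>)) \<omega>"
  shows "\<forall>t\<ge>0. \<forall>h\<ge>0.
      integrable M (X t) \<and> integrable M (\<lambda>\<omega>. (X t \<omega>)\<^sup>2) \<and>
      prob_space.expectation M (X t) = 2 * \<mu> / lam \<and>
      prob_space.variance M (X t) = V / lam \<and>
      prob_space.covariance M (X (t + h)) (X t)
        = V * h * exp (- lam * h) + V / lam * exp (- lam * h) \<and>
      (V > 0 \<longrightarrow> prob_space.correlation M (X (t + h)) (X t)
        = lam * h * exp (- lam * h) + exp (- lam * h))"
proof -
  interpret prob_space M by fact
  interpret L2_increments M L \<mu> V
    unfolding assms(5,6) by (rule two_sided_L2_increments) fact+
  have X: "stoch_int (\<lambda>u. exp (- lam * \<bar>t - u\<bar>)) (X t)" if "t \<ge> 0" for t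
  proof (rule stoch_int_cong_AE[OF stoch_int_levy_integral[OF L12_exp_abs[OF assms(2), of t]]])
    show "AE w in M. levy_integral L (\<lambda>u. exp (- lam * \<bar>t - u\<bar>)) w = X t w"
      using assms(8)[OF that] by eventually_elim simp
  qed (use assms(7)[OF that] in auto)
  have sq: "sq_integrable M (X t)" if "t \<ge> 0" for t by (rule stoch_int_sq[OF X[OF that]])
  have mean: "expectation (X t) = 2 * \<mu> / lam" if "t \<ge> 0" for t
    using stoch_int_mean[OF X[OF that]] has_bochner_integral_integral_eq[OF exp_abs_integral[OF assms(2), of t]] by simp
  have cov: "covariance (X (t + h)) (X t) = V * h * exp (- lam * h) + V / lam * exp (- lam * h)"
    if th: "t \<ge> 0" "h \<ge> 0" for t h
  proof -
    have "(LBINT u. exp (- lam * \<bar>t - u\<bar>) * exp (- lam * \<bar>t + h - u\<bar>)) = h * exp (- lam * h) + exp (- lam * h) / lam"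
      using has_bochner_integral_integral_eq[OF has_integral_exp_abs_mult[OF assms(2), of t "t + h"]] th by simp
    then have "expectation (\<lambda>w. X t w * X (t + h) w)
        = V * (h * exp (- lam * h) + exp (- lam * h) / lam) + \<mu>\<^sup>2 * ((2 / lam) * (2 / lam))"
      using stoch_int_mult[OF X X, of t "t + h"] th
        has_bochner_integral_integral_eq[OF exp_abs_integral[OF assms(2), of t]]
        has_bochner_integral_integral_eq[OF exp_abs_integral[OF assms(2), of "t + h"]] by simp
    \<comment> \<open>The drift term, with factor \<open>(2 / lam) * (2 / lam)\<close>, cancels
      against the product of the two means.\<close>
    then show ?thesis
      using covariance_sq_integrable[OF sq sq, of "t + h" t] th mean[of t] mean[of "t + h"]
      by (simp add: mult.commute[of "X (t + h) _"] power2_eq_square algebra_simps)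
  qed
  \<comment> \<open>The covariance at lag 0.\<close>
  have var: "variance (X t) = V / lam" if "t \<ge> 0" for t
    using cov[OF that, of 0] by (simp add: covariance_def power2_eq_square)
  have corr: "correlation (X (t + h)) (X t) = lam * h * exp (- lam * h) + exp (- lam * h)"
    if "t \<ge> 0" "h \<ge> 0" "V > 0" for t h
  proof -
    have "0 < V / lam" using that assms(2) by simp
    then have "sqrt (V / lam) * sqrt (V / lam) = V / lam"
      by (simp only: real_sqrt_mult_self abs_of_pos)
    then have "correlation (X (t + h)) (X t) = (V * h * exp (- lam * h) + V / lam * exp (- lam * h)) / (V / lam)"
      using var[of "t + h"] var[of t] that unfolding correlation_def cov[OF that(1,2)] by simp
    also have "\<dots> = lam * h * exp (- lam * h) + exp (- lam * h)"
      using that assms(2) by (simp add: field_simps)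
    finally show ?thesis .
  qed
  show ?thesis
    by (intro allI impI conjI sq_integrable_integrable sq_integrable_square sq mean var cov corr; assumption)
qed

end
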